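(* Let $K$ be an infinite field, $n\ge 2$, and $S=K[x_1,\ldots,x_n]$. If $I\subset S$ is a monomial ideal such that the set $\mathrm{Ass}(S/I)$ of associated primes of $S/I$ is totally ordered by inclusion, then $$\mathrm{reg}(I)=\min\{e : I_{\ge e}\ \text{is stable}\}.$$
   Context: $S=K[x_1,\ldots,x_n]$ has the standard grading. For a monomial $u\ne 1$, $m(u)=\max\{i: x_i\mid u\}$. A monomial ideal $I$ is stable if for every monomial $u\in I$, $u\neq 1$, and every $i<m(u)$ one has $x_iu/x_{m(u)}\in I$. For an integer $e$, $I_{\ge e}$ is the ideal generated by the monomials of degree $\ge e$ in $I$. $\mathrm{reg}(I)$ is the Castelnuovo-Mumford regularity of $I$ as a graded $S$-module, $\mathrm{reg}(I)=\max\{j-i: \mathrm{Tor}_i^S(I,K)_j\ne 0\}$.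
   Formalization: Mended: I ≠ 0; the minimum is over e ≥ the largest degree of a minimal generator (else I = (x_1,…,x_n) fails); stability is for any renumbering of the variables making all associated primes (x_1,…,x_k), which is proved to exist (else I = (x_2) fails). *)

theory Defs
  imports Complex_Main "HOL-Library.Poly_Mapping" "HOL-Library.Cardinality"
begin

text \<open>
  The polynomial ring \<open>S = K[x\<^sub>1, \<dots>, x\<^sub>n]\<close> is the whole type \<open>('n, 'k) mpoly\<close>, where the finite type
  \<open>'n\<close> is the set of indeterminates (so \<open>n = CARD('n)\<close>) and \<open>'n \<Rightarrow>\<^sub>0 nat\<close> is the monoid of exponent
  vectors.  The order \<open>x\<^sub>1, \<dots>, x\<^sub>n\<close> of the indeterminates, on which stability depends, is kept
  separate: it is a numbering \<open>v\<close>, with \<open>v i\<close> the index of \<open>x\<^sub>i\<close> for \<open>1 \<le> i \<le> n\<close>.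
\<close>

type_synonym ('n, 'k) mpoly = "('n \<Rightarrow>\<^sub>0 nat) \<Rightarrow>\<^sub>0 'k"

definition monomial :: "('n \<Rightarrow>\<^sub>0 nat) \<Rightarrow> ('n, 'k::field) mpoly" where
  "monomial u = Poly_Mapping.single u 1"

definition var :: "'n \<Rightarrow> ('n, 'k::field) mpoly" where
  "var i = monomial (Poly_Mapping.single i 1)"

definition mdeg :: "('n::finite \<Rightarrow>\<^sub>0 nat) \<Rightarrow> nat" where
  "mdeg u = (\<Sum>i\<in>UNIV. Poly_Mapping.lookup u i)"

definition homogeneous :: "int \<Rightarrow> ('n::finite, 'k::field) mpoly \<Rightarrow> bool" where
  "homogeneous a f \<longleftrightarrow> (\<forall>u\<in>Poly_Mapping.keys f. int (mdeg u) = a)"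

definition constant_coeff :: "('n, 'k::field) mpoly \<Rightarrow> 'k" where
  "constant_coeff f = Poly_Mapping.lookup f 0"


section \<open>Ideals and associated primes\<close>

text \<open>The ideals of a commutative ring are its submodules: \<open>ideal.subspace I\<close> says that \<open>I\<close> is an
  ideal, and \<open>ideal.span A\<close> is the ideal generated by \<open>A\<close>.\<close>

interpretation ideal: module "(*) :: 'a::comm_ring_1 \<Rightarrow> 'a \<Rightarrow> 'a"
  by unfold_locales (simp_all add: algebra_simps)

definition prime_ideal :: "'a::comm_ring_1 set \<Rightarrow> bool" where
  "prime_ideal P \<longleftrightarrow>
     ideal.subspace P \<and> P \<noteq> UNIV \<and> (\<forall>a b. a * b \<in> P \<longrightarrow> a \<in> P \<or> b \<in> P)"

text \<open>\<open>Ass(S/I)\<close>: the annihilator of the residue class of \<open>f\<close> in \<open>S/I\<close> is \<open>{g. g * f \<in> I}\<close>.\<close>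

definition Ass :: "'a::comm_ring_1 set \<Rightarrow> 'a set set" where
  "Ass I = {P. prime_ideal P \<and> (\<exists>f. P = {g. g * f \<in> I})}"

definition monomial_ideal :: "('n, 'k::field) mpoly set \<Rightarrow> bool" where
  "monomial_ideal I \<longleftrightarrow> (\<exists>M. I = ideal.span (monomial ` M))"

definition truncation :: "('n::finite, 'k::field) mpoly set \<Rightarrow> int \<Rightarrow> ('n, 'k) mpoly set" where
  "truncation I e = ideal.span (monomial ` {u. monomial u \<in> I \<and> e \<le> int (mdeg u)})"

text \<open>Exponents of the minimal monomial generators of a monomial ideal: the monomials of \<open>I\<close> with no
  proper divisor in \<open>I\<close>.\<close>

definition min_gens :: "('n, 'k::field) mpoly set \<Rightarrow> ('n \<Rightarrow>\<^sub>0 nat) set" where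
  "min_gens I = {u. monomial u \<in> I \<and>
     (\<forall>w. monomial w \<in> I \<and> (\<forall>i. Poly_Mapping.lookup w i \<le> Poly_Mapping.lookup u i) \<longrightarrow> w = u)}"


section \<open>Numberings of the indeterminates and stable ideals\<close>

definition numbering :: "(nat \<Rightarrow> 'n::finite) \<Rightarrow> bool" where
  "numbering v \<longleftrightarrow> bij_betw v {1..CARD('n)} UNIV"

text \<open>\<open>max_var v u\<close> is \<open>m(u)\<close>; meaningful for \<open>u \<noteq> 0\<close>, i.e. for monomials other than 1.\<close>

definition max_var :: "(nat \<Rightarrow> 'n::finite) \<Rightarrow> ('n \<Rightarrow>\<^sub>0 nat) \<Rightarrow> nat" where
  "max_var v u = Max {i \<in> {1..CARD('n)}. 0 < Poly_Mapping.lookup u (v i)}"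

definition stable_ideal :: "(nat \<Rightarrow> 'n::finite) \<Rightarrow> ('n, 'k::field) mpoly set \<Rightarrow> bool" where
  "stable_ideal v I \<longleftrightarrow> monomial_ideal I \<and>
     (\<forall>u. monomial u \<in> I \<and> u \<noteq> 0 \<longrightarrow>
       (\<forall>i. 1 \<le> i \<and> i < max_var v u \<longrightarrow>
         monomial (u + Poly_Mapping.single (v i) 1 - Poly_Mapping.single (v (max_var v u)) 1) \<in> I))"

text \<open>The numberings for which every associated prime of \<open>S/I\<close> is \<open>(x\<^sub>1, \<dots>, x\<^sub>k)\<close> for some \<open>k\<close>.
  Such a renumbering is needed: although \<open>Ass(S/(x\<^sub>2)) = {(x\<^sub>2)}\<close> is totally ordered, no truncation of
  \<open>(x\<^sub>2)\<close> is stable in the order \<open>x\<^sub>1, x\<^sub>2\<close>.\<close>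

definition adapted_numbering ::
    "('n::finite, 'k::field) mpoly set \<Rightarrow> (nat \<Rightarrow> 'n) \<Rightarrow> bool" where
  "adapted_numbering I v \<longleftrightarrow> numbering v \<and>
     (\<forall>P\<in>Ass I. \<exists>k\<le>CARD('n). P = ideal.span ((\<lambda>i. var (v i)) ` {1..k}))"


section \<open>Graded free resolutions, Tor and regularity\<close>

text \<open>
  A sequence of graded free \<open>S\<close>-modules \<open>F\<^sub>i = \<Oplus>\<^bsub>p < frank i\<^esub> S(-shift i p)\<close> with an augmentation
  \<open>F\<^sub>0 \<rightarrow> S\<close>, \<open>e\<^sub>p \<mapsto> aug p\<close>, and maps \<open>F\<^bsub>i+1\<^esub> \<rightarrow> F\<^sub>i\<close>, \<open>e\<^sub>p \<mapsto> \<Sum>\<^bsub>q < frank i\<^esub> diff i p q \<cdot> e\<^sub>q\<close>.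
  Note that \<open>diff i\<close> starts at \<open>F\<^bsub>i+1\<^esub>\<close>.  Elements of \<open>F\<^sub>i\<close> are coordinate functions, of which only the
  values below \<open>frank i\<close> matter.
\<close>

record (overloaded) ('n, 'k) free_complex =
  frank :: "nat \<Rightarrow> nat"
  shift :: "nat \<Rightarrow> nat \<Rightarrow> int"
  aug :: "nat \<Rightarrow> ('n, 'k) mpoly"
  diff :: "nat \<Rightarrow> nat \<Rightarrow> nat \<Rightarrow> ('n, 'k) mpoly"

definition aug_map ::
    "('n, 'k::field) free_complex \<Rightarrow> (nat \<Rightarrow> ('n, 'k) mpoly) \<Rightarrow> ('n, 'k) mpoly" where
  "aug_map F f = (\<Sum>p<frank F 0. f p * aug F p)"

definition diff_map ::
    "('n, 'k::field) free_complex \<Rightarrow> nat \<Rightarrow> (nat \<Rightarrow> ('n, 'k) mpoly) \<Rightarrow> nat \<Rightarrow> ('n, 'k) mpoly" where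
  "diff_map F i f q = (\<Sum>p<frank F (Suc i). f p * diff F i p q)"

definition graded_free_resolution ::
    "('n::finite, 'k::field) free_complex \<Rightarrow> ('n, 'k) mpoly set \<Rightarrow> bool" where
  "graded_free_resolution F I \<longleftrightarrow>
     \<comment> \<open>the maps are homogeneous of degree 0\<close>
     (\<forall>p<frank F 0. homogeneous (shift F 0 p) (aug F p)) \<and>
     (\<forall>i. \<forall>p<frank F (Suc i). \<forall>q<frank F i.
        homogeneous (shift F (Suc i) p - shift F i q) (diff F i p q)) \<and>
     \<comment> \<open>exactness of \<open>\<dots> \<rightarrow> F\<^sub>1 \<rightarrow> F\<^sub>0 \<rightarrow> I \<rightarrow> 0\<close>\<close>
     range (aug_map F) = I \<and>
     (\<forall>f. aug_map F f = 0 \<longleftrightarrow> (\<exists>g. \<forall>p<frank F 0. f p = diff_map F 0 g p)) \<and>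
     (\<forall>i f. (\<forall>q<frank F i. diff_map F i f q = 0) \<longleftrightarrow>
        (\<exists>g. \<forall>p<frank F (Suc i). f p = diff_map F (Suc i) g p))"

text \<open>
  \<open>F\<^sub>i \<otimes> K\<close>, for \<open>K = S/(x\<^sub>1, \<dots>, x\<^sub>n)\<close>, is \<open>\<Oplus>\<^bsub>p < frank i\<^esub> K(-shift i p)\<close>.  Its component of degree \<open>j\<close>
  is spanned by the basis elements with \<open>shift i p = j\<close>, and the maps of \<open>F \<otimes> K\<close> are given by the
  constant coefficients of the matrices of \<open>F\<close>.
\<close>

definition tensor_component ::
    "('n, 'k::field) free_complex \<Rightarrow> nat \<Rightarrow> int \<Rightarrow> (nat \<Rightarrow> 'k) set" where
  "tensor_component F i j = {c. \<forall>p. c p \<noteq> 0 \<longrightarrow> p < frank F i \<and> shift F i p = j}"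

definition tensor_diff ::
    "('n, 'k::field) free_complex \<Rightarrow> nat \<Rightarrow> (nat \<Rightarrow> 'k) \<Rightarrow> nat \<Rightarrow> 'k" where
  "tensor_diff F i c q =
     (if q < frank F i then \<Sum>p<frank F (Suc i). c p * constant_coeff (diff F i p q) else 0)"

fun tensor_cycles :: "('n, 'k::field) free_complex \<Rightarrow> nat \<Rightarrow> int \<Rightarrow> (nat \<Rightarrow> 'k) set" where
  "tensor_cycles F 0 j = tensor_component F 0 j"
| "tensor_cycles F (Suc i) j = {c \<in> tensor_component F (Suc i) j. tensor_diff F i c = (\<lambda>_. 0)}"

definition tensor_boundaries ::
    "('n, 'k::field) free_complex \<Rightarrow> nat \<Rightarrow> int \<Rightarrow> (nat \<Rightarrow> 'k) set" where
  "tensor_boundaries F i j = tensor_diff F i ` tensor_component F (Suc i) j"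

text \<open>As usual, \<open>Tor\<close> is computed from a chosen graded free resolution of \<open>I\<close>.\<close>

definition resolution :: "('n::finite, 'k::field) mpoly set \<Rightarrow> ('n, 'k) free_complex" where
  "resolution I = (SOME F. graded_free_resolution F I)"

text \<open>\<open>Tor\<^sub>i(I, K)\<^sub>j\<close> as a quotient of \<open>K\<close>-vector spaces, given by its set of cosets.\<close>

definition Tor :: "('n::finite, 'k::field) mpoly set \<Rightarrow> nat \<Rightarrow> int \<Rightarrow> (nat \<Rightarrow> 'k) set set" where
  "Tor I i j =
     (\<lambda>c. {c'. (\<lambda>p. c' p - c p) \<in> tensor_boundaries (resolution I) i j})
       ` tensor_cycles (resolution I) i j"

text \<open>The zero space is the one whose only element is the coset of 0, i.e. the space of boundaries.\<close>

definition Tor_nonzero :: "('n::finite, 'k::field) mpoly set \<Rightarrow> nat \<Rightarrow> int \<Rightarrow> bool" where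
  "Tor_nonzero I i j \<longleftrightarrow> Tor I i j \<noteq> {tensor_boundaries (resolution I) i j}"

definition regularity :: "('n::finite, 'k::field) mpoly set \<Rightarrow> int" where
  "regularity I = Max {j - int i |i j. Tor_nonzero I i j}"

definition is_minimum :: "int \<Rightarrow> int set \<Rightarrow> bool" where
  "is_minimum r A \<longleftrightarrow> r \<in> A \<and> (\<forall>e\<in>A. r \<le> e)"

end

(*
For monomial ideals and any numbering, "e bounds the degrees of the generators and I_{>= e} is stable"
is equivalent to a saturation condition C(e): if u is a monomial in x_1, ..., x_k of degree at least e
and x_k u lies in I, then so does u.

Dimension shifting along an arbitrary graded free resolution identifies Tor(I, K) with the homology of
the Koszul complex of I.  In degrees j > i + e, condition C(e) allows one to contract each multidegree
of that complex by multiplying with its last variable, so reg(I) <= e.  Conversely, if e is least with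
C(e), a violation u of C(e - 1), with index k, is killed modulo I by x_1, ..., x_k, and
u e_1 ^ ... ^ e_k is a nonzero Koszul class of S/I, which gives Tor_{k-1}(I, K) in degree e + k - 1.

That C(e) holds for some e is where the associated primes enter: otherwise there are u outside I with
x_k u in I and an exponent at some x_j, j < k, exceeding all exponents of generators, and then S/I has
an associated prime containing x_k but not x_j.
*)

theory Submission
  imports Defs "HOL-Library.Function_Algebras"
begin

text \<open>\<open>Tor\<close> is read off a resolution picked by Hilbert choice, so some resolution
  has to exist and the answer must not depend on which one was picked. The Taylor complex settles
  existence. For independence, no two resolutions are compared: each is compared with the Koszul
  complex of I, in which no resolution occurs. Both complexes consist of the faces of a simplex with
  monomial labels, and in each multidegree they reduce to the simplicial boundary. Hence one
  contraction, \<open>cone\<close>, serves three times, with different apex vertices: some variable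
  dividing the multidegree for free modules, some generator dividing it for the Taylor complex, and
  the last variable of the multidegree for I.

  The bound on the generator degrees is essential. Truncations of a stable ideal are stable, so for
  I = (x_1^3), whose regularity is 3, every integer e gives a stable \<open>truncation I e\<close>;
  only the generator bound singles out 3.\<close>

abbreviation lookup :: "('a \<Rightarrow>\<^sub>0 'b::zero) \<Rightarrow> 'a \<Rightarrow> 'b" where "lookup \<equiv> Poly_Mapping.lookup"
abbreviation keys :: "('a \<Rightarrow>\<^sub>0 'b::zero) \<Rightarrow> 'a set" where "keys \<equiv> Poly_Mapping.keys"
abbreviation single :: "'a \<Rightarrow> 'b::zero \<Rightarrow> ('a \<Rightarrow>\<^sub>0 'b)" where "single \<equiv> Poly_Mapping.single"

section \<open>Monomials\<close>

definition divides :: "('n \<Rightarrow>\<^sub>0 nat) \<Rightarrow> ('n \<Rightarrow>\<^sub>0 nat) \<Rightarrow> bool" (infix "\<preceq>" 50) where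
  "u \<preceq> w \<longleftrightarrow> (\<forall>i. lookup u i \<le> lookup w i)"

lemma divides_refl [simp]: "u \<preceq> u"
  by (simp add: divides_def)

lemma divides_zero [simp]: "0 \<preceq> u"
  by (simp add: divides_def)

lemma divides_trans: "u \<preceq> w \<Longrightarrow> w \<preceq> t \<Longrightarrow> u \<preceq> t"
  by (auto simp: divides_def intro: order_trans)

lemma divides_antisym: "u \<preceq> w \<Longrightarrow> w \<preceq> u \<Longrightarrow> u = w"
  by (intro poly_mapping_eqI) (meson divides_def order_antisym)

lemma divides_add [simp]: "u \<preceq> u + w" "u \<preceq> w + u"
  by (simp_all add: divides_def lookup_add)

lemma divides_diff_add: "u \<preceq> w \<Longrightarrow> (w - u) + u = w"
  by (intro poly_mapping_eqI) (simp add: divides_def lookup_add lookup_minus)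

lemma single_divides_iff: "single i (Suc 0) \<preceq> u \<longleftrightarrow> 0 < lookup u i"
  by (auto simp: divides_def lookup_single when_def Suc_le_eq)

lemma single_divides: "0 < lookup u i \<Longrightarrow> single i 1 \<preceq> u"
  by (simp add: single_divides_iff)

lemma mdeg_zero [simp]: "mdeg 0 = 0"
  by (simp add: mdeg_def)

lemma mdeg_add: "mdeg (u + w) = mdeg u + mdeg w"
  by (simp add: mdeg_def lookup_add sum.distrib)

lemma mdeg_single [simp]: "mdeg (single i c) = c"
  by (simp add: mdeg_def lookup_single when_def)

lemma mdeg_eq_0_iff: "mdeg u = 0 \<longleftrightarrow> u = 0"
  by (auto simp: mdeg_def intro: poly_mapping_eqI)

lemma mdeg_diff_add: "u \<preceq> w \<Longrightarrow> mdeg (w - u) + mdeg u = mdeg w"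
  by (metis divides_diff_add mdeg_add)

lemma mdeg_mono: "u \<preceq> w \<Longrightarrow> mdeg u \<le> mdeg w"
  by (metis mdeg_diff_add le_add2)

lemma divides_eq_if_mdeg: "u \<preceq> w \<Longrightarrow> mdeg w \<le> mdeg u \<Longrightarrow> u = w"
  by (metis divides_diff_add mdeg_diff_add mdeg_eq_0_iff add_0 add_le_same_cancel2 le_zero_eq)

lemma mdeg_pos_obtain:
  assumes "0 < mdeg u"
  obtains i where "0 < lookup u i"
  using assms that by (force simp: mdeg_def intro: ccontr)

lemma poly_mapping_sum_single: "f = (\<Sum>u\<in>keys f. single u (lookup f u))"
  by (intro poly_mapping_eqI) (auto simp: lookup_sum lookup_single when_def in_keys_iff)

lemma lookup_single_mult:
  fixes p :: "('n, 'k::field) mpoly"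
  shows "lookup (single m c * p) a = (if m \<preceq> a then c * lookup p (a - m) else 0)"
proof -
  have eq: "(a = m + q) \<longleftrightarrow> m \<preceq> a \<and> a - m = q" for q
    by (metis add_diff_cancel_left' divides_add(1) divides_diff_add add.commute)
  have "lookup (single m c * p) a = c * (\<Sum>q. lookup p q when a = m + q)"
    by (simp add: lookup_mult lookup_single when_mult)
  also have "(\<Sum>q. lookup p q when a = m + q) = (if m \<preceq> a then lookup p (a - m) else 0)"
    unfolding eq by (cases "m \<preceq> a") (simp_all add: eq_commute [of "a - m"])
  finally show ?thesis by simp
qed

lemma lookup_monomial_mult:
  "lookup (monomial m * p) a = (if m \<preceq> a then lookup p (a - m) else (0::'k::field))"
  by (simp add: monomial_def lookup_single_mult)

lemma monomial_mult: "monomial u * monomial w = monomial (u + w)"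
  by (simp add: monomial_def mult_single)

lemma monomial_zero: "monomial 0 = 1"
  by (simp add: monomial_def)

lemma keys_monomial [simp]: "keys (monomial u :: ('n, 'k::field) mpoly) = {u}"
  by (simp add: monomial_def)

lemma lookup_monomial: "lookup (monomial u :: ('n, 'k::field) mpoly) w = (if w = u then 1 else 0)"
  by (simp add: monomial_def lookup_single when_def)

text \<open>Only 0 + 0 gives exponent 0, so taking the constant coefficient is the ring map S
  \<rightarrow> K that kills the variables. It turns matrices over S into those of the complex
  tensored with K.\<close>

lemma constant_coeff_mult:
  "constant_coeff (f * g) = constant_coeff f * constant_coeff (g :: ('n, 'k::field) mpoly)"
proof -
  have "constant_coeff (single u c * g) = constant_coeff (single u c) * constant_coeff g" for u c
    by (auto simp: constant_coeff_def lookup_single_mult lookup_single when_def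
        dest: divides_antisym [OF _ divides_zero])
  then have "constant_coeff ((\<Sum>u\<in>keys f. single u (lookup f u)) * g) =
      constant_coeff (\<Sum>u\<in>keys f. single u (lookup f u)) * constant_coeff g"
    unfolding constant_coeff_def sum_distrib_right lookup_sum by simp
  then show ?thesis
    using poly_mapping_sum_single [of f] by simp
qed

lemma constant_coeff_diff: "constant_coeff (f - g) = constant_coeff f - constant_coeff g"
  by (simp add: constant_coeff_def lookup_minus)

lemma constant_coeff_sum: "constant_coeff (sum f A) = (\<Sum>x\<in>A. constant_coeff (f x))"
  by (simp add: constant_coeff_def lookup_sum)

section \<open>Homogeneous components\<close>

lemma homogeneous_zero [simp]: "homogeneous a 0"
  by (simp add: homogeneous_def)

lemma homogeneous_add: "homogeneous a f \<Longrightarrow> homogeneous a g \<Longrightarrow> homogeneous a (f + g)"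
  using keys_add [of f g] by (fastforce simp: homogeneous_def)

lemma homogeneous_uminus: "homogeneous a f \<Longrightarrow> homogeneous a (- f)"
  by (simp add: homogeneous_def in_keys_iff)

lemma homogeneous_diff: "homogeneous a f \<Longrightarrow> homogeneous a g \<Longrightarrow> homogeneous a (f - g)"
  using homogeneous_add [of a f "- g"] by (simp add: homogeneous_uminus)

lemma homogeneous_sum: "(\<And>x. x \<in> A \<Longrightarrow> homogeneous a (f x)) \<Longrightarrow> homogeneous a (sum f A)"
  by (induction A rule: infinite_finite_induct) (auto intro: homogeneous_add)

lemma homogeneous_mult: "homogeneous a f \<Longrightarrow> homogeneous b g \<Longrightarrow> homogeneous (a + b) (f * g)"
  using keys_mult [of f g] by (fastforce simp: homogeneous_def mdeg_add)

lemma homogeneous_monomial: "homogeneous (int (mdeg u)) (monomial u)"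
  by (simp add: homogeneous_def)

lemma homogeneous_neg_eq_0: "homogeneous a f \<Longrightarrow> a < 0 \<Longrightarrow> f = 0"
  by (metis homogeneous_def keys_eq_empty of_nat_less_0_iff all_not_in_conv)

definition hcomp :: "int \<Rightarrow> ('n::finite, 'k::field) mpoly \<Rightarrow> ('n, 'k) mpoly" where
  "hcomp a f = Poly_Mapping.mapp (\<lambda>u c. if int (mdeg u) = a then c else 0) f"

lemma lookup_hcomp: "lookup (hcomp a f) u = (if int (mdeg u) = a then lookup f u else 0)"
  by (auto simp: hcomp_def lookup_mapp when_def in_keys_iff)

lemma homogeneous_hcomp [simp]: "homogeneous a (hcomp a f)"
  by (auto simp: homogeneous_def in_keys_iff lookup_hcomp split: if_splits)

lemma hcomp_sum: "hcomp a (sum f A) = (\<Sum>x\<in>A. hcomp a (f x))"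
  by (rule poly_mapping_eqI) (simp add: lookup_hcomp lookup_sum)

lemma hcomp_id: "homogeneous a f \<Longrightarrow> hcomp a f = f"
  by (rule poly_mapping_eqI) (auto simp: lookup_hcomp homogeneous_def in_keys_iff)

text \<open>No monomial of f outside degree a - b, times one of the homogeneous g, lands in degree
  a. This is why suitable homogeneous parts of preimages under graded maps are again
  preimages.\<close>

lemma hcomp_mult:
  assumes "homogeneous b g"
  shows "hcomp a (f * g) = hcomp (a - b) f * g"
proof (rule poly_mapping_eqI)
  fix u
  have split: "f * g = hcomp (a - b) f * g + (f - hcomp (a - b) f) * g"
    by (simp add: algebra_simps)
  have hom: "homogeneous a (hcomp (a - b) f * g)"
    using homogeneous_mult [OF homogeneous_hcomp assms, of "a - b" f] by simp
  have rest: "int (mdeg w) \<noteq> a" if w: "w \<in> keys ((f - hcomp (a - b) f) * g)" for w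
  proof -
    obtain s t where "w = s + t" "s \<in> keys (f - hcomp (a - b) f)" "t \<in> keys g"
      using subsetD [OF keys_mult w] by blast
    then show ?thesis
      using assms by (fastforce simp: in_keys_iff lookup_minus lookup_hcomp mdeg_add homogeneous_def
          split: if_splits)
  qed
  show "lookup (hcomp a (f * g)) u = lookup (hcomp (a - b) f * g) u"
  proof (cases "int (mdeg u) = a")
    case True
    then have "lookup ((f - hcomp (a - b) f) * g) u = 0"
      using rest by (auto simp: in_keys_iff)
    then show ?thesis
      using True by (subst split) (simp add: lookup_hcomp lookup_add)
  next
    case False
    then show ?thesis
      using hom by (auto simp: lookup_hcomp homogeneous_def in_keys_iff)
  qed
qed

section \<open>Monomial ideals\<close>

text \<open>The polynomials all of whose monomials are multiples of members of M form an ideal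
  containing the generators; conversely each of their terms is a multiple of a generator. Membership
  thus becomes divisibility of exponents.\<close>

lemma mem_span_monomials:
  fixes f :: "('n, 'k::field) mpoly"
  shows "f \<in> ideal.span (monomial ` M) \<longleftrightarrow> (\<forall>u\<in>keys f. \<exists>m\<in>M. m \<preceq> u)"
proof
  let ?T = "{f :: ('n, 'k) mpoly. \<forall>u\<in>keys f. \<exists>m\<in>M. m \<preceq> u}"
  have "ideal.subspace ?T"
  proof (rule ideal.subspaceI)
    show "x + y \<in> ?T" if "x \<in> ?T" "y \<in> ?T" for x y
      using that keys_add [of x y] by blast
    show "c * x \<in> ?T" if "x \<in> ?T" for c x
      using that keys_mult [of c x] by (fastforce intro: divides_trans [OF _ divides_add(2)])
  qed simp
  then have "ideal.span (monomial ` M) \<subseteq> ?T"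
    by (intro ideal.span_minimal) (auto intro: divides_refl)
  then show "f \<in> ideal.span (monomial ` M) \<Longrightarrow> \<forall>u\<in>keys f. \<exists>m\<in>M. m \<preceq> u"
    by blast
next
  assume *: "\<forall>u\<in>keys f. \<exists>m\<in>M. m \<preceq> u"
  have "single u c \<in> ideal.span (monomial ` M)" if "u \<in> keys f" for u and c :: 'k
  proof -
    obtain m where "m \<in> M" "m \<preceq> u" using * \<open>u \<in> keys f\<close> by blast
    then have "single u c = single (u - m) c * monomial m"
      by (simp add: monomial_def mult_single divides_diff_add)
    with \<open>m \<in> M\<close> show ?thesis
      by (simp add: ideal.span_base ideal.span_scale)
  qed
  then show "f \<in> ideal.span (monomial ` M)"
    by (subst poly_mapping_sum_single) (intro ideal.span_sum)
qed

lemma monomial_mem_span: "monomial u \<in> ideal.span (monomial ` M) \<longleftrightarrow> (\<exists>m\<in>M. m \<preceq> u)"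
  by (simp add: mem_span_monomials)

lemma monomial_ideal_mem_iff:
  assumes "monomial_ideal I"
  shows "f \<in> I \<longleftrightarrow> (\<forall>u\<in>keys f. monomial u \<in> I)"
  using assms unfolding monomial_ideal_def by (metis mem_span_monomials monomial_mem_span)

lemma monomial_ideal_subspace: "monomial_ideal I \<Longrightarrow> ideal.subspace I"
  unfolding monomial_ideal_def by auto

lemma monomial_ideal_divides:
  assumes "monomial_ideal I" "monomial u \<in> I" "u \<preceq> w"
  shows "monomial w \<in> I"
  using assms unfolding monomial_ideal_def by (metis monomial_mem_span divides_trans)

lemma monomial_mem_truncation:
  "monomial_ideal I \<Longrightarrow> monomial u \<in> truncation I e \<longleftrightarrow> monomial u \<in> I \<and> e \<le> int (mdeg u)"
  unfolding truncation_def monomial_mem_span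
  by (auto intro: monomial_ideal_divides dest: mdeg_mono)

lemma monomial_ideal_truncation: "monomial_ideal (truncation I e)"
  unfolding truncation_def monomial_ideal_def by blast

lemma min_gens_divides:
  fixes I :: "('n::finite, 'k::field) mpoly set"
  assumes "monomial u \<in> I"
  shows "\<exists>m\<in>min_gens I. m \<preceq> u"
  using assms
proof (induction "mdeg u" arbitrary: u rule: less_induct)
  case less
  show ?case
  proof (cases "u \<in> min_gens I")
    case False
    then obtain w where w: "monomial w \<in> I" "w \<preceq> u" "w \<noteq> u"
      using less.prems by (auto simp: min_gens_def divides_def)
    then have "mdeg w < mdeg u"
      by (meson divides_eq_if_mdeg not_le)
    then show ?thesis
      using less.hyps w divides_trans by blast
  qed (use divides_refl in blast)
qed

lemma min_gens_span:
  fixes I :: "('n::finite, 'k::field) mpoly set"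
  assumes "monomial_ideal I"
  shows "I = ideal.span (monomial ` min_gens I)"
proof -
  have "monomial u \<in> I \<longleftrightarrow> (\<exists>m\<in>min_gens I. m \<preceq> u)" for u
    using min_gens_divides monomial_ideal_divides [OF assms]
    by (auto simp: min_gens_def)
  then show ?thesis
    by (intro set_eqI, subst monomial_ideal_mem_iff [OF assms]) (simp add: mem_span_monomials)
qed

section \<open>Dickson's lemma: finiteness of the set of minimal generators\<close>

lemma exists_monotone_subsequence:
  fixes f :: "nat \<Rightarrow> 'n \<Rightarrow> nat"
  assumes "finite A"
  shows "\<exists>r :: nat \<Rightarrow> nat. strict_mono r \<and> (\<forall>i\<in>A. mono (\<lambda>m. f (r m) i))"
  using assms
proof (induction A rule: finite_induct)
  case empty
  show ?case by (auto intro: exI [of _ "\<lambda>m. m"] simp: strict_mono_def)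
next
  case (insert x A)
  then obtain r :: "nat \<Rightarrow> nat" where r: "strict_mono r" "\<forall>i\<in>A. mono (\<lambda>m. f (r m) i)" by blast
  obtain s :: "nat \<Rightarrow> nat" where s: "strict_mono s" "monoseq (\<lambda>m. f (r (s m)) x)"
    using seq_monosub [of "\<lambda>m. f (r m) x"] by (auto simp: o_def)
  have "\<exists>t :: nat \<Rightarrow> nat. strict_mono t \<and> mono (\<lambda>m. f (r (s (t m))) x)"
  proof (cases "mono (\<lambda>m. f (r (s m)) x)")
    case True
    then show ?thesis by (intro exI [of _ id]) (auto simp: strict_mono_def)
  next
    case False
    then have dec: "\<forall>m. \<forall>n\<ge>m. f (r (s n)) x \<le> f (r (s m)) x"
      using s(2) by (auto simp: monoseq_def mono_def)
    \<comment> \<open>A weakly decreasing sequence of naturals is constant from the place where it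
      attains its least value, hence also weakly increasing from there on.\<close>
    define N where "N = (ARG_MIN (\<lambda>m. f (r (s m)) x) m. True)"
    have "f (r (s N)) x \<le> f (r (s m)) x" for m
      unfolding N_def by (rule arg_min_nat_le) simp
    then have "f (r (s (N + m))) x = f (r (s N)) x" for m
      using dec by (meson le_add1 order_antisym)
    then show ?thesis
      by (intro exI [of _ "\<lambda>m. N + m"]) (auto simp: strict_mono_def mono_def)
  qed
  then obtain t :: "nat \<Rightarrow> nat" where t: "strict_mono t" "mono (\<lambda>m. f (r (s (t m))) x)" by blast
  have "mono (\<lambda>m. f (r (s (t m))) i)" if "i \<in> A" for i
    using r(2) s(1) t(1) that by (simp add: mono_def strict_mono_less_eq)
  then show ?case
    using r(1) s(1) t by (intro exI [of _ "\<lambda>m. r (s (t m))"] conjI ballI) (auto simp: strict_mono_def)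
qed

text \<open>Along a subsequence on which all exponents increase weakly, the first of two distinct
  minimal generators would divide the second.\<close>

lemma finite_min_gens: "finite (min_gens (I :: ('n::finite, 'k::field) mpoly set))"
proof (rule ccontr)
  assume "infinite (min_gens I)"
  then obtain g :: "nat \<Rightarrow> ('n \<Rightarrow>\<^sub>0 nat)" where g: "inj g" "\<forall>m. g m \<in> min_gens I"
    using infinite_iff_countable_subset by (metis range_subsetD)
  obtain r :: "nat \<Rightarrow> nat" where r: "strict_mono r" "\<forall>i. mono (\<lambda>m. lookup (g (r m)) i)"
    using exists_monotone_subsequence [of UNIV "\<lambda>m. lookup (g m)"] by auto
  have "lookup (g (r 0)) i \<le> lookup (g (r 1)) i" for i
    using r(2) by (auto simp: mono_def)
  then have "g (r 0) = g (r 1)"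
    using g(2) by (auto simp: min_gens_def)
  then show False
    using g(1) r(1) by (auto dest!: injD simp: strict_mono_eq)
qed

section \<open>Chains on a labelled simplex\<close>

text \<open>Meant for l \<notin> T: the sign of T as a facet of \<open>insert l T\<close>, given by
  the position of l among the vertices.\<close>

definition ksign :: "nat \<Rightarrow> nat set \<Rightarrow> 'a::comm_ring_1" where
  "ksign l T = (- 1) ^ card {t \<in> T. t < l}"

lemma ksign_square: "ksign l T * ksign l T = 1"
  by (simp add: ksign_def flip: power_mult_distrib)

lemma ksign_nonzero: "(ksign l T :: 'a::field) \<noteq> 0"
  by (simp add: ksign_def)

lemma ksign_empty [simp]: "ksign l {} = 1"
  by (simp add: ksign_def)

text \<open>Inserting the smaller of k and l shifts the position of the larger by one, while
  inserting the larger leaves the position of the smaller alone: exactly one sign changes.\<close>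

lemma ksign_swap:
  assumes "finite T" "k \<noteq> l" "k \<notin> T" "l \<notin> T"
  shows "ksign l (insert k T) * ksign k (insert l T) = - (ksign l T * ksign k T :: 'a::comm_ring_1)"
proof -
  have *: "ksign l (insert k T) * ksign k (insert l T) = - (ksign l T * ksign k T :: 'a)"
    if "k < l" "k \<notin> T" for k l
  proof -
    have "{t \<in> insert k T. t < l} = insert k {t \<in> T. t < l}" "{t \<in> insert l T. t < k} = {t \<in> T. t < k}"
      using \<open>k < l\<close> by auto
    then show ?thesis using \<open>finite T\<close> \<open>k \<notin> T\<close> by (simp add: ksign_def)
  qed
  show ?thesis
    using *[of k l] *[of l k] assms by (cases k l rule: linorder_cases) (simp_all add: mult.commute)
qed

lemma ksign_exchange:
  assumes "finite T" "k \<noteq> l" "k \<notin> T" "l \<notin> T"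
  shows "ksign l T * ksign k (insert l T) = - (ksign k T * ksign l (insert k T) :: 'a::comm_ring_1)"
proof -
  have "a * d = - (b * c)" if "c * d = - (a * b)" "a * a = 1" "c * c = 1" for a b c d :: 'a
  proof -
    have "a * d = (c * c) * (a * d)" by (simp only: that mult_1)
    also have "\<dots> = (c * d) * (a * c)" by (simp only: mult_ac)
    also have "\<dots> = - ((a * a) * (b * c))" by (simp only: that(1) mult_minus_left mult_minus_right mult_ac)
    finally show ?thesis by (simp only: that mult_1)
  qed
  from this [OF ksign_swap [OF assms] ksign_square ksign_square] show ?thesis .
qed

text \<open>The terms for (l, m) and (m, l) cancel. The diagonal is left out of the sum, so
  characteristic 2 is no exception.\<close>

lemma sum_antisymmetric:
  fixes a :: "nat \<Rightarrow> nat \<Rightarrow> 'a::ab_group_add"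
  assumes "finite A" "\<And>l m. l \<in> A \<Longrightarrow> m \<in> A \<Longrightarrow> l \<noteq> m \<Longrightarrow> a l m = - a m l"
  shows "(\<Sum>l\<in>A. \<Sum>m\<in>A - {l}. a l m) = 0"
  using assms
proof (induction A rule: finite_induct)
  case (insert x A)
  have "(\<Sum>m\<in>insert x A - {l}. a l m) = a l x + (\<Sum>m\<in>A - {l}. a l m)" if "l \<in> A" for l
  proof -
    have "insert x A - {l} = insert x (A - {l})" using that insert.hyps by auto
    then show ?thesis using insert.hyps by simp
  qed
  moreover have "insert x A - {x} = A" using insert.hyps by auto
  ultimately have "(\<Sum>l\<in>insert x A. \<Sum>m\<in>insert x A - {l}. a l m) =
      (\<Sum>m\<in>A. a x m + a m x) + (\<Sum>l\<in>A. \<Sum>m\<in>A - {l}. a l m)"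
    using insert.hyps by (simp add: sum.distrib add_ac)
  also have "(\<Sum>m\<in>A. a x m + a m x) = 0"
  proof (rule sum.neutral, rule ballI)
    fix m assume "m \<in> A"
    then have "a x m = - a m x" using insert.hyps by (intro insert.prems) auto
    then show "a x m + a m x = 0" by simp
  qed
  also have "(\<Sum>l\<in>A. \<Sum>m\<in>A - {l}. a l m) = 0"
    by (rule insert.IH) (rule insert.prems, auto)
  finally show ?case by simp
qed simp

text \<open>The boundary is written by coefficients: that of T collects the faces with one more
  vertex. Two vertices can be added in two orders, with opposite signs by
  \<open>ksign_exchange\<close>.\<close>

lemma simplex_boundary_boundary:
  fixes c :: "nat set \<Rightarrow> 'a::comm_ring_1"
  assumes "finite V" "T \<subseteq> V"
  shows "(\<Sum>l\<in>V - T. ksign l T * (\<Sum>m\<in>V - insert l T. ksign m (insert l T) * c (insert m (insert l T)))) = 0"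
proof -
  define a where "a = (\<lambda>l m. ksign l T * (ksign m (insert l T) * c (insert m (insert l T))))"
  have anti: "a l m = - a m l" if "l \<in> V - T" "m \<in> V - T" "l \<noteq> m" for l m
  proof -
    have "ksign l T * ksign m (insert l T) = - (ksign m T * ksign l (insert m T) :: 'a)"
      using that finite_subset [OF assms(2,1)] by (intro ksign_exchange) auto
    then show ?thesis
      unfolding a_def mult.assoc [symmetric] by (simp add: insert_commute)
  qed
  have eq: "V - insert l T = (V - T) - {l}" for l by (rule Diff_insert)
  have "(\<Sum>l\<in>V - T. \<Sum>m\<in>(V - T) - {l}. a l m) = 0"
    using \<open>finite V\<close> by (intro sum_antisymmetric anti) auto
  then show ?thesis
    unfolding a_def eq sum_distrib_left .
qed

text \<open>Coning with apex k moves the coefficient of T - {k}, up to sign, to the face T through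
  k. If k \<notin> T, only l = k contributes to the sum. If k \<in> T, the cycle condition at T -
  {k} expresses c T by the remaining faces.\<close>

lemma simplex_cone:
  fixes c :: "nat set \<Rightarrow> 'a::comm_ring_1"
  assumes "finite V" "T \<subseteq> V" "k \<in> V"
    and cycle: "\<And>T. T \<subseteq> V \<Longrightarrow> (\<Sum>l\<in>V - T. ksign l T * c (insert l T)) = 0"
  shows "(\<Sum>l\<in>V - T. ksign l T *
      (if k \<in> insert l T then ksign k (insert l T - {k}) * c (insert l T - {k}) else 0)) = c T"
    (is "?S = _")
proof (cases "k \<in> T")
  case False
  then have "?S = (\<Sum>l\<in>{k}. ksign l T * (ksign k (insert l T - {k}) * c (insert l T - {k})))"
    using assms(1,3) by (intro sum.mono_neutral_cong_right) auto
  then show ?thesis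
    using False by (simp add: ksign_square flip: mult.assoc)
next
  case True
  define T' where "T' = T - {k}"
  have T: "T = insert k T'" "k \<notin> T'" "T' \<subseteq> V" "finite T'"
    using True assms finite_subset [OF assms(2,1)] by (auto simp: T'_def)
  have "?S = (\<Sum>l\<in>V - T. - ksign k T' * (ksign l T' * c (insert l T')))"
  proof (rule sum.cong [OF refl])
    fix l assume l: "l \<in> V - T"
    then have "insert l T - {k} = insert l T'" "k \<noteq> l" "l \<notin> T'"
      using T by auto
    then show "ksign l T *
      (if k \<in> insert l T then ksign k (insert l T - {k}) * c (insert l T - {k}) else 0) =
        - ksign k T' * (ksign l T' * c (insert l T'))"
      using ksign_swap [of T' k l, where ?'a = 'a] T True by (simp flip: mult.assoc)
  qed
  also have "\<dots> = - ksign k T' * (\<Sum>l\<in>V - T. ksign l T' * c (insert l T'))"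
    by (simp add: sum_distrib_left)
  also have "(\<Sum>l\<in>V - T. ksign l T' * c (insert l T')) = - ksign k T' * c T"
  proof -
    have "V - T' = insert k (V - T)" using True \<open>k \<in> V\<close> by (auto simp: T'_def)
    moreover have "(\<Sum>l\<in>insert k (V - T). ksign l T' * c (insert l T')) =
        ksign k T' * c (insert k T') + (\<Sum>l\<in>V - T. ksign l T' * c (insert l T'))"
      using \<open>finite V\<close> True by (intro sum.insert) auto
    ultimately have "0 = ksign k T' * c T + (\<Sum>l\<in>V - T. ksign l T' * c (insert l T'))"
      using cycle [OF \<open>T' \<subseteq> V\<close>] unfolding T(1) [symmetric] by metis
    then show ?thesis by (simp add: eq_neg_iff_add_eq_0 add.commute)
  qed
  finally show ?thesis
    by (simp add: ksign_square flip: mult.assoc)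
qed

text \<open>The chains are those of the cellular complex of a simplex whose faces carry monomial labels.
  The Koszul complex is the case of the squarefree labels, the Taylor complex that of least common
  multiples.\<close>

locale labelled_simplex =
  fixes V :: "nat set" and lam :: "nat set \<Rightarrow> ('n::finite \<Rightarrow>\<^sub>0 nat)"
  assumes finite_V: "finite V"
    and lam_mono: "\<And>T l. T \<subseteq> V \<Longrightarrow> l \<in> V \<Longrightarrow> lam T \<preceq> lam (insert l T)"
begin

definition cdiff :: "(nat set \<Rightarrow> ('n, 'k::field) mpoly) \<Rightarrow> nat set \<Rightarrow> ('n, 'k) mpoly" where
  "cdiff z T =
    (if T \<subseteq> V then \<Sum>l\<in>V - T. single (lam (insert l T) - lam T) (ksign l T) * z (insert l T) else 0)"

text \<open>The coefficients of a chain in multidegree \<open>b\<close>, on which \<open>cdiff\<close> acts as the boundary of a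
  simplex.\<close>

definition cf :: "(nat set \<Rightarrow> ('n, 'k::field) mpoly) \<Rightarrow> ('n \<Rightarrow>\<^sub>0 nat) \<Rightarrow> nat set \<Rightarrow> 'k" where
  "cf z b T = (if lam T \<preceq> b then lookup (z T) (b - lam T) else 0)"

lemma cf_add_label: "cf z (a + lam T) T = lookup (z T) a"
  by (simp add: cf_def)

lemma cf_zero: "z T = 0 \<Longrightarrow> cf z b T = 0"
  by (simp add: cf_def)

text \<open>The quotient of labels in \<open>cdiff\<close> carries a coefficient in multidegree b at
  \<open>insert l T\<close> to multidegree b at T, so that only the signs remain. Faces whose label
  does not divide b drop out.\<close>

lemma cf_cdiff:
  assumes "T \<subseteq> V"
  shows "cf (cdiff z) b T = (\<Sum>l\<in>V - T. ksign l T * cf z b (insert l T))"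
proof -
  have *: "(if lam T \<preceq> b then lookup (single (lam (insert l T) - lam T) (ksign l T) * z (insert l T)) (b - lam T)
      else 0) = ksign l T * cf z b (insert l T)" if "l \<in> V - T" for l
  proof -
    have le: "lam T \<preceq> lam (insert l T)" using lam_mono assms that by auto
    then have "lam T \<preceq> b" if "lam (insert l T) \<preceq> b"
      using that divides_trans by blast
    moreover have "lam (insert l T) - lam T \<preceq> b - lam T \<longleftrightarrow> lam (insert l T) \<preceq> b" if "lam T \<preceq> b"
      using le that unfolding divides_def lookup_minus by (auto simp: le_diff_iff)
    moreover have "b - lam T - (lam (insert l T) - lam T) = b - lam (insert l T)"
      using le by (intro poly_mapping_eqI) (auto simp: lookup_minus divides_def)
    ultimately show ?thesis
      by (auto simp: lookup_single_mult cf_def)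
  qed
  have "cf (cdiff z) b T = (\<Sum>l\<in>V - T. if lam T \<preceq> b
      then lookup (single (lam (insert l T) - lam T) (ksign l T) * z (insert l T)) (b - lam T) else 0)"
    using assms by (simp add: cf_def cdiff_def lookup_sum)
  then show ?thesis
    by (simp only: * cong: sum.cong)
qed

lemma chain_eqI:
  assumes "\<And>b T. T \<subseteq> V \<Longrightarrow> cf z b T = cf z' b T" "\<And>T. \<not> T \<subseteq> V \<Longrightarrow> z T = z' T"
  shows "z = z'"
proof
  fix T
  show "z T = z' T"
    using assms(1) [of T] assms(2) [of T]
    by (cases "T \<subseteq> V") (auto intro!: poly_mapping_eqI simp flip: cf_add_label)
qed

lemma cdiff_outside: "\<not> T \<subseteq> V \<Longrightarrow> cdiff z T = 0"
  by (simp add: cdiff_def)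

lemma cdiff_cdiff: "cdiff (cdiff z) = (\<lambda>_. 0)"
proof (rule chain_eqI)
  fix b T assume "T \<subseteq> V"
  then have "cf (cdiff (cdiff z)) b T =
    (\<Sum>l\<in>V - T. ksign l T * (\<Sum>m\<in>V - insert l T. ksign m (insert l T) * cf z b (insert m (insert l T))))"
    by (simp add: cf_cdiff)
  then show "cf (cdiff (cdiff z)) b T = cf (\<lambda>_. 0) b T"
    using simplex_boundary_boundary [OF finite_V \<open>T \<subseteq> V\<close>] by (simp add: cf_def)
qed (simp add: cdiff_outside)

text \<open>In each multidegree \<open>b\<close> the cycle is coned off with the vertex \<open>kk b\<close>.\<close>

lemma cone:
  fixes z :: "nat set \<Rightarrow> ('n, 'k::field) mpoly"
  assumes outside: "\<And>T. \<not> T \<subseteq> V \<Longrightarrow> z T = 0"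
    and cycle: "\<And>T. cdiff z T = 0"
    and apex: "\<And>T a. T \<subseteq> V \<Longrightarrow> a \<in> keys (z T) \<Longrightarrow> kk (a + lam T) \<in> V"
    and cone: "\<And>T a. T \<subseteq> V \<Longrightarrow> a \<in> keys (z T) \<Longrightarrow> kk (a + lam T) \<notin> T \<Longrightarrow>
      lam (insert (kk (a + lam T)) T) \<preceq> a + lam T"
  obtains w where "cdiff w = z" "\<And>T. \<not> T \<subseteq> V \<Longrightarrow> w T = 0"
    "\<And>T a. a \<in> keys (w T) \<Longrightarrow> kk (a + lam T) \<in> T \<and>
      (\<exists>a'\<in>keys (z (T - {kk (a + lam T)})). a' + lam (T - {kk (a + lam T)}) = a + lam T)"
proof -
  \<comment> \<open>The cone over z, one multidegree at a time; \<open>w\<close> reassembles these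
    strands into polynomials.\<close>
  define W where "W b T = (if kk b \<in> T \<and> T \<subseteq> V then ksign (kk b) (T - {kk b}) * cf z b (T - {kk b}) else 0)"
    for b T
  define w where "w T = Abs_poly_mapping (\<lambda>a. W (a + lam T) T)" for T
  have cf_key: "b - lam T \<in> keys (z T)" "(b - lam T) + lam T = b" if "cf z b T \<noteq> 0" for b T
    using that by (auto simp: cf_def in_keys_iff divides_diff_add split: if_splits)
  have W_key: "\<exists>a'\<in>keys (z (T - {kk b})). a' + lam (T - {kk b}) = b" if "W b T \<noteq> 0" for b T
    using that cf_key [of b "T - {kk b}"] by (auto simp: W_def split: if_splits)
  have W_in: "kk b \<in> T" if "W b T \<noteq> 0" for b T
    using that by (auto simp: W_def split: if_splits)
  \<comment> \<open>A monomial of \<open>w T\<close> comes from one of some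
    \<open>z (T - {t})\<close>, and these are finite in number although the apex varies with the
    multidegree.\<close>
  have fin: "finite {a. W (a + lam T) T \<noteq> 0}" for T
  proof (cases "T \<subseteq> V")
    case True
    have "{a. W (a + lam T) T \<noteq> 0} \<subseteq> (\<Union>t\<in>T. (\<lambda>a'. a' + lam (T - {t}) - lam T) ` keys (z (T - {t})))"
    proof
      fix a assume "a \<in> {a. W (a + lam T) T \<noteq> 0}"
      then have "W (a + lam T) T \<noteq> 0" by simp
      then obtain a' where a': "a' \<in> keys (z (T - {kk (a + lam T)}))"
        "a' + lam (T - {kk (a + lam T)}) = a + lam T" and "kk (a + lam T) \<in> T"
        using W_key W_in by blast
      moreover have "a = a' + lam (T - {kk (a + lam T)}) - lam T"
        unfolding a'(2) by simp
      ultimately show "a \<in> (\<Union>t\<in>T. (\<lambda>a'. a' + lam (T - {t}) - lam T) ` keys (z (T - {t})))"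
        by blast
    qed
    then show ?thesis
      using finite_subset [OF True finite_V] by (auto intro: finite_subset)
  qed (simp add: W_def)
  have lookup_w: "lookup (w T) a = W (a + lam T) T" for T a
    using fin by (simp add: w_def)
  have cf_w: "cf w b T = W b T" if "T \<subseteq> V" for b T
  proof -
    \<comment> \<open>The hypothesis \<open>cone\<close> enters here: the label of the enlarged face
      has to divide b for the coefficient \<open>W b T\<close> to come from a chain.\<close>
    have "lam T \<preceq> b" if "W b T \<noteq> 0"
    proof -
      let ?T = "T - {kk b}"
      have T: "kk b \<in> T" "insert (kk b) ?T = T" "cf z b ?T \<noteq> 0" "?T \<subseteq> V"
        using that by (auto simp: W_def split: if_splits)
      then show ?thesis
        using cone [of ?T "b - lam ?T"] cf_key [of b ?T] by simp
    qed
    then show ?thesis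
      by (auto simp: cf_def lookup_w divides_diff_add)
  qed
  have zero_cycle: "(\<Sum>l\<in>V - T. ksign l T * cf z b (insert l T)) = 0" if "T \<subseteq> V" for b T
    using cf_cdiff [OF that, of z b] cycle by (simp add: cf_zero)
  have "cdiff w = z"
  proof (rule chain_eqI)
    fix b T assume T: "T \<subseteq> V"
    have "cf (cdiff w) b T = (\<Sum>l\<in>V - T. ksign l T * W b (insert l T))"
      unfolding cf_cdiff [OF T] by (intro sum.cong refl) (simp add: cf_w T)
    also have "\<dots> = cf z b T"
    proof (cases "kk b \<in> V")
      case True
      have "(\<Sum>l\<in>V - T. ksign l T * W b (insert l T)) = (\<Sum>l\<in>V - T. ksign l T *
        (if kk b \<in> insert l T then ksign (kk b) (insert l T - {kk b}) * cf z b (insert l T - {kk b}) else 0))"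
        using T by (intro sum.cong) (auto simp: W_def)
      then show ?thesis
        using simplex_cone [OF finite_V T True zero_cycle] by simp
    next
      case False
      then have "cf z b T = 0"
        using apex [OF T] cf_key by metis
      moreover have "W b T' = 0" for T'
        using False by (auto simp: W_def)
      ultimately show ?thesis by simp
    qed
    finally show "cf (cdiff w) b T = cf z b T" .
  qed (simp add: cdiff_outside outside)
  moreover have "w T = 0" if "\<not> T \<subseteq> V" for T
    using that by (intro poly_mapping_eqI) (simp add: lookup_w W_def)
  moreover have "kk (a + lam T) \<in> T \<and>
      (\<exists>a'\<in>keys (z (T - {kk (a + lam T)})). a' + lam (T - {kk (a + lam T)}) = a + lam T)"
    if "a \<in> keys (w T)" for T a
  proof -
    have "W (a + lam T) T \<noteq> 0" using that by (simp add: in_keys_iff lookup_w)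
    then show ?thesis using W_in W_key by blast
  qed
  ultimately show thesis by (rule that)
qed

end

section \<open>Koszul homology\<close>

lemma sum_fun_apply: "sum f A p = (\<Sum>x\<in>A. f x p)"
  by (induction A rule: infinite_finite_induct) simp_all

definition indices :: "(nat \<Rightarrow> 'n::finite) \<Rightarrow> nat set" where
  "indices v = {1..CARD('n)}"

locale koszul =
  fixes v :: "nat \<Rightarrow> 'n::finite"
  assumes numbering: "numbering v"
begin

abbreviation vars :: "nat set" where "vars \<equiv> indices v"

lemma finite_vars: "finite vars"
  by (simp add: indices_def)

definition sqf :: "nat set \<Rightarrow> ('n \<Rightarrow>\<^sub>0 nat)" where
  "sqf T = (\<Sum>t\<in>T. single (v t) 1)"

lemma v_eq_iff: "l \<in> vars \<Longrightarrow> t \<in> vars \<Longrightarrow> v l = v t \<longleftrightarrow> l = t"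
  using numbering unfolding numbering_def bij_betw_def indices_def by (metis inj_on_eq_iff)

lemma ex_var: "\<exists>t\<in>vars. x = v t"
  using numbering unfolding numbering_def bij_betw_def indices_def by blast

lemma finite_face: "T \<subseteq> vars \<Longrightarrow> finite T"
  using finite_subset finite_vars by blast

lemma lookup_sqf:
  assumes "T \<subseteq> vars" "t \<in> vars"
  shows "lookup (sqf T) (v t) = (if t \<in> T then 1 else 0)"
proof -
  have "lookup (sqf T) (v t) = (\<Sum>l\<in>T. if l = t then 1 else 0)"
    unfolding sqf_def lookup_sum lookup_single when_def
    using assms by (intro sum.cong refl) (auto simp: v_eq_iff subset_iff)
  then show ?thesis
    using finite_face [OF assms(1)] by simp
qed

lemma sqf_divides_iff:
  assumes "T \<subseteq> vars"
  shows "sqf T \<preceq> b \<longleftrightarrow> (\<forall>t\<in>T. 0 < lookup b (v t))"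
proof -
  have "(\<forall>x. P x) \<longleftrightarrow> (\<forall>t\<in>vars. P (v t))" for P
    using ex_var by metis
  then have "sqf T \<preceq> b \<longleftrightarrow> (\<forall>t\<in>vars. (if t \<in> T then 1 else 0) \<le> lookup b (v t))"
    using lookup_sqf [OF assms] by (simp add: divides_def)
  also have "\<dots> \<longleftrightarrow> (\<forall>t\<in>T. 0 < lookup b (v t))"
    using assms by (auto simp: Suc_le_eq)
  finally show ?thesis .
qed

lemma sqf_insert: "finite T \<Longrightarrow> l \<notin> T \<Longrightarrow> sqf (insert l T) = single (v l) 1 + sqf T"
  by (simp add: sqf_def)

lemma mdeg_sqf: "finite T \<Longrightarrow> mdeg (sqf T) = card T"
  by (induction T rule: finite_induct) (auto simp: sqf_insert mdeg_add, simp add: sqf_def)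

sublocale labelled_simplex vars sqf
proof
  show "sqf T \<preceq> sqf (insert l T)" if "T \<subseteq> vars" for T l
    using finite_face [OF that] by (cases "l \<in> T") (simp_all add: insert_absorb sqf_insert)
qed (rule finite_vars)

definition svar :: "nat \<Rightarrow> nat set \<Rightarrow> ('n, 'k::field) mpoly" where
  "svar l T = single (single (v l) 1) (ksign l T)"

lemma constant_coeff_svar [simp]: "constant_coeff (svar l T) = 0"
proof -
  have "single (v l) (1 :: nat) \<noteq> 0" by (metis lookup_single_eq lookup_zero zero_neq_one)
  then show ?thesis by (simp add: constant_coeff_def svar_def lookup_single when_def)
qed

lemma homogeneous_svar: "homogeneous 1 (svar l T)"
  by (simp add: homogeneous_def svar_def)

lemma cdiff_sqf:
  "cdiff z T = (if T \<subseteq> vars then \<Sum>l\<in>vars - T. svar l T * z (insert l T) else 0)"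
proof -
  have "sqf (insert l T) - sqf T = single (v l) 1" if "T \<subseteq> vars" "l \<notin> T" for l
    using that finite_face by (simp add: sqf_insert)
  then show ?thesis
    by (auto simp: cdiff_def svar_def intro!: sum.cong)
qed

text \<open>A module is a submodule of a free module, given by its homogeneous components; its elements
  are coordinate functions.\<close>

definition graded_submodule :: "(int \<Rightarrow> (nat \<Rightarrow> ('n, 'k::field) mpoly) set) \<Rightarrow> bool" where
  "graded_submodule M \<longleftrightarrow> (\<forall>j. 0 \<in> M j \<and> (\<forall>f\<in>M j. \<forall>g\<in>M j. f - g \<in> M j) \<and>
    (\<forall>f\<in>M j. \<forall>a. homogeneous 1 a \<longrightarrow> (\<lambda>p. a * f p) \<in> M (j + 1)))"

lemma graded_submodule_diff: "graded_submodule M \<Longrightarrow> f \<in> M j \<Longrightarrow> g \<in> M j \<Longrightarrow> f - g \<in> M j"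
  by (simp add: graded_submodule_def)

lemma graded_submodule_zero: "graded_submodule M \<Longrightarrow> 0 \<in> M j"
  by (simp add: graded_submodule_def)

lemma graded_submodule_sum:
  assumes M: "graded_submodule M" and "\<And>x. x \<in> A \<Longrightarrow> f x \<in> M j"
  shows "sum f A \<in> M j"
proof -
  have add: "a + b \<in> M j" if "a \<in> M j" "b \<in> M j" for a b
  proof -
    have "a - (0 - b) \<in> M j" using that M by (intro graded_submodule_diff graded_submodule_zero)
    then show ?thesis by simp
  qed
  show ?thesis
    using assms(2)
    by (induction A rule: infinite_finite_induct) (auto intro: add graded_submodule_zero [OF M])
qed

text \<open>The basis element of a face with q vertices has degree q, hence the coefficients in M (j
  - q). The value 0 on all other sets lets chains be compared by equality of functions.\<close>

definition chains ::
    "(int \<Rightarrow> (nat \<Rightarrow> ('n, 'k::field) mpoly) set) \<Rightarrow> nat \<Rightarrow> int \<Rightarrow> (nat set \<Rightarrow> nat \<Rightarrow> ('n, 'k) mpoly) set" where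
  "chains M q j = {z. \<forall>T. if T \<subseteq> vars \<and> card T = q then z T \<in> M (j - int q) else z T = 0}"

lemma chainsI:
  "(\<And>T. T \<subseteq> vars \<Longrightarrow> card T = q \<Longrightarrow> z T \<in> M (j - int q)) \<Longrightarrow>
    (\<And>T. \<not> (T \<subseteq> vars \<and> card T = q) \<Longrightarrow> z T = 0) \<Longrightarrow> z \<in> chains M q j"
  by (auto simp: chains_def)

lemma chains_mem: "z \<in> chains M q j \<Longrightarrow> T \<subseteq> vars \<Longrightarrow> card T = q \<Longrightarrow> z T \<in> M (j - int q)"
  by (auto simp: chains_def dest: spec [of _ T])

lemma chains_zero: "z \<in> chains M q j \<Longrightarrow> \<not> (T \<subseteq> vars \<and> card T = q) \<Longrightarrow> z T = 0"
  by (auto simp: chains_def dest: spec [of _ T])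

definition kd :: "(nat set \<Rightarrow> nat \<Rightarrow> ('n, 'k::field) mpoly) \<Rightarrow> nat set \<Rightarrow> nat \<Rightarrow> ('n, 'k) mpoly" where
  "kd z T p = cdiff (\<lambda>T. z T p) T"

lemma kd_eq: "kd z T = (if T \<subseteq> vars then \<Sum>l\<in>vars - T. (\<lambda>p. svar l T * z (insert l T) p) else 0)"
  by (rule ext) (simp add: kd_def cdiff_sqf sum_fun_apply)

lemma kd_kd: "kd (kd z) = 0"
proof (intro ext)
  fix T p
  have "kd (kd z) T p = cdiff (cdiff (\<lambda>T. z T p)) T"
    by (simp add: kd_def [abs_def])
  then show "kd (kd z) T p = 0 T p"
    by (simp add: cdiff_cdiff)
qed

lemma kd_diff: "kd (y - w) = kd y - kd w"
  by (intro ext) (simp add: kd_def cdiff_sqf algebra_simps sum_subtractf)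

lemma kd_zero: "kd 0 = 0"
  by (intro ext) (simp add: kd_def cdiff_sqf)

lemma chains_diff:
  assumes "graded_submodule M" "y \<in> chains M q j" "w \<in> chains M q j"
  shows "y - w \<in> chains M q j"
proof (rule chainsI)
  show "(y - w) T \<in> M (j - int q)" if "T \<subseteq> vars" "card T = q" for T
    using graded_submodule_diff [OF assms(1) chains_mem [OF assms(2) that] chains_mem [OF assms(3) that]]
    by simp
  show "(y - w) T = 0" if "\<not> (T \<subseteq> vars \<and> card T = q)" for T
    using chains_zero [OF assms(2) that] chains_zero [OF assms(3) that] by simp
qed

lemma kd_chains:
  assumes M: "graded_submodule M" and z: "z \<in> chains M (Suc q) j"
  shows "kd z \<in> chains M q j"
proof (rule chainsI)
  fix T assume T: "T \<subseteq> vars" "card T = q"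
  have "(\<lambda>p. svar l T * z (insert l T) p) \<in> M (j - int q)" if "l \<in> vars - T" for l
  proof -
    have "z (insert l T) \<in> M (j - int (Suc q))"
      using that T finite_face by (intro chains_mem [OF z]) auto
    then have "(\<lambda>p. svar l T * z (insert l T) p) \<in> M (j - int (Suc q) + 1)"
      using M homogeneous_svar unfolding graded_submodule_def by blast
    then show ?thesis by simp
  qed
  then show "kd z T \<in> M (j - int q)"
    using T graded_submodule_sum [OF M, of "vars - T" "\<lambda>l p. svar l T * z (insert l T) p"]
    by (simp only: kd_eq if_True)
next
  fix T assume "\<not> (T \<subseteq> vars \<and> card T = q)"
  then have "z (insert l T) = 0" if "T \<subseteq> vars" "l \<in> vars - T" for l
    using that finite_face by (intro chains_zero [OF z]) auto
  then show "kd z T = 0"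
    by (auto simp: kd_eq intro!: sum.neutral)
qed

text \<open>Koszul homology of M vanishes in homological degree q and internal degree j. For q = 0
  this says that M j consists of combinations of the variables with coefficients in M (j -
  1).\<close>

definition acyclic :: "(int \<Rightarrow> (nat \<Rightarrow> ('n, 'k::field) mpoly) set) \<Rightarrow> nat \<Rightarrow> int \<Rightarrow> bool" where
  "acyclic M q j \<longleftrightarrow> (\<forall>z\<in>chains M q j. kd z = 0 \<longrightarrow> (\<exists>w\<in>chains M (Suc q) j. kd w = z))"

text \<open>Injectivity of H_q(N)_j \<rightarrow> H_q(L)_j for N \<subseteq> L. It is kept apart
  from \<open>acyclic\<close> because a free module L can have homology in degree 0.\<close>

definition rel_acyclic ::
    "(int \<Rightarrow> (nat \<Rightarrow> ('n, 'k::field) mpoly) set) \<Rightarrow> (int \<Rightarrow> (nat \<Rightarrow> ('n, 'k) mpoly) set) \<Rightarrow> nat \<Rightarrow> int \<Rightarrow> bool" where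
  "rel_acyclic N L q j \<longleftrightarrow>
    (\<forall>z\<in>chains N q j. (\<exists>y\<in>chains L (Suc q) j. kd y = z) \<longrightarrow> (\<exists>w\<in>chains N (Suc q) j. kd w = z))"

lemma chains_mono: "(\<And>j. N j \<subseteq> L j) \<Longrightarrow> chains N q j \<subseteq> chains L q j"
  by (fastforce simp: chains_def)

text \<open>If H_q(L)_j vanishes, the cycles of N are exactly the chains of N that bound in
  L.\<close>

lemma rel_acyclic_iff:
  assumes "\<And>j. N j \<subseteq> L j" "acyclic L q j"
  shows "rel_acyclic N L q j \<longleftrightarrow> acyclic N q j"
proof -
  have "(\<exists>y\<in>chains L (Suc q) j. kd y = z) \<longleftrightarrow> kd z = 0" if "z \<in> chains N q j" for z
  proof
    show "kd z = 0" if "\<exists>y\<in>chains L (Suc q) j. kd y = z"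
      using that kd_kd by (elim bexE) (erule subst)
    show "\<exists>y\<in>chains L (Suc q) j. kd y = z" if "kd z = 0"
      using assms(2) that subsetD [OF chains_mono [OF assms(1)] \<open>z \<in> _\<close>] unfolding acyclic_def by simp
  qed
  then show ?thesis
    unfolding acyclic_def rel_acyclic_def by (intro ball_cong refl) simp
qed

end

text \<open>A short exact sequence N \<rightarrow> L \<rightarrow> M in each degree. N is the kernel
  itself rather than a module mapped onto it, so its chains are chains of L.\<close>

locale koszul_exact = koszul v for v :: "nat \<Rightarrow> 'n::finite" +
  fixes N L M :: "int \<Rightarrow> (nat \<Rightarrow> ('n, 'k::field) mpoly) set"
    and \<phi> :: "(nat \<Rightarrow> ('n, 'k) mpoly) \<Rightarrow> nat \<Rightarrow> ('n, 'k) mpoly"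
  assumes L: "graded_submodule L"
    and additive: "\<And>f g. \<phi> (f + g) = \<phi> f + \<phi> g"
    and scale: "\<And>a f. \<phi> (\<lambda>p. a * f p) = (\<lambda>p. a * \<phi> f p)"
    and maps: "\<And>f j. f \<in> L j \<Longrightarrow> \<phi> f \<in> M j"
    and surj: "\<And>m j. m \<in> M j \<Longrightarrow> \<exists>f\<in>L j. \<phi> f = m"
    and kernel: "\<And>j. N j = {f \<in> L j. \<phi> f = 0}"
begin

lemma map_zero: "\<phi> 0 = 0"
  using additive [of 0 0] by simp

lemma map_diff: "\<phi> (f - g) = \<phi> f - \<phi> g"
  using additive [of "f - g" g] by (simp add: algebra_simps)

lemma map_sum: "\<phi> (sum f A) = (\<Sum>x\<in>A. \<phi> (f x))"
  by (induction A rule: infinite_finite_induct) 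
      (metis sum.infinite map_zero, metis sum.empty map_zero, metis sum.insert additive)

lemma map_kd: "\<phi> (kd z T) = kd (\<lambda>T. \<phi> (z T)) T"
  by (simp add: kd_eq map_sum scale map_zero)

lemma map_chains: "z \<in> chains L q j \<Longrightarrow> (\<lambda>T. \<phi> (z T)) \<in> chains M q j"
  by (rule chainsI) (auto simp: map_zero intro!: maps dest: chains_mem chains_zero)

lemma lift_chains:
  assumes "z \<in> chains M q j"
  shows "\<exists>y\<in>chains L q j. \<forall>T. \<phi> (y T) = z T"
proof -
  have "\<exists>f. (if T \<subseteq> vars \<and> card T = q then f \<in> L (j - int q) else f = 0) \<and> \<phi> f = z T" for T
    using surj [of "z T" "j - int q"] chains_mem [OF assms, of T] chains_zero [OF assms, of T] map_zero
    by auto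
  then obtain y where "\<forall>T. (if T \<subseteq> vars \<and> card T = q then y T \<in> L (j - int q) else y T = 0) \<and> \<phi> (y T) = z T"
    by metis
  then show ?thesis
    by (intro bexI [of _ y]) (auto simp: chains_def)
qed

lemma kernel_chains: "z \<in> chains L q j \<Longrightarrow> (\<And>T. \<phi> (z T) = 0) \<Longrightarrow> z \<in> chains N q j"
  by (rule chainsI) (auto simp: kernel dest: chains_mem chains_zero)

text \<open>The stretch H_{q+1}(L) \<rightarrow> H_{q+1}(M) \<rightarrow> H_q(N) \<rightarrow>
  H_q(L) of the long exact sequence: where the first term vanishes, the second is the kernel of the
  last map.\<close>

lemma connecting:
  assumes L_acyclic: "acyclic L (Suc q) j"
  shows "acyclic M (Suc q) j \<longleftrightarrow> rel_acyclic N L q j"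
proof
  assume M: "acyclic M (Suc q) j"
  show "rel_acyclic N L q j"
    unfolding rel_acyclic_def
  proof (intro ballI impI, elim bexE)
    fix z y assume z: "z \<in> chains N q j" and y: "y \<in> chains L (Suc q) j" "kd y = z"
    have "\<phi> (z T) = 0" for T
      using chains_mem [OF z, of T] chains_zero [OF z, of T]
      by (cases "T \<subseteq> vars \<and> card T = q") (auto simp: kernel map_zero)
    then have "kd (\<lambda>T. \<phi> (y T)) = 0"
      by (intro ext) (simp add: y flip: map_kd)
    then obtain w where w: "w \<in> chains M (Suc (Suc q)) j" "kd w = (\<lambda>T. \<phi> (y T))"
      using M map_chains [OF y(1)] by (auto simp: acyclic_def)
    obtain w' where w': "w' \<in> chains L (Suc (Suc q)) j" "\<forall>T. \<phi> (w' T) = w T"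
      using lift_chains [OF w(1)] by blast
    \<comment> \<open>\<open>y\<close> and \<open>kd w'\<close> have the same image in M, and
      subtracting a boundary does not change \<open>kd y\<close>.\<close>
    have "\<phi> ((y - kd w') T) = 0" for T
      using w w' by (simp add: map_diff map_kd)
    then have "y - kd w' \<in> chains N (Suc q) j"
      using chains_diff [OF L y(1) kd_chains [OF L w'(1)]] kernel_chains by blast
    moreover have "kd (y - kd w') = z"
      by (simp add: kd_diff kd_kd y)
    ultimately show "\<exists>w\<in>chains N (Suc q) j. kd w = z" by blast
  qed
next
  assume N: "rel_acyclic N L q j"
  show "acyclic M (Suc q) j"
    unfolding acyclic_def
  proof (intro ballI impI)
    fix z assume z: "z \<in> chains M (Suc q) j" "kd z = 0"
    obtain y where y: "y \<in> chains L (Suc q) j" "\<forall>T. \<phi> (y T) = z T"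
      using lift_chains [OF z(1)] by blast
    \<comment> \<open>The lift of a cycle of M has its boundary in the kernel N.\<close>
    have "kd y \<in> chains N q j"
      using z(2) y by (intro kernel_chains kd_chains L) (simp_all add: map_kd)
    then obtain w where w: "w \<in> chains N (Suc q) j" "kd w = kd y"
      using N y(1) by (auto simp: rel_acyclic_def)
    have wL: "w \<in> chains L (Suc q) j"
      using w(1) chains_mono [of N L] kernel by blast
    have "kd (y - w) = 0"
      by (simp add: kd_diff w)
    then obtain u where u: "u \<in> chains L (Suc (Suc q)) j" "kd u = y - w"
      using L_acyclic chains_diff [OF L y(1) wL] unfolding acyclic_def by blast
    have "\<phi> (w T) = 0" for T
      using chains_mem [OF w(1), of T] chains_zero [OF w(1), of T]
      by (cases "T \<subseteq> vars \<and> card T = Suc q") (auto simp: kernel map_zero)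
    then have "kd (\<lambda>T. \<phi> (u T)) = z"
      using u(2) y(2) by (intro ext) (simp add: map_diff flip: map_kd)
    then show "\<exists>w\<in>chains M (Suc (Suc q)) j. kd w = z"
      using map_chains [OF u(1)] by blast
  qed
qed

end

section \<open>Koszul homology of free modules\<close>

context koszul
begin

definition free_module :: "nat \<Rightarrow> (nat \<Rightarrow> int) \<Rightarrow> int \<Rightarrow> (nat \<Rightarrow> ('n, 'k::field) mpoly) set" where
  "free_module r s j = {f. \<forall>p. if p < r then homogeneous (j - s p) (f p) else f p = 0}"

lemma graded_submodule_free: "graded_submodule (free_module r s :: int \<Rightarrow> (nat \<Rightarrow> ('n, 'k::field) mpoly) set)"
proof -
  have "homogeneous (j + 1 - s p) (a * f)" if "homogeneous 1 a" "homogeneous (j - s p) f"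
    for j p and a f :: "('n, 'k) mpoly"
    using homogeneous_mult [OF that] by (simp add: algebra_simps)
  then show ?thesis
    by (auto simp: graded_submodule_def free_module_def intro!: homogeneous_diff)
qed

text \<open>Any variable dividing the multidegree serves as apex: the label of a face enlarged by it
  still divides the multidegree. An apex is missing only in multidegree 0, where only the empty face
  lives; for q = 0 its coefficients there are excluded by \<open>const\<close>.\<close>

lemma free_exact:
  fixes z :: "nat set \<Rightarrow> nat \<Rightarrow> ('n, 'k::field) mpoly"
  assumes z: "z \<in> chains (free_module r s) q j" and cycle: "kd z = 0"
    and const: "q = 0 \<Longrightarrow> (\<And>p. constant_coeff (z {} p) = 0)"
  shows "\<exists>w\<in>chains (free_module r s) (Suc q) j. kd w = z"
proof -
  define kk where "kk b = (SOME t. t \<in> vars \<and> 0 < lookup b (v t))" for b :: "'n \<Rightarrow>\<^sub>0 nat"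
  have kk: "kk b \<in> vars \<and> 0 < lookup b (v (kk b))" if "b \<noteq> 0" for b
  proof -
    have "0 < mdeg b" using that by (simp add: mdeg_eq_0_iff zero_less_iff_neq_zero)
    then obtain x where "0 < lookup b x" by (rule mdeg_pos_obtain)
    then show ?thesis
      unfolding kk_def using ex_var [of x] by (intro someI_ex [of "\<lambda>t. t \<in> vars \<and> 0 < lookup b (v t)"]) auto
  qed
  have face: "card T = q" "T \<subseteq> vars" if "a \<in> keys (z T p)" for a T p
    using that chains_zero [OF z, of T] by (metis keys_zero zero_fun_apply empty_iff)+
  have nonzero: "a + sqf T \<noteq> 0" if "a \<in> keys (z T p)" for a T p
  proof
    assume "a + sqf T = 0"
    then have "mdeg a + card T = 0"
      using mdeg_sqf [OF finite_face [OF face(2) [OF that]]] by (metis mdeg_add mdeg_zero)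
    then have "a = 0" "card T = 0" by (simp_all add: mdeg_eq_0_iff)
    moreover from this have "T = {}" using face(2) [OF that] finite_face by auto
    ultimately show False
      using const face(1) [OF that] that by (auto simp: constant_coeff_def in_keys_iff)
  qed
  have cone_ok: "sqf (insert (kk (a + sqf T)) T) \<preceq> a + sqf T" if "a \<in> keys (z T p)" for a T p
    using kk [OF nonzero [OF that]] face(2) [OF that]
    by (subst sqf_divides_iff) (auto simp: lookup_add lookup_sqf subset_iff)
  have "\<exists>w. cdiff w = (\<lambda>T. z T p) \<and> (\<forall>T. \<not> T \<subseteq> vars \<longrightarrow> w T = 0) \<and>
    (\<forall>T. \<forall>a\<in>keys (w T). kk (a + sqf T) \<in> T \<and>
      (\<exists>a'\<in>keys (z (T - {kk (a + sqf T)}) p). a' + sqf (T - {kk (a + sqf T)}) = a + sqf T))" for p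
  proof (rule cone [of "\<lambda>T. z T p" kk])
    show "z T p = 0" if "\<not> T \<subseteq> vars" for T
      using that chains_zero [OF z, of T] by simp
    show "cdiff (\<lambda>T. z T p) T = 0" for T
      using fun_cong [OF fun_cong [OF cycle, of T], of p] by (simp add: kd_def)
  qed (use kk nonzero cone_ok in blast)+
  then obtain w where w: "\<And>p. cdiff (w p) = (\<lambda>T. z T p)" "\<And>p T. \<not> T \<subseteq> vars \<Longrightarrow> w p T = 0"
    "\<And>p T a. a \<in> keys (w p T) \<Longrightarrow> kk (a + sqf T) \<in> T \<and>
      (\<exists>a'\<in>keys (z (T - {kk (a + sqf T)}) p). a' + sqf (T - {kk (a + sqf T)}) = a + sqf T)"
    by metis
  \<comment> \<open>Passing from z to w adds a vertex to the face and removes a variable from the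
    coefficient, which keeps the internal degree.\<close>
  have w_key: "card T = Suc q \<and> p < r \<and> int (mdeg a) = j - int (Suc q) - s p" if a: "a \<in> keys (w p T)" for p T a
  proof -
    have T: "T \<subseteq> vars" using w(2) that by (metis keys_zero empty_iff)
    let ?T = "T - {kk (a + sqf T)}"
    obtain a' where a': "a' \<in> keys (z ?T p)" "a' + sqf ?T = a + sqf T" and kT: "kk (a + sqf T) \<in> T"
      using w(3) [OF a] by blast
    have card: "card ?T = q" "card T = Suc q"
      using face [OF a'(1)] card.remove [OF finite_face [OF T] kT] by simp_all
    have "z ?T \<in> free_module r s (j - int q)"
      using face [OF a'(1)] by (intro chains_mem [OF z]) auto
    then have "p < r" "int (mdeg a') = j - int q - s p"
      using a'(1) by (auto simp: free_module_def homogeneous_def in_keys_iff dest!: spec [of _ p] split: if_splits)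
    moreover have "mdeg a' + q = mdeg a + Suc q"
      using arg_cong [OF a'(2), of mdeg] T finite_face [OF T] card by (simp add: mdeg_add mdeg_sqf)
    ultimately show ?thesis using card by simp
  qed
  have "(\<lambda>T p. w p T) \<in> chains (free_module r s) (Suc q) j"
  proof (rule chainsI)
    show "(\<lambda>p. w p T) \<in> free_module r s (j - int (Suc q))" for T
    proof -
      have "homogeneous (j - int (Suc q) - s p) (w p T)" for p
        using w_key by (auto simp: homogeneous_def)
      moreover have "w p T = 0" if "\<not> p < r" for p
        using w_key [of _ p T] that by (intro poly_mapping_eqI) (simp add: in_keys_iff, blast)
      ultimately show ?thesis by (auto simp: free_module_def)
    qed
    show "(\<lambda>p. w p T) = 0" if "\<not> (T \<subseteq> vars \<and> card T = Suc q)" for T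
    proof
      fix p
      have "a \<notin> keys (w p T)" for a
        using w_key w(2) that by (metis keys_zero empty_iff)
      then show "w p T = 0 p" by (intro poly_mapping_eqI) (simp add: in_keys_iff)
    qed
  qed
  moreover have "kd (\<lambda>T p. w p T) = z"
    by (intro ext) (simp add: kd_def w(1))
  ultimately show ?thesis by blast
qed

lemma acyclic_free: "acyclic (free_module r s :: int \<Rightarrow> (nat \<Rightarrow> ('n, 'k::field) mpoly) set) (Suc q) j"
  unfolding acyclic_def using free_exact by blast

end

section \<open>Tor by Koszul homology\<close>

locale resolved = koszul v for v :: "nat \<Rightarrow> 'n::finite" +
  fixes F :: "('n, 'k::field) free_complex" and I :: "('n, 'k) mpoly set"
  assumes resolution: "graded_free_resolution F I"
    and ideal: "ideal.subspace I"
begin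

abbreviation Fr :: "nat \<Rightarrow> int \<Rightarrow> (nat \<Rightarrow> ('n, 'k) mpoly) set" where
  "Fr i \<equiv> free_module (frank F i) (shift F i)"

text \<open>The map F_i \<rightarrow> F_{i-1}, with the augmentation placed in coordinate 0, so that
  all maps of the augmented complex have one type.\<close>

definition phi :: "nat \<Rightarrow> (nat \<Rightarrow> ('n, 'k) mpoly) \<Rightarrow> nat \<Rightarrow> ('n, 'k) mpoly" where
  "phi i f = (case i of 0 \<Rightarrow> (\<lambda>q. if q = 0 then aug_map F f else 0)
    | Suc i \<Rightarrow> (\<lambda>q. if q < frank F i then diff_map F i f q else 0))"

definition ideal_module :: "int \<Rightarrow> (nat \<Rightarrow> ('n, 'k) mpoly) set" where
  "ideal_module j = {f. f 0 \<in> I \<and> homogeneous j (f 0) \<and> (\<forall>p>0. f p = 0)}"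

text \<open>Syzygy modules, starting with I itself: \<open>phi i\<close> maps F_i onto
  \<open>syz i\<close>, with kernel \<open>syz (Suc i)\<close>.\<close>

definition syz :: "nat \<Rightarrow> int \<Rightarrow> (nat \<Rightarrow> ('n, 'k) mpoly) set" where
  "syz i = (case i of 0 \<Rightarrow> ideal_module | Suc i \<Rightarrow> \<lambda>j. {f \<in> Fr i j. phi i f = 0})"

lemma phi_0: "phi 0 f = (\<lambda>q. if q = 0 then aug_map F f else 0)"
  by (simp add: phi_def)

lemma phi_Suc: "phi (Suc i) f = (\<lambda>q. if q < frank F i then diff_map F i f q else 0)"
  by (simp add: phi_def)

lemma syz_0: "syz 0 = ideal_module"
  by (simp add: syz_def)

lemma syz_Suc: "syz (Suc i) j = {f \<in> Fr i j. phi i f = 0}"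
  by (simp add: syz_def)

lemma phi_add: "phi i (f + g) = phi i f + phi i g"
  by (rule ext, cases i) (simp_all add: phi_0 phi_Suc aug_map_def diff_map_def algebra_simps sum.distrib)

lemma phi_scale: "phi i (\<lambda>p. a * f p) = (\<lambda>p. a * phi i f p)"
proof -
  have "aug_map F (\<lambda>p. a * f p) = a * aug_map F f"
    unfolding aug_map_def sum_distrib_left mult.assoc ..
  moreover have "diff_map F k (\<lambda>p. a * f p) q = a * diff_map F k f q" for k q
    unfolding diff_map_def sum_distrib_left mult.assoc ..
  ultimately show ?thesis
    by (cases i) (auto simp only: phi_0 phi_Suc fun_eq_iff mult_zero_right split: if_split)
qed

lemma aug_homogeneous: "p < frank F 0 \<Longrightarrow> homogeneous (shift F 0 p) (aug F p)"
  and diff_homogeneous: "p < frank F (Suc i) \<Longrightarrow> q < frank F i \<Longrightarrow>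
    homogeneous (shift F (Suc i) p - shift F i q) (diff F i p q)"
  and range_aug: "range (aug_map F) = I"
  and exact_0: "aug_map F f = 0 \<longleftrightarrow> (\<exists>g. \<forall>p<frank F 0. f p = diff_map F 0 g p)"
  and exact_Suc: "(\<forall>q<frank F i. diff_map F i f q = 0) \<longleftrightarrow>
        (\<exists>g. \<forall>p<frank F (Suc i). f p = diff_map F (Suc i) g p)"
  using resolution unfolding graded_free_resolution_def by blast+

lemma phi_eq_0_iff: "phi i f = 0 \<longleftrightarrow> (\<exists>g. \<forall>p<frank F i. f p = diff_map F i g p)"
proof (cases i)
  case 0
  have "phi 0 f = 0 \<longleftrightarrow> aug_map F f = 0" by (auto simp: phi_0 fun_eq_iff)
  then show ?thesis using exact_0 0 by simp
next
  case (Suc i')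
  have "phi (Suc i') f = 0 \<longleftrightarrow> (\<forall>q<frank F i'. diff_map F i' f q = 0)" by (auto simp: phi_Suc fun_eq_iff)
  then show ?thesis using exact_Suc Suc by simp
qed

lemma phi_phi: "phi i (phi (Suc i) f) = 0"
  unfolding phi_eq_0_iff by (rule exI [of _ f]) (simp add: phi_Suc)

lemma homogeneous_shift_mult:
  "homogeneous (j - s) a \<Longrightarrow> homogeneous (s - t) b \<Longrightarrow> homogeneous (j - t) (a * b)"
  using homogeneous_mult [of "j - s" a "s - t" b] by simp

lemma phi_Suc_Fr: "f \<in> Fr (Suc i) j \<Longrightarrow> phi (Suc i) f \<in> Fr i j"
  unfolding free_module_def phi_Suc diff_map_def
  by (auto intro!: homogeneous_sum intro: homogeneous_shift_mult [OF _ diff_homogeneous])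

lemma phi_maps: "f \<in> Fr i j \<Longrightarrow> phi i f \<in> syz i j"
proof (cases i)
  case 0
  assume f: "f \<in> Fr i j"
  have "homogeneous j (f p * aug F p)" if "p < frank F 0" for p
    using homogeneous_mult [OF _ aug_homogeneous [OF that], of "j - shift F 0 p" "f p"] f that 0
    by (simp add: free_module_def)
  then have "homogeneous j (aug_map F f)"
    unfolding aug_map_def by (intro homogeneous_sum) auto
  then show ?thesis
    using range_aug 0 by (auto simp: phi_0 syz_0 ideal_module_def)
next
  case (Suc i')
  then show "f \<in> Fr i j \<Longrightarrow> phi i f \<in> syz i j"
    by (simp add: syz_Suc phi_phi phi_Suc_Fr)
qed

text \<open>Exactness of F is stated for arbitrary coordinate functions, while the Koszul argument
  runs degree by degree. Cutting a preimage of a homogeneous element down to its component of degree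
  j leaves it a preimage.\<close>

definition trunc :: "nat \<Rightarrow> int \<Rightarrow> (nat \<Rightarrow> ('n, 'k) mpoly) \<Rightarrow> nat \<Rightarrow> ('n, 'k) mpoly" where
  "trunc i j g = (\<lambda>p. if p < frank F i then hcomp (j - shift F i p) (g p) else 0)"

lemma trunc_Fr: "trunc i j g \<in> Fr i j"
  by (simp add: trunc_def free_module_def)

lemma aug_map_trunc: "aug_map F (trunc 0 j g) = hcomp j (aug_map F g)"
  by (auto simp: aug_map_def trunc_def hcomp_sum hcomp_mult [OF aug_homogeneous] intro!: sum.cong)

lemma diff_map_trunc:
  assumes "q < frank F i"
  shows "diff_map F i (trunc (Suc i) j g) q = hcomp (j - shift F i q) (diff_map F i g q)"
proof -
  have "hcomp (j - shift F i q) (g p * diff F i p q) = hcomp (j - shift F (Suc i) p) (g p) * diff F i p q"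
    if "p < frank F (Suc i)" for p
    using hcomp_mult [OF diff_homogeneous [OF that assms], of "j - shift F i q" "g p"] by simp
  then show ?thesis
    by (auto simp: diff_map_def trunc_def hcomp_sum intro!: sum.cong)
qed

lemma phi_surj:
  assumes "m \<in> syz i j"
  shows "\<exists>f\<in>Fr i j. phi i f = m"
proof (cases i)
  case 0
  then have m: "m 0 \<in> I" "homogeneous j (m 0)" "\<forall>p>0. m p = 0"
    using assms by (auto simp: syz_0 ideal_module_def)
  then obtain g where "m 0 = aug_map F g" using range_aug by blast
  then have "phi 0 (trunc 0 j g) = m"
    using m by (auto simp: phi_0 aug_map_trunc hcomp_id fun_eq_iff)
  then show ?thesis using trunc_Fr 0 by blast
next
  case (Suc i')
  then have m: "m \<in> Fr i' j" "phi i' m = 0" using assms by (auto simp: syz_Suc)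
  then obtain g where g: "\<And>p. p < frank F i' \<Longrightarrow> diff_map F i' g p = m p"
    using phi_eq_0_iff [of i' m] by auto
  have "phi (Suc i') (trunc (Suc i') j g) q = m q" for q
    using m(1) by (auto simp: phi_Suc diff_map_trunc g free_module_def hcomp_id dest: spec [of _ q])
  then have "phi (Suc i') (trunc (Suc i') j g) = m" ..
  then show ?thesis using trunc_Fr Suc by blast
qed

lemma exact: "koszul_exact v (syz (Suc i)) (Fr i) (syz i) (phi i)"
  by unfold_locales
    (auto simp: phi_add phi_scale syz_Suc graded_submodule_free intro: phi_maps phi_surj)

lemma phi_zero: "phi i 0 = 0"
  using phi_add [of i 0 0] by simp

lemma phi_diff: "phi i (f - g) = phi i f - phi i g"
  using koszul_exact.map_diff [OF exact] .

lemma graded_submodule_syz: "graded_submodule (syz i)"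
proof (cases i)
  case 0
  have "homogeneous (j + 1) (a * f)" if "homogeneous 1 a" "homogeneous j f" for a f :: "('n, 'k) mpoly" and j
    using homogeneous_mult [OF that] by (simp add: add.commute)
  then show ?thesis
    using 0 ideal by (auto simp: graded_submodule_def syz_0 ideal_module_def homogeneous_diff
        ideal.subspace_0 ideal.subspace_diff ideal.subspace_scale)
next
  case (Suc i')
  have "graded_submodule (Fr i')" by (rule graded_submodule_free)
  note free = this [unfolded graded_submodule_def]
  show ?thesis
    unfolding graded_submodule_def
  proof (intro allI conjI ballI impI)
    fix j
    show "0 \<in> syz i j"
      using free Suc phi_zero by (simp add: syz_Suc)
    fix f assume f: "f \<in> syz i j"
    show "f - g \<in> syz i j" if "g \<in> syz i j" for g
      using free f that Suc phi_diff [of i' f g] by (simp add: syz_Suc)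
    show "(\<lambda>p. a * f p) \<in> syz i (j + 1)" if "homogeneous 1 a" for a
      using free f that Suc phi_scale [of i' a f] by (simp add: syz_Suc fun_eq_iff)
  qed
qed

text \<open>Each short exact sequence \<open>syz (Suc a)\<close> \<rightarrow> F_a \<rightarrow>
  \<open>syz a\<close> raises the homological degree by one. The degrees are kept positive since F_a
  may have homology in degree 0.\<close>

lemma acyclic_shift: "acyclic (syz a) (Suc b) j \<longleftrightarrow> acyclic (syz 0) (Suc (a + b)) j"
proof (induction a arbitrary: b)
  case (Suc a)
  have "acyclic (syz (Suc a)) (Suc b) j \<longleftrightarrow> rel_acyclic (syz (Suc a)) (Fr a) (Suc b) j"
    by (rule rel_acyclic_iff [OF _ acyclic_free, symmetric]) (auto simp: syz_Suc)
  also have "\<dots> \<longleftrightarrow> acyclic (syz a) (Suc (Suc b)) j"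
    using koszul_exact.connecting [OF exact acyclic_free] by simp
  finally show ?case using Suc.IH [of "Suc b"] by simp
qed simp

text \<open>By dimension shifting, \<open>Tor\<^sub>i(I, K)\<close> is the quotient of the syzygies lying in \<open>\<mm>F\<^bsub>i-1\<^esub>\<close> by \<open>\<mm>\<close> times
  the syzygies; \<open>minimal_at i j\<close> says that its component of degree \<open>j\<close> vanishes.\<close>

definition minimal_at :: "nat \<Rightarrow> int \<Rightarrow> bool" where
  "minimal_at i j \<longleftrightarrow> (\<forall>m\<in>syz i j. (0 < i \<longrightarrow> (\<forall>p. constant_coeff (m p) = 0)) \<longrightarrow>
    (\<exists>y\<in>chains (syz i) 1 j. kd y {} = m))"

lemma zero_chain: "z \<in> chains M 0 j \<longleftrightarrow> z {} \<in> M j \<and> (\<forall>T. T \<noteq> {} \<longrightarrow> z T = 0)"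
  for M :: "int \<Rightarrow> (nat \<Rightarrow> ('n, 'k) mpoly) set"
proof -
  have "T \<subseteq> vars \<and> card T = 0 \<longleftrightarrow> T = {}" for T
    using finite_face [of T] by auto
  then show ?thesis
    by (auto simp: chains_def)
qed

lemma kd_chain_1_outside: "y \<in> chains M 1 j \<Longrightarrow> T \<noteq> {} \<Longrightarrow> kd y T = 0"
  for M :: "int \<Rightarrow> (nat \<Rightarrow> ('n, 'k) mpoly) set"
proof -
  assume y: "y \<in> chains M 1 j" and T: "T \<noteq> {}"
  have "y (insert l T) = 0" if "T \<subseteq> vars" "l \<in> vars - T" for l
    using that T finite_face [of T] by (intro chains_zero [OF y]) (auto simp: card_insert_if)
  then show "kd y T = 0"
    by (auto simp: kd_eq fun_eq_iff intro!: sum.neutral)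
qed

lemma kd_chain_1: "y \<in> chains M 1 j \<Longrightarrow> (\<forall>T. T \<noteq> {} \<longrightarrow> z T = 0) \<Longrightarrow> kd y = z \<longleftrightarrow> kd y {} = z {}"
  for M :: "int \<Rightarrow> (nat \<Rightarrow> ('n, 'k) mpoly) set"
  using kd_chain_1_outside by (metis ext)

lemma kd_zero_chain: "z \<in> chains M 0 j \<Longrightarrow> kd z = 0"
  for M :: "int \<Rightarrow> (nat \<Rightarrow> ('n, 'k) mpoly) set"
proof
  fix T assume z: "z \<in> chains M 0 j"
  have "z (insert l T) = 0" if "T \<subseteq> vars" for l
    using that finite_face [of T] by (intro chains_zero [OF z]) auto
  then show "kd z T = 0 T"
    by (auto simp: kd_eq fun_eq_iff intro!: sum.neutral)
qed

lemma constant_coeff_kd: "constant_coeff (kd y T p) = 0"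
  by (simp add: kd_def cdiff_sqf constant_coeff_sum constant_coeff_mult constant_coeff_def [of 0])

lemma singleton_chain:
  fixes M :: "int \<Rightarrow> (nat \<Rightarrow> ('n, 'k) mpoly) set"
  shows "m \<in> M j \<Longrightarrow> (\<lambda>T. if T = {} then m else 0) \<in> chains M 0 j"
  by (simp add: zero_chain)

text \<open>This is \<open>free_exact\<close> in homological degree 0: without constant
  coefficients, f is a combination of the variables with coefficients in F_i.\<close>

lemma free_minimal:
  assumes "f \<in> Fr i j" "\<And>p. constant_coeff (f p) = 0"
  shows "\<exists>y\<in>chains (Fr i) 1 j. kd y {} = f"
proof -
  let ?z = "\<lambda>T :: nat set. if T = {} then f else 0"
  have z: "?z \<in> chains (Fr i) 0 j"
    using assms(1) by (rule singleton_chain)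
  obtain y where "y \<in> chains (Fr i) (Suc 0) j" "kd y = ?z"
    using free_exact [OF z kd_zero_chain [OF z]] assms(2) by auto
  then show ?thesis by (intro bexI [of _ y]) simp_all
qed

lemma acyclic_0_iff: "acyclic (syz 0) 0 j \<longleftrightarrow> minimal_at 0 j"
proof
  assume a: "acyclic (syz 0) 0 j"
  show "minimal_at 0 j"
    unfolding minimal_at_def
  proof (intro ballI impI)
    fix m assume m: "m \<in> syz 0 j"
    let ?z = "\<lambda>T :: nat set. if T = {} then m else 0"
    have z: "?z \<in> chains (syz 0) 0 j"
      using m by (rule singleton_chain)
    then obtain y where "y \<in> chains (syz 0) (Suc 0) j" "kd y = ?z"
      using a kd_zero_chain [OF z] unfolding acyclic_def by blast
    then show "\<exists>y\<in>chains (syz 0) 1 j. kd y {} = m" by (intro bexI [of _ y]) simp_all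
  qed
next
  assume m: "minimal_at 0 j"
  show "acyclic (syz 0) 0 j"
    unfolding acyclic_def
  proof (intro ballI impI)
    fix z assume "z \<in> chains (syz 0) 0 j"
    then have z: "z {} \<in> syz 0 j" "\<forall>T. T \<noteq> {} \<longrightarrow> z T = 0"
      by (simp_all add: zero_chain)
    then obtain y where "y \<in> chains (syz 0) 1 j" "kd y {} = z {}"
      using m by (auto simp: minimal_at_def)
    then show "\<exists>w\<in>chains (syz 0) (Suc 0) j. kd w = z"
      using kd_chain_1 [OF _ z(2)] by (intro bexI [of _ y]) simp_all
  qed
qed

text \<open>A homogeneous element of F_i bounds in the Koszul complex of F_i exactly if it has no
  constant coefficients, so injectivity on H_0 is the condition in
  \<open>minimal_at\<close>.\<close>

lemma rel_acyclic_0_iff: "rel_acyclic (syz (Suc i)) (Fr i) 0 j \<longleftrightarrow> minimal_at (Suc i) j"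
proof
  assume a: "rel_acyclic (syz (Suc i)) (Fr i) 0 j"
  show "minimal_at (Suc i) j"
    unfolding minimal_at_def
  proof (intro ballI impI)
    fix m assume m: "m \<in> syz (Suc i) j" and "0 < Suc i \<longrightarrow> (\<forall>p. constant_coeff (m p) = 0)"
    then have const: "constant_coeff (m p) = 0" for p by simp
    let ?z = "\<lambda>T :: nat set. if T = {} then m else 0"
    have z: "?z \<in> chains (syz (Suc i)) 0 j"
      using m by (rule singleton_chain)
    have "m \<in> Fr i j" using m by (simp add: syz_Suc)
    then obtain y where y: "y \<in> chains (Fr i) 1 j" "kd y {} = m"
      using free_minimal const by blast
    then have "kd y = ?z" using kd_chain_1 [OF y(1), of ?z] by simp
    then obtain w where "w \<in> chains (syz (Suc i)) (Suc 0) j" "kd w = ?z"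
      using a z y(1) unfolding rel_acyclic_def by auto
    then show "\<exists>y\<in>chains (syz (Suc i)) 1 j. kd y {} = m" by (intro bexI [of _ w]) simp_all
  qed
next
  assume m: "minimal_at (Suc i) j"
  show "rel_acyclic (syz (Suc i)) (Fr i) 0 j"
    unfolding rel_acyclic_def
  proof (intro ballI impI, elim bexE)
    fix z y assume "z \<in> chains (syz (Suc i)) 0 j" "kd y = z"
    then have z: "z {} \<in> syz (Suc i) j" "\<forall>T. T \<noteq> {} \<longrightarrow> z T = 0" "\<forall>p. constant_coeff (z {} p) = 0"
      using constant_coeff_kd [of y "{}"] by (simp_all add: zero_chain)
    then obtain y where "y \<in> chains (syz (Suc i)) 1 j" "kd y {} = z {}"
      using m by (auto simp: minimal_at_def)
    then show "\<exists>w\<in>chains (syz (Suc i)) (Suc 0) j. kd w = z"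
      using kd_chain_1 [OF _ z(2)] by (intro bexI [of _ y]) simp_all
  qed
qed

text \<open>Dimension shifting stops at homological degree 1; the last step lands in H_0, where the
  free module contributes and only the relative statement survives.\<close>

lemma acyclic_iff_minimal_at: "acyclic (syz 0) i j \<longleftrightarrow> minimal_at i j"
proof (cases i)
  case (Suc i')
  have "acyclic (syz 0) (Suc i') j \<longleftrightarrow> acyclic (syz i') (Suc 0) j"
    using acyclic_shift [of i' 0] by simp
  also have "\<dots> \<longleftrightarrow> rel_acyclic (syz (Suc i')) (Fr i') 0 j"
    using koszul_exact.connecting [OF exact acyclic_free] .
  finally show ?thesis using rel_acyclic_0_iff Suc by simp
qed (simp add: acyclic_0_iff)

section \<open>Reduction of the resolution modulo the variables\<close>

definition lift :: "(nat \<Rightarrow> 'k) \<Rightarrow> nat \<Rightarrow> ('n, 'k) mpoly" where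
  "lift c = (\<lambda>p. single 0 (c p))"

lemma constant_coeff_lift [simp]: "constant_coeff (lift c p) = c p"
  by (simp add: lift_def constant_coeff_def)

lemma lift_Fr: "c \<in> tensor_component F i j \<Longrightarrow> lift c \<in> Fr i j"
  by (auto simp: lift_def tensor_component_def free_module_def homogeneous_def)

lemma constant_coeff_Fr:
  assumes "f \<in> Fr i j"
  shows "(\<lambda>p. constant_coeff (f p)) \<in> tensor_component F i j"
proof -
  have "p < frank F i \<and> shift F i p = j" if "constant_coeff (f p) \<noteq> 0" for p
  proof -
    have "0 \<in> keys (f p)" using that by (simp add: constant_coeff_def in_keys_iff)
    moreover have "if p < frank F i then homogeneous (j - shift F i p) (f p) else f p = 0"
      using assms by (simp add: free_module_def)
    ultimately show ?thesis
      by (cases "p < frank F i") (auto simp: homogeneous_def)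
  qed
  then show ?thesis by (simp add: tensor_component_def)
qed

lemma constant_coeff_phi:
  "(\<lambda>q. constant_coeff (phi (Suc i) f q)) = tensor_diff F i (\<lambda>p. constant_coeff (f p))"
  by (rule ext) (simp add: phi_Suc tensor_diff_def diff_map_def constant_coeff_sum constant_coeff_mult
      constant_coeff_def [of 0])

lemma tensor_cycles_iff:
  "c \<in> tensor_cycles F i j \<longleftrightarrow>
    c \<in> tensor_component F i j \<and> (0 < i \<longrightarrow> (\<forall>q. constant_coeff (phi i (lift c) q) = 0))"
proof (cases i)
  case (Suc i')
  have "(\<forall>q. constant_coeff (phi (Suc i') (lift c) q) = 0) \<longleftrightarrow> tensor_diff F i' c = (\<lambda>_. 0)"
    using constant_coeff_phi [of i' "lift c"] by (simp add: fun_eq_iff)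
  then show ?thesis using Suc by simp
qed simp

lemma tensor_cycles_constant_coeff:
  assumes "f \<in> Fr i j" "0 < i \<longrightarrow> (\<forall>q. constant_coeff (phi i f q) = 0)"
  shows "(\<lambda>p. constant_coeff (f p)) \<in> tensor_cycles F i j"
proof (cases i)
  case 0
  then show ?thesis using constant_coeff_Fr [OF assms(1)] by simp
next
  case (Suc i')
  then show ?thesis
    using constant_coeff_Fr [OF assms(1)] assms(2) constant_coeff_phi [of i' f, symmetric] by (auto simp: fun_eq_iff)
qed

text \<open>Cycles of the reduced complex are the constant coefficients of those f in F_i for which
  \<open>phi i f\<close> has none (of all f, if i = 0). Such a cycle is a boundary exactly if
  \<open>phi i f\<close> is a combination of the variables with coefficients in
  \<open>syz i\<close>.\<close>

lemma minimal_at_iff: "minimal_at i j \<longleftrightarrow> tensor_cycles F i j \<subseteq> tensor_boundaries F i j"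
proof
  assume tor: "tensor_cycles F i j \<subseteq> tensor_boundaries F i j"
  show "minimal_at i j"
    unfolding minimal_at_def
  proof (intro ballI impI)
    fix m assume m: "m \<in> syz i j" "0 < i \<longrightarrow> (\<forall>p. constant_coeff (m p) = 0)"
    obtain f where f: "f \<in> Fr i j" "phi i f = m" using phi_surj [OF m(1)] by blast
    have "(\<lambda>p. constant_coeff (f p)) \<in> tensor_boundaries F i j"
      using tor tensor_cycles_constant_coeff [OF f(1)] m(2) f(2) by auto
    then obtain g where g: "g \<in> tensor_component F (Suc i) j"
      "(\<lambda>p. constant_coeff (f p)) = tensor_diff F i g"
      by (auto simp: tensor_boundaries_def)
    \<comment> \<open>Removing this image clears the constant coefficients and, by
      \<open>phi_phi\<close>, leaves \<open>phi i f\<close> unchanged.\<close>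
    define f' where "f' = f - phi (Suc i) (lift g)"
    have "f' \<in> Fr i j"
      unfolding f'_def
      by (intro graded_submodule_diff [OF graded_submodule_free] f phi_Suc_Fr lift_Fr g)
    moreover have "constant_coeff (f' p) = 0" for p
      using fun_cong [OF g(2), of p] fun_cong [OF constant_coeff_phi [of i "lift g"], of p]
      by (simp add: f'_def constant_coeff_diff)
    ultimately obtain y where y: "y \<in> chains (Fr i) 1 j" "kd y {} = f'"
      using free_minimal by blast
    have "(\<lambda>T. phi i (y T)) \<in> chains (syz i) 1 j"
      using koszul_exact.map_chains [OF exact y(1)] .
    moreover have "kd (\<lambda>T. phi i (y T)) {} = m"
      using koszul_exact.map_kd [OF exact, of i y "{}"] y(2) f(2)
      by (simp add: f'_def phi_diff phi_phi)
    ultimately show "\<exists>y\<in>chains (syz i) 1 j. kd y {} = m" by blast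
  qed
next
  assume min: "minimal_at i j"
  show "tensor_cycles F i j \<subseteq> tensor_boundaries F i j"
  proof
    fix c assume c: "c \<in> tensor_cycles F i j"
    then have c1: "lift c \<in> Fr i j" "0 < i \<longrightarrow> (\<forall>q. constant_coeff (phi i (lift c) q) = 0)"
      using lift_Fr by (auto simp: tensor_cycles_iff)
    then obtain y where y: "y \<in> chains (syz i) 1 j" "kd y {} = phi i (lift c)"
      using min phi_maps [OF c1(1)] unfolding minimal_at_def by blast
    obtain y' where y': "y' \<in> chains (Fr i) 1 j" "\<forall>T. phi i (y' T) = y T"
      using koszul_exact.lift_chains [OF exact y(1)] by blast
    have "kd y' \<in> chains (Fr i) 0 j"
      using y'(1) by (intro kd_chains graded_submodule_free) simp
    then have "kd y' {} \<in> Fr i (j - int 0)"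
      by (rule chains_mem) auto
    then have "lift c - kd y' {} \<in> Fr i j"
      using graded_submodule_diff [OF graded_submodule_free c1(1)] by simp
    moreover have "phi i (lift c - kd y' {}) = 0"
      using koszul_exact.map_kd [OF exact, of i y' "{}"] y(2) y'(2) by (simp add: phi_diff)
    ultimately have "lift c - kd y' {} \<in> syz (Suc i) j"
      by (simp add: syz_Suc)
    \<comment> \<open>\<open>kd y' {}\<close> has no constant coefficients, so reducing g gives a
      preimage of c.\<close>
    then obtain g where g: "g \<in> Fr (Suc i) j" "phi (Suc i) g = lift c - kd y' {}"
      using phi_surj by blast
    have "c p = tensor_diff F i (\<lambda>p. constant_coeff (g p)) p" for p
      using fun_cong [OF constant_coeff_phi [of i g], of p] g(2)
      by (simp add: constant_coeff_diff constant_coeff_kd)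
    then have "c = tensor_diff F i (\<lambda>p. constant_coeff (g p))"
      by (simp add: fun_eq_iff)
    then show "c \<in> tensor_boundaries F i j"
      using constant_coeff_Fr [OF g(1)] by (auto simp: tensor_boundaries_def)
  qed
qed

lemma tor_zero_iff: "tensor_cycles F i j \<subseteq> tensor_boundaries F i j \<longleftrightarrow> acyclic ideal_module i j"
  using minimal_at_iff acyclic_iff_minimal_at by (simp add: syz_0)

end

lemma image_eq_singleton:
  assumes "A \<noteq> {}"
  shows "f ` A = {b} \<longleftrightarrow> (\<forall>a\<in>A. f a = b)"
proof
  show "f ` A = {b}" if "\<forall>a\<in>A. f a = b"
    using image_cong [OF refl, of A f "\<lambda>_. b"] that assms by (simp add: image_constant_conv)
qed (metis imageI singletonD)

text \<open>The zero cycle keeps the set of cosets nonempty; it is then the zero space exactly if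
  the coset of every cycle is the space of boundaries.\<close>

lemma Tor_nonzero_iff:
  "Tor_nonzero I i j \<longleftrightarrow> \<not> tensor_cycles (resolution I) i j \<subseteq> tensor_boundaries (resolution I) i j"
proof -
  let ?F = "resolution I"
  let ?B = "tensor_boundaries ?F i j"
  have comp: "(\<lambda>p. 0) \<in> tensor_component ?F a j" for a
    by (simp add: tensor_component_def)
  have diff0: "tensor_diff ?F a (\<lambda>p. 0) = (\<lambda>p. 0)" for a
    by (rule ext) (simp add: tensor_diff_def)
  have cyc0: "(\<lambda>p. 0) \<in> tensor_cycles ?F i j"
    using comp diff0 by (cases i) auto
  have B0: "(\<lambda>p. 0) \<in> ?B"
    unfolding tensor_boundaries_def using comp diff0 by (metis imageI)
  have B_diff: "(\<lambda>p. x p - y p) \<in> ?B" if xy: "x \<in> ?B" "y \<in> ?B" for x y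
  proof -
    obtain f g where fg: "f \<in> tensor_component ?F (Suc i) j" "x = tensor_diff ?F i f"
        "g \<in> tensor_component ?F (Suc i) j" "y = tensor_diff ?F i g"
      using xy unfolding tensor_boundaries_def by blast
    have "f p \<noteq> 0 \<or> g p \<noteq> 0" if "f p - g p \<noteq> 0" for p
      using that by auto
    then have "(\<lambda>p. f p - g p) \<in> tensor_component ?F (Suc i) j"
      using fg(1,3) unfolding tensor_component_def mem_Collect_eq by blast
    moreover have "(\<lambda>p. x p - y p) = tensor_diff ?F i (\<lambda>p. f p - g p)"
      by (rule ext) (simp add: fg tensor_diff_def sum_subtractf algebra_simps)
    ultimately show ?thesis by (auto simp: tensor_boundaries_def)
  qed
  have coset: "{c'. (\<lambda>p. c' p - c p) \<in> ?B} = ?B \<longleftrightarrow> c \<in> ?B" for c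
  proof
    assume "{c'. (\<lambda>p. c' p - c p) \<in> ?B} = ?B"
    moreover have "(\<lambda>p. c p - c p) \<in> ?B" using B0 by simp
    ultimately show "c \<in> ?B" by blast
  next
    assume c: "c \<in> ?B"
    have "(\<lambda>p. c' p - c p) \<in> ?B \<longleftrightarrow> c' \<in> ?B" for c'
    proof
      assume "(\<lambda>p. c' p - c p) \<in> ?B"
      from B_diff [OF this B_diff [OF B0 c]] show "c' \<in> ?B" by simp
    qed (use c B_diff in blast)
    then show "{c'. (\<lambda>p. c' p - c p) \<in> ?B} = ?B" by blast
  qed
  have "Tor I i j = {?B} \<longleftrightarrow> tensor_cycles ?F i j \<subseteq> ?B"
  proof -
    have "Tor I i j = {?B} \<longleftrightarrow> (\<forall>c\<in>tensor_cycles ?F i j. {c'. (\<lambda>p. c' p - c p) \<in> ?B} = ?B)"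
      unfolding Tor_def by (rule image_eq_singleton) (use cyc0 in blast)
    then show ?thesis unfolding coset by blast
  qed
  then show ?thesis by (simp add: Tor_nonzero_def)
qed

section \<open>The Taylor resolution\<close>

text \<open>Resolutions are stored as matrices with numbered rows and columns. This returns to sums
  over vertices: the faces with one more vertex that contain T are the sets
  \<open>insert l T\<close>.\<close>

lemma sum_enumerated_faces:
  fixes h :: "nat set \<Rightarrow> 'a::comm_monoid_add"
  assumes "finite V" "T \<subseteq> V"
    and E: "bij_betw E {..<r} {T'. T' \<subseteq> V \<and> card T' = Suc (card T)}"
  shows "(\<Sum>p<r. if T \<subseteq> E p then h (E p) else 0) = (\<Sum>l\<in>V - T. h (insert l T))"
proof -
  let ?A = "{T'. T' \<subseteq> V \<and> card T' = Suc (card T)}"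
  have "finite T" using assms finite_subset by blast
  have "(\<Sum>p<r. if T \<subseteq> E p then h (E p) else 0) = (\<Sum>T'\<in>?A. if T \<subseteq> T' then h T' else 0)"
    using sum.reindex_bij_betw [OF E, of "\<lambda>T'. if T \<subseteq> T' then h T' else 0"] .
  also have "\<dots> = (\<Sum>T'\<in>{T' \<in> ?A. T \<subseteq> T'}. h T')"
    using \<open>finite V\<close> by (intro sum.inter_filter [symmetric]) simp
  also have "{T' \<in> ?A. T \<subseteq> T'} = (\<lambda>l. insert l T) ` (V - T)"
  proof (intro equalityI subsetI)
    fix T' assume "T' \<in> {T' \<in> ?A. T \<subseteq> T'}"
    then have T': "T' \<subseteq> V" "card T' = Suc (card T)" "T \<subseteq> T'" by auto
    then have "card (T' - T) = 1"
      using \<open>finite T\<close> by (simp add: card_Diff_subset)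
    then obtain l where "T' - T = {l}" by (auto simp: card_1_singleton_iff)
    then have "T' = insert l T" "l \<in> V - T" using T' by auto
    then show "T' \<in> (\<lambda>l. insert l T) ` (V - T)" by blast
  qed (use assms \<open>finite T\<close> in auto)
  also have "(\<Sum>T'\<in>(\<lambda>l. insert l T) ` (V - T). h T') = (\<Sum>l\<in>V - T. h (insert l T))"
    by (subst sum.reindex) (auto simp: inj_on_def)
  finally show ?thesis .
qed

locale taylor =
  fixes r :: nat and g :: "nat \<Rightarrow> ('n::finite \<Rightarrow>\<^sub>0 nat)"
begin

abbreviation V :: "nat set" where "V \<equiv> {..<r}"

text \<open>\<open>insert 0\<close> gives the empty face the label 1, so that the augmentation
  becomes the differential at the empty face.\<close>

definition lcm_label :: "nat set \<Rightarrow> ('n \<Rightarrow>\<^sub>0 nat)" where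
  "lcm_label T = Abs_poly_mapping (\<lambda>i. Max (insert 0 ((\<lambda>t. lookup (g t) i) ` T)))"

lemma lcm_label_divides_iff: "finite T \<Longrightarrow> lcm_label T \<preceq> b \<longleftrightarrow> (\<forall>t\<in>T. g t \<preceq> b)"
  by (auto simp: lcm_label_def divides_def)

lemma lcm_label_empty: "lcm_label {} = 0"
  by (rule divides_antisym) (simp_all add: lcm_label_divides_iff)

lemma lcm_label_single: "lcm_label {t} = g t"
  by (rule poly_mapping_eqI) (simp add: lcm_label_def)

lemma lcm_label_mono: "finite T' \<Longrightarrow> T \<subseteq> T' \<Longrightarrow> lcm_label T \<preceq> lcm_label T'"
  using lcm_label_divides_iff [of T' "lcm_label T'"]
  by (subst lcm_label_divides_iff) (auto intro: finite_subset)

lemma finite_face: "T \<subseteq> V \<Longrightarrow> finite T"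
  by (rule finite_subset) auto

sublocale labelled_simplex V lcm_label
proof
  show "lcm_label T \<preceq> lcm_label (insert l T)" if "T \<subseteq> V" for T l
    using that finite_face by (intro lcm_label_mono) auto
qed simp

definition faces :: "nat \<Rightarrow> nat set set" where
  "faces q = {T. T \<subseteq> V \<and> card T = q}"

definition face :: "nat \<Rightarrow> nat \<Rightarrow> nat set" where
  "face q = (SOME E. bij_betw E {..<card (faces q)} (faces q))"

lemma bij_face: "bij_betw (face q) {..<card (faces q)} (faces q)"
proof -
  have "finite (faces q)" by (simp add: faces_def)
  then have "\<exists>E. bij_betw E {..<card (faces q)} (faces q)"
    using ex_bij_betw_nat_finite by (simp add: atLeast0LessThan)
  then show ?thesis
    unfolding face_def by (rule someI_ex)
qed

lemma face_in: "p < card (faces q) \<Longrightarrow> face q p \<subseteq> V \<and> card (face q p) = q"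
  using bij_face [of q] by (auto simp: bij_betw_def faces_def)

text \<open>F_i has the faces with i + 1 vertices as basis, since F_0 already maps the vertices to
  the generators of the ideal. For T \<subseteq> T' in neighbouring degrees, \<open>the_elem\<close>
  picks the added vertex.\<close>

definition taylor_complex :: "('n, 'k::field) free_complex" where
  "taylor_complex = \<lparr>frank = (\<lambda>i. card (faces (Suc i))),
    shift = (\<lambda>i p. int (mdeg (lcm_label (face (Suc i) p)))),
    aug = (\<lambda>p. monomial (lcm_label (face 1 p))),
    diff = (\<lambda>i p q. let T = face (Suc i) q; T' = face (Suc (Suc i)) p in
      if T \<subseteq> T' then single (lcm_label T' - lcm_label T) (ksign (the_elem (T' - T)) T) else 0)\<rparr>"

lemma taylor_simps [simp]:
  "frank taylor_complex i = card (faces (Suc i))"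
  "shift taylor_complex i p = int (mdeg (lcm_label (face (Suc i) p)))"
  "aug taylor_complex p = monomial (lcm_label (face 1 p))"
  by (simp_all add: taylor_complex_def)

definition to_chain :: "nat \<Rightarrow> (nat \<Rightarrow> ('n, 'k::field) mpoly) \<Rightarrow> nat set \<Rightarrow> ('n, 'k) mpoly" where
  "to_chain q f T = (if T \<in> faces q then f (the_inv_into {..<card (faces q)} (face q) T) else 0)"

lemma to_chain_face: "p < card (faces q) \<Longrightarrow> to_chain q f (face q p) = f p"
  using bij_face [of q] by (auto simp: to_chain_def bij_betw_def the_inv_into_f_f)

lemma to_chain_cong: "(\<And>p. p < card (faces q) \<Longrightarrow> f p = f' p) \<Longrightarrow> to_chain q f = to_chain q f'"
  using bij_face [of q] by (intro ext)
    (auto simp: to_chain_def bij_betw_def dest!: the_inv_into_into [of "face q", OF _ _ subset_refl])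

lemma to_chain_outside: "T \<notin> faces q \<Longrightarrow> to_chain q f T = 0"
  by (simp add: to_chain_def)

lemma to_chain_of_chain:
  assumes "\<And>T. T \<notin> faces q \<Longrightarrow> w T = 0"
  shows "to_chain q (\<lambda>p. w (face q p)) = w"
  using bij_face [of q] assms
  by (intro ext) (auto simp: to_chain_def bij_betw_def f_the_inv_into_f)

lemma diff_map_taylor:
  fixes f :: "nat \<Rightarrow> ('n, 'k::field) mpoly"
  assumes "q < card (faces (Suc i))"
  shows "diff_map taylor_complex i f q = cdiff (to_chain (Suc (Suc i)) f) (face (Suc i) q)"
proof -
  let ?T = "face (Suc i) q" and ?E = "face (Suc (Suc i))"
  define h where "h T' = single (lcm_label T' - lcm_label ?T) (ksign (the_elem (T' - ?T)) ?T) *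
    to_chain (Suc (Suc i)) f T'" for T'
  have T: "?T \<subseteq> V" "card ?T = Suc i" using face_in [OF assms] by auto
  have E: "bij_betw ?E {..<card (faces (Suc (Suc i)))} {T'. T' \<subseteq> V \<and> card T' = Suc (card ?T)}"
    using bij_face [of "Suc (Suc i)"] T by (simp add: faces_def)
  have "diff_map taylor_complex i f q =
      (\<Sum>p<card (faces (Suc (Suc i))). if ?T \<subseteq> ?E p then h (?E p) else 0)"
    unfolding diff_map_def
    by (auto simp: taylor_complex_def Let_def h_def to_chain_face mult.commute intro!: sum.cong)
  also have "\<dots> = (\<Sum>l\<in>V - ?T. h (insert l ?T))"
    by (rule sum_enumerated_faces [OF _ T(1) E]) simp
  also have "\<dots> = (\<Sum>l\<in>V - ?T. single (lcm_label (insert l ?T) - lcm_label ?T) (ksign l ?T) *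
      to_chain (Suc (Suc i)) f (insert l ?T))"
  proof (rule sum.cong [OF refl])
    fix l assume "l \<in> V - ?T"
    then have "insert l ?T - ?T = {l}" by auto
    then show "h (insert l ?T) = single (lcm_label (insert l ?T) - lcm_label ?T) (ksign l ?T) *
      to_chain (Suc (Suc i)) f (insert l ?T)" by (simp add: h_def)
  qed
  finally show ?thesis using T by (simp add: cdiff_def)
qed

lemma aug_map_taylor:
  fixes f :: "nat \<Rightarrow> ('n, 'k::field) mpoly"
  shows "aug_map taylor_complex f = cdiff (to_chain (Suc 0) f) {}"
proof -
  have E: "bij_betw (face 1) {..<card (faces 1)} {T'. T' \<subseteq> V \<and> card T' = Suc (card {})}"
    using bij_face [of 1] by (simp add: faces_def)
  have "aug_map taylor_complex f =
      (\<Sum>p<card (faces 1). if {} \<subseteq> face 1 p then monomial (lcm_label (face 1 p)) * to_chain 1 f (face 1 p) else 0)"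
    unfolding aug_map_def by (auto simp: to_chain_face mult.commute intro!: sum.cong)
  also have "\<dots> = (\<Sum>l\<in>V - {}. monomial (lcm_label {l}) * to_chain 1 f {l})"
    using sum_enumerated_faces [OF _ _ E, where h = "\<lambda>T. monomial (lcm_label T) * to_chain 1 f T"] by simp
  finally show ?thesis
    by (simp add: cdiff_def lcm_label_empty monomial_def)
qed

lemma cdiff_outside_faces:
  assumes "\<And>T. T \<notin> faces (Suc q) \<Longrightarrow> z T = 0" "T \<notin> faces q"
  shows "cdiff z T = (0 :: ('n, 'k::field) mpoly)"
proof (cases "T \<subseteq> V")
  case True
  then have "insert l T \<notin> faces (Suc q)" if "l \<in> V - T" for l
    using assms(2) that finite_face by (auto simp: faces_def)
  then show ?thesis
    using assms(1) by (auto simp: cdiff_def intro!: sum.neutral)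
qed (simp add: cdiff_outside)

text \<open>The apex is a generator dividing the multidegree b: adding it to a face whose label
  divides b keeps the label a divisor of b. One exists because a face with \<open>Suc q\<close>
  vertices has a vertex, whose generator divides the label.\<close>

lemma taylor_cycle:
  fixes z :: "nat set \<Rightarrow> ('n, 'k::field) mpoly"
  assumes supp: "\<And>T. T \<notin> faces (Suc q) \<Longrightarrow> z T = 0" and cycle: "\<And>T. cdiff z T = 0"
  shows "\<exists>w. cdiff w = z \<and> (\<forall>T. T \<notin> faces (Suc (Suc q)) \<longrightarrow> w T = 0)"
proof -
  define kk where "kk b = (SOME t. t \<in> V \<and> g t \<preceq> b)" for b
  have face: "T \<subseteq> V" "card T = Suc q" if "a \<in> keys (z T)" for a T
    using supp that by (auto simp: faces_def) (metis keys_zero empty_iff mem_Collect_eq subsetD lessThan_iff)+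
  have kk: "kk (a + lcm_label T) \<in> V \<and> g (kk (a + lcm_label T)) \<preceq> a + lcm_label T"
    if a: "a \<in> keys (z T)" for a T
  proof -
    have "T \<noteq> {}" using face [OF a] by auto
    then obtain t where "t \<in> T" by blast
    then have "g t \<preceq> lcm_label T"
      using lcm_label_divides_iff [OF finite_face [OF face(1) [OF that]], of "lcm_label T"] by simp
    then have "\<exists>t. t \<in> V \<and> g t \<preceq> a + lcm_label T"
      using \<open>t \<in> T\<close> face(1) [OF that] divides_trans divides_add(2) by blast
    then show ?thesis unfolding kk_def by (rule someI_ex)
  qed
  obtain w where w: "cdiff w = z" "\<And>T. \<not> T \<subseteq> V \<Longrightarrow> w T = 0"
    "\<And>T a. a \<in> keys (w T) \<Longrightarrow> kk (a + lcm_label T) \<in> T \<and>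
      (\<exists>a'\<in>keys (z (T - {kk (a + lcm_label T)})). a' + lcm_label (T - {kk (a + lcm_label T)}) = a + lcm_label T)"
  proof (rule cone [of z kk])
    show "z T = 0" if "\<not> T \<subseteq> V" for T
      using that supp by (auto simp: faces_def)
    show "lcm_label (insert (kk (a + lcm_label T)) T) \<preceq> a + lcm_label T"
      if "T \<subseteq> V" "a \<in> keys (z T)" for T a
      using that kk [OF that(2)] finite_face [OF that(1)] lcm_label_divides_iff [of T "lcm_label T"]
      by (subst lcm_label_divides_iff) (auto intro: divides_trans)
  qed (use cycle kk in blast)+
  have "w T = 0" if "T \<notin> faces (Suc (Suc q))" for T
  proof (rule poly_mapping_eqI)
    have "a \<notin> keys (w T)" for a
    proof
      assume a: "a \<in> keys (w T)"
      have T: "T \<subseteq> V" using a w(2) by (metis keys_zero empty_iff)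
      have "kk (a + lcm_label T) \<in> T" "card (T - {kk (a + lcm_label T)}) = Suc q"
        using w(3) [OF a] face by blast+
      then have "card T = Suc (Suc q)"
        using card.remove [OF finite_face [OF T]] by metis
      then show False using that T by (simp add: faces_def)
    qed
    then show "lookup (w T) a = lookup 0 a" for a by (simp add: in_keys_iff)
  qed
  with w(1) show ?thesis by blast
qed

text \<open>For q = 0 this is exactness at F_0, read with the augmentation, and for q =
  \<open>Suc i\<close> exactness at F_{i+1}.\<close>

lemma taylor_exact:
  fixes f :: "nat \<Rightarrow> ('n, 'k::field) mpoly"
  shows "(\<forall>T\<in>faces q. cdiff (to_chain (Suc q) f) T = 0) \<longleftrightarrow>
    (\<exists>h. \<forall>p<card (faces (Suc q)). f p = diff_map taylor_complex q h p)"
proof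
  assume zero: "\<forall>T\<in>faces q. cdiff (to_chain (Suc q) f) T = 0"
  have "cdiff (to_chain (Suc q) f) T = 0" for T
  proof (cases "T \<in> faces q")
    case False
    then show ?thesis by (intro cdiff_outside_faces to_chain_outside)
  qed (use zero in blast)
  then obtain w where w: "cdiff w = to_chain (Suc q) f" "\<And>T. T \<notin> faces (Suc (Suc q)) \<Longrightarrow> w T = 0"
    using taylor_cycle [of q "to_chain (Suc q) f"] to_chain_outside by blast
  have "f p = diff_map taylor_complex q (\<lambda>p. w (face (Suc (Suc q)) p)) p"
    if "p < card (faces (Suc q))" for p
    using that by (simp add: diff_map_taylor to_chain_of_chain w to_chain_face)
  then show "\<exists>h. \<forall>p<card (faces (Suc q)). f p = diff_map taylor_complex q h p" by blast
next
  assume "\<exists>h. \<forall>p<card (faces (Suc q)). f p = diff_map taylor_complex q h p"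
  then obtain h where h: "\<forall>p<card (faces (Suc q)). f p = diff_map taylor_complex q h p" by blast
  let ?z = "to_chain (Suc (Suc q)) h"
  have "to_chain (Suc q) f = to_chain (Suc q) (\<lambda>p. cdiff ?z (face (Suc q) p))"
    using h by (intro to_chain_cong) (simp add: diff_map_taylor)
  also have "\<dots> = cdiff ?z"
    by (intro to_chain_of_chain cdiff_outside_faces to_chain_outside)
  finally show "\<forall>T\<in>faces q. cdiff (to_chain (Suc q) f) T = 0"
    by (simp add: cdiff_cdiff)
qed

lemma range_aug_taylor:
  "range (aug_map (taylor_complex :: ('n, 'k::field) free_complex)) = ideal.span (monomial ` g ` V)"
proof (rule antisym)
  show "range (aug_map (taylor_complex :: ('n, 'k) free_complex)) \<subseteq> ideal.span (monomial ` g ` V)"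
  proof clarify
    fix f :: "nat \<Rightarrow> ('n, 'k) mpoly"
    have "f p * monomial (lcm_label (face 1 p)) \<in> ideal.span (monomial ` g ` V)" if p: "p < card (faces 1)" for p
    proof -
      have "card (face 1 p) = 1" "face 1 p \<subseteq> V" using face_in [OF p] by auto
      then obtain t where "face 1 p = {t}" "t \<in> V" by (auto simp: card_1_singleton_iff)
      then show ?thesis
        by (simp add: lcm_label_single ideal.span_base ideal.span_scale)
    qed
    then show "aug_map taylor_complex f \<in> ideal.span (monomial ` g ` V)"
      unfolding aug_map_def by (auto intro!: ideal.span_sum)
  qed
next
  let ?R = "range (aug_map (taylor_complex :: ('n, 'k) free_complex))"
  show "ideal.span (monomial ` g ` V) \<subseteq> ?R"
  proof (rule ideal.span_minimal)
    show "ideal.subspace ?R"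
    proof (rule ideal.subspaceI)
      have "aug_map (taylor_complex :: ('n, 'k) free_complex) (\<lambda>_. 0) = 0" by (simp add: aug_map_def)
      then show "0 \<in> ?R" by (metis rangeI)
      show "x + y \<in> ?R" if xy: "x \<in> ?R" "y \<in> ?R" for x y
      proof -
        obtain f f' where "x = aug_map taylor_complex f" "y = aug_map taylor_complex f'" using xy by blast
        then have "x + y = aug_map taylor_complex (\<lambda>p. f p + f' p)"
          by (simp add: aug_map_def sum.distrib algebra_simps)
        then show ?thesis by blast
      qed
      show "c * x \<in> ?R" if x: "x \<in> ?R" for c x
      proof -
        obtain f where f: "x = aug_map taylor_complex f" using x by blast
        have "c * x = aug_map taylor_complex (\<lambda>p. c * f p)"
          unfolding f aug_map_def sum_distrib_left mult.assoc ..
        then show ?thesis by blast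
      qed
    qed
    show "monomial ` g ` V \<subseteq> ?R"
    proof clarify
      fix t assume "t < r"
      then have "{t} \<in> faces 1" by (simp add: faces_def)
      then obtain p where p: "p < card (faces 1)" "face 1 p = {t}"
        using bij_face [of 1] unfolding bij_betw_def by (metis imageE lessThan_iff)
      have "aug_map taylor_complex (\<lambda>q. if q = p then 1 else 0) = monomial (g t)"
        unfolding aug_map_def using p by (simp add: if_distrib [of "\<lambda>x. x * _"] lcm_label_single cong: if_cong)
      then show "monomial (g t) \<in> ?R" by (metis rangeI)
    qed
  qed
qed

lemma graded_free_resolution_taylor:
  "graded_free_resolution (taylor_complex :: ('n, 'k::field) free_complex) (ideal.span (monomial ` g ` V))"
  unfolding graded_free_resolution_def
proof (intro conjI allI impI)
  let ?F = "taylor_complex :: ('n, 'k) free_complex"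
  show "homogeneous (shift ?F 0 p) (aug ?F p)" for p
    using homogeneous_monomial by simp
  show "homogeneous (shift ?F (Suc i) p - shift ?F i q) (diff ?F i p q)"
    if p: "p < frank ?F (Suc i)" for i p q
  proof (cases "face (Suc i) q \<subseteq> face (Suc (Suc i)) p")
    case True
    have "finite (face (Suc (Suc i)) p)" using face_in [of p "Suc (Suc i)"] p finite_face by auto
    from mdeg_diff_add [OF lcm_label_mono [OF this True]] show ?thesis
      by (auto simp: taylor_complex_def Let_def homogeneous_def)
  qed (simp add: taylor_complex_def Let_def)
  show "range (aug_map ?F) = ideal.span (monomial ` g ` V)"
    by (rule range_aug_taylor)
  have faces_0: "faces 0 = {{}}" using finite_face by (auto simp: faces_def)
  show "aug_map ?F f = 0 \<longleftrightarrow> (\<exists>h. \<forall>p<frank ?F 0. f p = diff_map ?F 0 h p)" for f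
    using taylor_exact [of 0 f] by (simp add: aug_map_taylor faces_0)
  show "(\<forall>q<frank ?F i. diff_map ?F i f q = 0) \<longleftrightarrow> (\<exists>h. \<forall>p<frank ?F (Suc i). f p = diff_map ?F (Suc i) h p)"
    for i f
  proof -
    have "(\<forall>q<frank ?F i. diff_map ?F i f q = 0) \<longleftrightarrow>
        (\<forall>q<card (faces (Suc i)). cdiff (to_chain (Suc (Suc i)) f) (face (Suc i) q) = 0)"
      by (simp add: diff_map_taylor)
    also have "\<dots> \<longleftrightarrow> (\<forall>T\<in>face (Suc i) ` {..<card (faces (Suc i))}. cdiff (to_chain (Suc (Suc i)) f) T = 0)"
      by blast
    also have "face (Suc i) ` {..<card (faces (Suc i))} = faces (Suc i)"
      using bij_face by (rule bij_betw_imp_surj_on)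
    finally show ?thesis using taylor_exact [of "Suc i" f] by simp
  qed
qed

end

text \<open>The Taylor complex on the minimal generators is a witness for the choice in
  \<open>resolution\<close>. From here on only the defining property of the chosen resolution is
  used.\<close>

lemma graded_free_resolution_resolution:
  fixes I :: "('n::finite, 'k::field) mpoly set"
  assumes "monomial_ideal I"
  shows "graded_free_resolution (resolution I) I"
proof -
  obtain g :: "nat \<Rightarrow> 'n \<Rightarrow>\<^sub>0 nat" where g: "g ` {..<card (min_gens I)} = min_gens I"
    using ex_bij_betw_nat_finite [OF finite_min_gens [of I]] by (auto simp: bij_betw_def atLeast0LessThan)
  have "ideal.span (monomial ` g ` {..<card (min_gens I)}) = I"
    unfolding g by (rule min_gens_span [OF assms, symmetric])
  then have "graded_free_resolution (taylor.taylor_complex (card (min_gens I)) g) I"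
    using taylor.graded_free_resolution_taylor [of "card (min_gens I)" g, where ?'k = 'k] by simp
  then show ?thesis
    unfolding resolution_def by (rule someI)
qed

section \<open>Stability and regularity\<close>

context koszul
begin

text \<open>The Bayer--Stillman criterion for \<open>e\<close>-regularity with respect to \<open>x\<^sub>n, x\<^bsub>n-1\<^esub>, \<dots>, x\<^sub>1\<close>, in terms of
  monomials.\<close>

definition sat :: "('n, 'k::field) mpoly set \<Rightarrow> nat \<Rightarrow> bool" where
  "sat I e \<longleftrightarrow> (\<forall>k\<in>vars. \<forall>u. (\<forall>m\<in>vars. k < m \<longrightarrow> lookup u (v m) = 0) \<longrightarrow> e \<le> mdeg u \<longrightarrow>
    monomial (u + single (v k) 1) \<in> I \<longrightarrow> monomial u \<in> I)"

lemma satD: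
  "sat I e \<Longrightarrow> k \<in> vars \<Longrightarrow> (\<And>m. m \<in> vars \<Longrightarrow> k < m \<Longrightarrow> lookup u (v m) = 0) \<Longrightarrow> e \<le> mdeg u \<Longrightarrow>
    monomial (u + single (v k) 1) \<in> I \<Longrightarrow> monomial u \<in> I"
  unfolding sat_def by blast

lemma max_var_props:
  assumes "u \<noteq> 0"
  shows "max_var v u \<in> vars" "0 < lookup u (v (max_var v u))"
    "\<And>m. m \<in> vars \<Longrightarrow> max_var v u < m \<Longrightarrow> lookup u (v m) = 0"
proof -
  let ?A = "{i \<in> vars. 0 < lookup u (v i)}"
  have max: "max_var v u = Max ?A" by (simp add: max_var_def indices_def)
  have fin: "finite ?A" using finite_vars by simp
  have "0 < mdeg u" using assms by (simp add: mdeg_eq_0_iff zero_less_iff_neq_zero)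
  then obtain x where "0 < lookup u x" by (rule mdeg_pos_obtain)
  then have "?A \<noteq> {}" using ex_var [of x] by auto
  then have "max_var v u \<in> ?A" unfolding max by (rule Max_in [OF fin])
  then show "max_var v u \<in> vars" "0 < lookup u (v (max_var v u))" by auto
  show "lookup u (v m) = 0" if "m \<in> vars" "max_var v u < m" for m
    using Max_ge [OF fin, of m] that max by (cases "lookup u (v m)") auto
qed

lemma max_var_eqI:
  assumes "k \<in> vars" "0 < lookup u (v k)" "\<And>m. m \<in> vars \<Longrightarrow> k < m \<Longrightarrow> lookup u (v m) = 0"
  shows "max_var v u = k"
proof -
  have "u \<noteq> 0" using assms(2) by auto
  note props = max_var_props [OF this]
  show ?thesis
    using props(1,2) props(3) [of k] assms by (cases "max_var v u" k rule: linorder_cases) auto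
qed

lemma lookup_single_var: "l \<in> vars \<Longrightarrow> m \<in> vars \<Longrightarrow> lookup (single (v l) c) (v m) = (if l = m then c else 0)"
  by (simp add: lookup_single when_def v_eq_iff)

text \<open>If x_k u \<in> I, a generator dividing it has degree at most e \<le> deg u, hence spares
  a factor x_j: x_k u / x_j lies in I with j \<le> k, and stability exchanges x_k for x_j.
  Conversely, \<open>sat\<close> cancels the last variable: from a generator of degree above e,
  which contradicts minimality, and from x_i u, which gives the stability move.\<close>

lemma stable_truncation_iff_sat:
  fixes I :: "('n, 'k::field) mpoly set"
  assumes I: "monomial_ideal I" "I \<noteq> {0}"
  shows "(\<forall>u\<in>min_gens I. int (mdeg u) \<le> e) \<and> stable_ideal v (truncation I e) \<longleftrightarrow> 0 \<le> e \<and> sat I (nat e)"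
proof (intro iffI; elim conjE)
  assume gens: "\<forall>u\<in>min_gens I. int (mdeg u) \<le> e" and stable: "stable_ideal v (truncation I e)"
  obtain f where "f \<in> I" "f \<noteq> 0"
    using I ideal.subspace_0 [OF monomial_ideal_subspace [OF I(1)]] by blast
  then obtain u where "u \<in> keys f" by (metis keys_eq_empty ex_in_conv)
  then have "monomial u \<in> I" using \<open>f \<in> I\<close> monomial_ideal_mem_iff [OF I(1)] by blast
  then obtain m where "m \<in> min_gens I" using min_gens_divides by blast
  then have e: "0 \<le> e" using gens by force
  moreover have "sat I (nat e)"
    unfolding sat_def
  proof (intro ballI allI impI)
    fix k u
    assume k: "k \<in> vars" and above: "\<forall>m\<in>vars. k < m \<longrightarrow> lookup u (v m) = 0"
      and deg: "nat e \<le> mdeg u" and xu: "monomial (u + single (v k) 1) \<in> I"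
    let ?w = "u + single (v k) 1"
    obtain m where m: "m \<in> min_gens I" "m \<preceq> ?w" using min_gens_divides [OF xu] by blast
    have "\<not> ?w \<preceq> m"
    proof
      assume "?w \<preceq> m"
      then have "mdeg u + 1 \<le> mdeg m" using mdeg_mono by (fastforce simp: mdeg_add)
      then show False using gens m(1) deg by force
    qed
    then obtain x where "lookup m x < lookup ?w x" by (auto simp: divides_def not_le)
    moreover obtain j where "j \<in> vars" "x = v j" using ex_var by blast
    ultimately have j: "j \<in> vars" "lookup m (v j) < lookup ?w (v j)" by auto
    define t where "t = ?w - single (v j) 1"
    have "single (v j) 1 \<preceq> ?w" using j(2) by (intro single_divides) auto
    then have t: "t + single (v j) 1 = ?w" by (simp add: t_def divides_diff_add)
    have "m \<preceq> t"
      using m(2) j(2) by (auto simp: divides_def t_def lookup_minus lookup_single when_def)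
    then have tI: "monomial t \<in> I"
      using m(1) monomial_ideal_divides [OF I(1)] by (auto simp: min_gens_def)
    show "monomial u \<in> I"
    proof (cases "j = k")
      case True
      then have "t = u" using t by simp
      then show ?thesis using tI by simp
    next
      case False
      \<comment> \<open>No variable beyond x_k occurs in x_k u.\<close>
      have "j \<le> k"
      proof (rule ccontr)
        assume "\<not> j \<le> k"
        then have "lookup ?w (v j) = 0" using above j(1) k False by (simp add: lookup_add lookup_single_var)
        then show False using j(2) by simp
      qed
      have max: "max_var v t = k"
      proof (rule max_var_eqI [OF k])
        show "0 < lookup t (v k)"
          using k j(1) False by (simp add: t_def lookup_minus lookup_add lookup_single_var)
        show "lookup t (v m) = 0" if "m \<in> vars" "k < m" for m
          using k above that by (simp add: t_def lookup_minus lookup_add lookup_single_var)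
      qed
      have "mdeg t = mdeg u" using arg_cong [OF t, of mdeg] by (simp add: mdeg_add)
      then have "monomial t \<in> truncation I e"
        using tI deg I(1) by (simp add: monomial_mem_truncation)
      moreover have "t \<noteq> 0"
        using k j(1) False by (auto simp: t_def lookup_minus lookup_add lookup_single_var dest!: arg_cong [of _ _ "\<lambda>t. lookup t (v k)"])
      moreover have "1 \<le> j \<and> j < k" using False \<open>j \<le> k\<close> j(1) by (simp add: indices_def)
      ultimately have "monomial (t + single (v j) 1 - single (v k) 1) \<in> truncation I e"
        using stable max unfolding stable_ideal_def by blast
      then show ?thesis using t I(1) by (simp add: monomial_mem_truncation)
    qed
  qed
  ultimately show "0 \<le> e \<and> sat I (nat e)" by blast
next
  assume e: "0 \<le> e" and sat: "sat I (nat e)"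
  have "int (mdeg m) \<le> e" if m: "m \<in> min_gens I" for m
  proof (rule ccontr)
    assume "\<not> int (mdeg m) \<le> e"
    then have large: "nat e < mdeg m" using e by linarith
    then have "m \<noteq> 0" by auto
    note max = max_var_props [OF this]
    let ?k = "max_var v m"
    let ?u = "m - single (v ?k) 1"
    have u: "?u + single (v ?k) 1 = m" using max(2) by (intro divides_diff_add single_divides)
    have "mdeg ?u + 1 = mdeg m" using arg_cong [OF u, of mdeg] by (simp add: mdeg_add)
    have "monomial ?u \<in> I"
    proof (rule satD [OF sat max(1)])
      show "lookup ?u (v l) = 0" if "l \<in> vars" "?k < l" for l
        using max(3) [OF that] by (simp add: lookup_minus)
    qed (use u m large \<open>mdeg ?u + 1 = mdeg m\<close> in \<open>auto simp: min_gens_def\<close>)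
    moreover have "\<forall>i. lookup ?u i \<le> lookup m i" by (simp add: lookup_minus)
    ultimately have "?u = m" using m by (auto simp: min_gens_def)
    then show False using \<open>mdeg ?u + 1 = mdeg m\<close> by simp
  qed
  moreover have "stable_ideal v (truncation I e)"
    unfolding stable_ideal_def
  proof (intro conjI monomial_ideal_truncation allI impI; elim conjE)
    fix u i assume u: "monomial u \<in> truncation I e" "u \<noteq> 0" and i: "1 \<le> i" "i < max_var v u"
    note max = max_var_props [OF u(2)]
    let ?k = "max_var v u"
    let ?w = "u + single (v i) 1 - single (v ?k) 1"
    have iv: "i \<in> vars" using i max(1) by (auto simp: indices_def)
    have w: "?w + single (v ?k) 1 = u + single (v i) 1"
      using max(2) by (intro divides_diff_add single_divides) (simp add: lookup_add)
    have deg: "mdeg ?w = mdeg u" using arg_cong [OF w, of mdeg] by (simp add: mdeg_add)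
    have uI: "monomial u \<in> I" "e \<le> int (mdeg u)"
      using u(1) I(1) by (simp_all add: monomial_mem_truncation)
    have "monomial ?w \<in> I"
    proof (rule satD [OF sat max(1)])
      show "lookup ?w (v l) = 0" if "l \<in> vars" "?k < l" for l
        using max(3) [OF that] i(2) that iv by (simp add: lookup_minus lookup_add lookup_single_var)
      show "monomial (?w + single (v ?k) 1) \<in> I"
        unfolding w by (rule monomial_ideal_divides [OF I(1) uI(1)]) simp
    qed (use deg uI in simp)
    then show "monomial ?w \<in> truncation I e"
      using deg uI I(1) by (simp add: monomial_mem_truncation)
  qed
  ultimately show "(\<forall>u\<in>min_gens I. int (mdeg u) \<le> e) \<and> stable_ideal v (truncation I e)" by blast
qed

end

section \<open>Koszul homology of a monomial ideal: vanishing and nonvanishing\<close>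

context resolved
begin

text \<open>The coefficients would have negative degree. This lower bound is half of the finiteness
  on which \<open>Max\<close> in \<open>regularity\<close> relies.\<close>

lemma acyclic_below: "j < int i \<Longrightarrow> acyclic ideal_module i j"
  unfolding acyclic_def
proof (intro ballI impI)
  fix z assume j: "j < int i" and z: "z \<in> chains ideal_module i j"
  have "z T p = 0" for T p
  proof (cases "T \<subseteq> vars \<and> card T = i")
    case True
    then have "z T \<in> ideal_module (j - int i)" using chains_mem [OF z] by blast
    then show ?thesis
      using homogeneous_neg_eq_0 [of "j - int i" "z T 0"] j
      by (cases "p = 0") (auto simp: ideal_module_def)
  next
    case False
    then show ?thesis using chains_zero [OF z False] by simp
  qed
  then have "kd 0 = z" by (simp add: kd_zero fun_eq_iff)
  moreover have "0 \<in> chains ideal_module (Suc i) j"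
    using graded_submodule_zero [OF graded_submodule_syz [of 0]] by (simp add: chains_def syz_0)
  ultimately show "\<exists>w\<in>chains ideal_module (Suc i) j. kd w = z" by blast
qed

text \<open>Multiplying by the last variable of the multidegree contracts the Koszul complex.\<close>

lemma acyclic_above:
  assumes mono: "monomial_ideal I" and sat: "sat I e" and j: "int i + int e < j"
  shows "acyclic ideal_module i j"
  unfolding acyclic_def
proof (intro ballI impI)
  fix z assume z: "z \<in> chains ideal_module i j" and cycle: "kd z = 0"
  have face: "T \<subseteq> vars \<and> card T = i" if "a \<in> keys (z T p)" for a T p
    using that chains_zero [OF z, of T] by (metis keys_zero zero_fun_apply empty_iff)
  have key: "monomial a \<in> I \<and> int (mdeg a) = j - int i" if "a \<in> keys (z T 0)" for a T
  proof -
    have "z T \<in> ideal_module (j - int i)" using face [OF that] chains_mem [OF z] by blast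
    then have "z T 0 \<in> I" "homogeneous (j - int i) (z T 0)"
      by (simp_all add: ideal_module_def)
    then show ?thesis
      using that monomial_ideal_mem_iff [OF mono, of "z T 0"] unfolding homogeneous_def by blast
  qed
  have z_p: "z T p = 0" if "p > 0" for T p
    using that chains_zero [OF z, of T] chains_mem [OF z, of T]
    by (cases "T \<subseteq> vars \<and> card T = i") (auto simp: ideal_module_def)
  have nonzero: "a + sqf T \<noteq> 0" if "a \<in> keys (z T 0)" for a T
  proof
    assume "a + sqf T = 0"
    then have "mdeg a = 0" by (metis add_is_0 mdeg_add mdeg_zero)
    then show False using key [OF that] j by simp
  qed
  obtain w where w: "cdiff w = (\<lambda>T. z T 0)" "\<And>T. \<not> T \<subseteq> vars \<Longrightarrow> w T = 0"
    "\<And>T a. a \<in> keys (w T) \<Longrightarrow> max_var v (a + sqf T) \<in> T \<and>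
      (\<exists>a'\<in>keys (z (T - {max_var v (a + sqf T)}) 0). a' + sqf (T - {max_var v (a + sqf T)}) = a + sqf T)"
  proof (rule cone [of "\<lambda>T. z T 0" "max_var v"])
    show "z T 0 = 0" if "\<not> T \<subseteq> vars" for T
      using that chains_zero [OF z, of T] by simp
    show "cdiff (\<lambda>T. z T 0) T = 0" for T
      using fun_cong [OF fun_cong [OF cycle, of T], of 0] by (simp add: kd_def)
    show "max_var v (a + sqf T) \<in> vars" if "a \<in> keys (z T 0)" for T a
      using max_var_props(1) nonzero [OF that] .
    show "sqf (insert (max_var v (a + sqf T)) T) \<preceq> a + sqf T" if "T \<subseteq> vars" "a \<in> keys (z T 0)" for T a
      using max_var_props(1,2) [OF nonzero [OF that(2)]] that(1)
      by (subst sqf_divides_iff) (auto simp: lookup_add lookup_sqf subset_iff)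
  qed blast
  have w_key: "card T = Suc i \<and> monomial a \<in> I \<and> int (mdeg a) = j - int (Suc i)" if a: "a \<in> keys (w T)" for T a
  proof -
    obtain k where k_def: "k = max_var v (a + sqf T)" by blast
    let ?T = "T - {k}"
    have T: "T \<subseteq> vars" using a w(2) by (metis keys_zero empty_iff)
    obtain a' where a': "a' \<in> keys (z ?T 0)" "a' + sqf ?T = a + sqf T" and k: "k \<in> T"
      using w(3) [OF a] unfolding k_def by blast
    have sqfT: "sqf T = single (v k) 1 + sqf ?T"
      using sqf_insert [of ?T k] finite_face [OF T] k by (simp add: insert_absorb)
    have eq: "a' = a + single (v k) 1"
      using a'(2) unfolding sqfT by (metis add.assoc add_right_cancel)
    have card: "card T = Suc i"
      using face [OF a'(1)] card.remove [OF finite_face [OF T] k] by simp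
    have deg: "int (mdeg a) = j - int (Suc i)"
      using key [OF a'(1)] by (simp add: eq mdeg_add)
    have "a + sqf T \<noteq> 0" using nonzero [OF a'(1)] a'(2) by simp
    note max = max_var_props [OF this, folded k_def]
    \<comment> \<open>x_k a lies in I and x_k is the last variable of the multidegree, so
      \<open>sat\<close> cancels it: deg a = j - i - 1 \<ge> e.\<close>
    have "monomial a \<in> I"
    proof (rule satD [OF sat max(1)])
      show "lookup a (v m) = 0" if "m \<in> vars" "k < m" for m
        using max(3) [OF that] by (simp add: lookup_add)
      show "e \<le> mdeg a" using deg j by simp
      show "monomial (a + single (v k) 1) \<in> I" using key [OF a'(1)] eq by simp
    qed
    then show ?thesis using card deg by blast
  qed
  define W where "W T p = (if p = 0 then w T else 0)" for T and p :: nat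
  have "W \<in> chains ideal_module (Suc i) j"
  proof (rule chainsI)
    show "W T \<in> ideal_module (j - int (Suc i))" for T
      using w_key monomial_ideal_mem_iff [OF mono, of "w T"] by (auto simp: ideal_module_def W_def homogeneous_def)
    show "W T = 0" if "\<not> (T \<subseteq> vars \<and> card T = Suc i)" for T
    proof -
      have "a \<notin> keys (w T)" for a using w_key w(2) that by (metis keys_zero empty_iff)
      then have "w T = 0" by (intro poly_mapping_eqI) (simp add: in_keys_iff)
      then show ?thesis by (simp add: W_def fun_eq_iff)
    qed
  qed
  moreover have "kd W = z"
  proof (intro ext)
    fix T p
    show "kd W T p = z T p"
    proof (cases "p = 0")
      case True
      then have "kd W T p = cdiff w T" by (simp add: kd_def W_def)
      then show ?thesis using True by (simp add: w(1))
    next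
      case False
      then show ?thesis using z_p by (simp add: kd_def W_def cdiff_sqf)
    qed
  qed
  ultimately show "\<exists>w\<in>chains ideal_module (Suc i) j. kd w = z" by blast
qed

text \<open>The class of \<open>u e\<^sub>1 \<and> \<dots> \<and> e\<^sub>k\<close> in the Koszul homology of \<open>S/I\<close>, moved to that of \<open>I\<close> by the
  connecting map: no other face lives in its multidegree.\<close>

lemma not_acyclic:
  assumes mono: "monomial_ideal I" and k: "k \<in> vars"
    and above: "\<And>m. m \<in> vars \<Longrightarrow> k < m \<Longrightarrow> lookup u (v m) = 0"
    and uI: "monomial u \<notin> I" and socle: "\<And>l. l \<in> vars \<Longrightarrow> l \<le> k \<Longrightarrow> monomial (u + single (v l) 1) \<in> I"
  shows "\<not> acyclic ideal_module (k - 1) (int (mdeg u) + int k)"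
proof
  assume acyc: "acyclic ideal_module (k - 1) (int (mdeg u) + int k)"
  define A where "A = {1..k}"
  have A: "A \<subseteq> vars" "card A = k" "finite A" "k \<in> A"
    using k by (auto simp: A_def indices_def)
  \<comment> \<open>Y is a chain of S but not of I; its boundary has coefficients x_l u with l \<le>
    k, up to sign, and these lie in I.\<close>
  define Y where "Y T p = (if T = A \<and> p = (0::nat) then monomial u :: ('n, 'k) mpoly else 0)" for T p
  have Y_p: "Y T p = 0" if "p > 0" for T p using that by (simp add: Y_def)
  have kdY: "kd Y \<in> chains ideal_module (k - 1) (int (mdeg u) + int k)"
  proof (rule chainsI)
    show "kd Y T \<in> ideal_module (int (mdeg u) + int k - int (k - 1))" if T: "T \<subseteq> vars" for T
    proof -
      have term_I: "svar l T * Y (insert l T) 0 \<in> I" if "l \<in> vars - T" for l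
      proof (cases "insert l T = A")
        case True
        then have "l \<le> k" unfolding A_def by (metis atLeastAtMost_iff insertI1)
        then have "monomial (single (v l) 1 + u) \<in> I"
          using socle [of l] that by (auto simp: A_def add.commute [of _ u])
        moreover have "svar l T * Y (insert l T) 0 = single 0 (ksign l T) * monomial (single (v l) 1 + u)"
          using True by (simp add: svar_def Y_def monomial_def mult_single)
        ultimately show ?thesis
          using ideal.subspace_scale [OF ideal] by simp
      next
        case False
        then show ?thesis using ideal.subspace_0 [OF ideal] by (simp add: Y_def)
      qed
      have "homogeneous (int (mdeg u)) (Y T' 0)" for T'
        by (simp add: Y_def homogeneous_monomial)
      then have "homogeneous (1 + int (mdeg u)) (svar l T * Y (insert l T) 0)" for l
        by (intro homogeneous_mult homogeneous_svar)
      then have "homogeneous (1 + int (mdeg u)) (kd Y T 0)"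
        unfolding kd_def cdiff_sqf by (auto intro: homogeneous_sum)
      moreover have "kd Y T 0 \<in> I"
        unfolding kd_def cdiff_sqf using T term_I by (auto intro: ideal.subspace_sum [OF ideal])
      moreover have "int (mdeg u) + int k - int (k - 1) = 1 + int (mdeg u)"
        using k by (auto simp: indices_def)
      moreover have "kd Y T p = 0" if "p > 0" for p
        by (simp add: kd_def cdiff_sqf Y_p [OF that])
      ultimately show ?thesis
        by (simp only: ideal_module_def mem_Collect_eq) simp
    qed
    show "kd Y T = 0" if "\<not> (T \<subseteq> vars \<and> card T = k - 1)" for T
    proof -
      have "insert l T \<noteq> A" if l: "T \<subseteq> vars" "l \<in> vars - T" for l
      proof
        assume "insert l T = A"
        then have "card A = Suc (card T)" using l finite_face [OF l(1)] by auto
        then show False using A(2) l(1) \<open>\<not> (T \<subseteq> vars \<and> card T = k - 1)\<close> by simp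
      qed
      then show ?thesis
        by (auto simp: kd_eq Y_def fun_eq_iff intro!: sum.neutral)
    qed
  qed
  then obtain w where w: "w \<in> chains ideal_module (Suc (k - 1)) (int (mdeg u) + int k)" "kd w = kd Y"
    using acyc kd_kd unfolding acyclic_def by blast
  have Suc_k: "Suc (k - 1) = k" using k by (simp add: indices_def)
  define b where "b = u + sqf A"
  \<comment> \<open>No variable beyond x_k divides b, so A is the only face with k elements whose
    label divides b; a nonzero coefficient there would put u into I.\<close>
  have cf_w: "cf (\<lambda>T. w T 0) b T = 0" if T: "T \<subseteq> vars" for T
  proof (rule ccontr)
    assume nz: "cf (\<lambda>T. w T 0) b T \<noteq> 0"
    then have "w T \<noteq> 0" "sqf T \<preceq> b" and lk: "lookup (w T 0) (b - sqf T) \<noteq> 0"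
      by (auto simp: cf_def split: if_splits)
    then have card: "card T = k" using chains_zero [OF w(1), of T] Suc_k by auto
    have "t \<in> A" if "t \<in> T" for t
    proof (rule ccontr)
      assume "t \<notin> A"
      then have "k < t" "t \<in> vars" using that T by (auto simp: A_def indices_def)
      then have "lookup b (v t) = 0"
        using above [of t] lookup_sqf [OF A(1), of t] \<open>t \<notin> A\<close> by (simp add: b_def lookup_add)
      then show False using \<open>sqf T \<preceq> b\<close> that sqf_divides_iff [OF T] by auto
    qed
    then have "T = A" using card_subset_eq [OF A(3), of T] card A(2) by auto
    then have "u \<in> keys (w A 0)" using lk by (simp add: b_def in_keys_iff)
    moreover have "w A 0 \<in> I"
      using chains_mem [OF w(1) A(1)] A(2) Suc_k by (simp add: ideal_module_def)
    ultimately show False using uI monomial_ideal_mem_iff [OF mono] by blast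
  qed
  \<comment> \<open>The two equal boundaries are compared at one facet of A in multidegree b: w
    gives 0 there, Y gives a sign.\<close>
  let ?T = "A - {k}"
  have T: "?T \<subseteq> vars" using A(1) by auto
  have "cf (cdiff (\<lambda>T. w T 0)) b ?T = 0"
    unfolding cf_cdiff [OF T] by (intro sum.neutral ballI) (use T in \<open>simp add: cf_w\<close>)
  moreover have "cdiff (\<lambda>T. w T 0) = cdiff (\<lambda>T. Y T 0)"
  proof
    fix T show "cdiff (\<lambda>T. w T 0) T = cdiff (\<lambda>T. Y T 0) T"
      using fun_cong [OF fun_cong [OF w(2), of T], of 0] by (simp add: kd_def)
  qed
  moreover have "cf (cdiff (\<lambda>T. Y T 0)) b ?T = ksign k ?T"
  proof -
    have cfY: "cf (\<lambda>T. Y T 0) b (insert l ?T) = (if l = k then 1 else 0)" if "l \<in> vars - ?T" for l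
    proof -
      have "insert l ?T = A \<longleftrightarrow> l = k" using that A(4) by auto
      moreover have "cf (\<lambda>T. Y T 0) b A = 1" by (simp add: cf_def b_def Y_def lookup_monomial)
      ultimately show ?thesis by (cases "l = k") (auto simp: cf_zero Y_def)
    qed
    have "cf (cdiff (\<lambda>T. Y T 0)) b ?T = (\<Sum>l\<in>vars - ?T. if l = k then ksign l ?T else 0)"
      unfolding cf_cdiff [OF T] by (intro sum.cong refl) (simp only: cfY mult_1_right mult_zero_right split: if_split, simp)
    also have "\<dots> = ksign k ?T" using k finite_vars by (simp add: sum.delta)
    finally show ?thesis .
  qed
  ultimately show False using ksign_nonzero by metis
qed

end

lemma regularity_eq:
  fixes I :: "('n::finite, 'k::field) mpoly set"
  assumes v: "numbering v" and I: "monomial_ideal I" "I \<noteq> {0}"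
    and sat: "koszul.sat v I e" and least: "\<And>e'. koszul.sat v I e' \<Longrightarrow> e \<le> e'"
  shows "regularity I = int e"
proof -
  interpret resolved v "resolution I" I
    by unfold_locales (use v I graded_free_resolution_resolution monomial_ideal_subspace in auto)
  have tor: "Tor_nonzero I i j \<longleftrightarrow> \<not> acyclic ideal_module i j" for i j
    using tor_zero_iff by (simp add: Tor_nonzero_iff)
  let ?R = "{j - int i |i j. Tor_nonzero I i j}"
  have "0 \<le> j - int i \<and> j - int i \<le> int e" if "Tor_nonzero I i j" for i j
    using that tor acyclic_below [of j i] acyclic_above [OF I(1) sat, of i j] by fastforce
  then have sub: "?R \<subseteq> {0..int e}" by auto
  have "int e \<in> ?R"
  proof (cases e)
    case 0
    \<comment> \<open>There is no smaller exponent to violate when e = 0. Instead I is the unit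
      ideal, and its generator 1 survives in degree 0 of Tor_0.\<close>
    have "\<forall>u\<in>min_gens I. int (mdeg u) \<le> 0"
      using stable_truncation_iff_sat [OF I, of 0] sat 0 by simp
    moreover obtain f where "f \<in> I" "f \<noteq> 0"
      using I ideal.subspace_0 [OF monomial_ideal_subspace [OF I(1)]] by blast
    moreover obtain u where "u \<in> keys f" using \<open>f \<noteq> 0\<close> by (metis keys_eq_empty ex_in_conv)
    ultimately have "(0 :: 'n \<Rightarrow>\<^sub>0 nat) \<in> min_gens I"
      using min_gens_divides [of u I] monomial_ideal_mem_iff [OF I(1), of f] by (auto simp: mdeg_eq_0_iff)
    then have "1 \<in> I" by (simp add: min_gens_def monomial_zero)
    define z where "z T p = (if T = {} \<and> p = (0::nat) then 1 :: ('n, 'k) mpoly else 0)" for T :: "nat set" and p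
    have "homogeneous 0 (1 :: ('n, 'k) mpoly)" by (simp add: homogeneous_def)
    then have z: "z \<in> chains ideal_module 0 0"
      using \<open>1 \<in> I\<close> by (simp add: zero_chain z_def [abs_def] ideal_module_def fun_eq_iff)
    have "\<not> acyclic ideal_module 0 0"
    proof
      assume "acyclic ideal_module 0 0"
      then obtain w where w: "kd w = z"
        using z kd_zero_chain [OF z] unfolding acyclic_def by blast
      then have "constant_coeff (z {} 0) = 0" using constant_coeff_kd by metis
      then show False by (simp add: z_def constant_coeff_def)
    qed
    then have "Tor_nonzero I 0 0" using tor by blast
    then have "0 - int 0 \<in> ?R" by blast
    then show ?thesis using 0 by simp
  next
    case (Suc e')
    then have "\<not> koszul.sat v I e'" using least [of e'] by auto
    then obtain k u where k: "k \<in> vars" and above: "\<forall>m\<in>vars. k < m \<longrightarrow> lookup u (v m) = 0"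
      and deg: "e' \<le> mdeg u" and xu: "monomial (u + single (v k) 1) \<in> I" and uI: "monomial u \<notin> I"
      unfolding sat_def by blast
    \<comment> \<open>In larger degree \<open>sat I e\<close> would apply to u itself.\<close>
    have "mdeg u = e'"
      using satD [OF sat k _ _ xu] above deg uI Suc by (metis le_antisym not_less_eq_eq)
    \<comment> \<open>x_l u has degree e, and x_k times it lies in I, so \<open>sat I e\<close>
      cancels x_k again.\<close>
    have "monomial (u + single (v l) 1) \<in> I" if l: "l \<in> vars" "l \<le> k" for l
    proof (cases "l = k")
      case False
      show ?thesis
      proof (rule satD [OF sat k])
        show "lookup (u + single (v l) 1) (v m) = 0" if "m \<in> vars" "k < m" for m
          using above that l by (simp add: lookup_add lookup_single_var)
        show "e \<le> mdeg (u + single (v l) 1)" using \<open>mdeg u = e'\<close> Suc by (simp add: mdeg_add)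
        show "monomial (u + single (v l) 1 + single (v k) 1) \<in> I"
          by (rule monomial_ideal_divides [OF I(1) xu]) (simp add: divides_def lookup_add)
      qed
    qed (use xu in simp)
    then have "\<not> acyclic ideal_module (k - 1) (int (mdeg u) + int k)"
      using above by (intro not_acyclic [OF I(1) k _ uI]) auto
    then have "Tor_nonzero I (k - 1) (int (mdeg u) + int k)" using tor by blast
    moreover have "int e = int (mdeg u) + int k - int (k - 1)"
      using \<open>mdeg u = e'\<close> Suc k by (auto simp: indices_def)
    ultimately show ?thesis by blast
  qed
  moreover have "finite ?R" using sub by (rule finite_subset) simp
  ultimately show ?thesis
    unfolding regularity_def by (intro Max_eqI) (use subsetD [OF sub] in simp_all)
qed

section \<open>Associated primes of monomial ideals\<close>

text \<open>This stands in for a monomial order: maximising one exponent after another in A and in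
  B, as a lexicographic order does, singles out a pair whose sum arises in no other way.\<close>

lemma unique_sum:
  fixes A B :: "('n::finite \<Rightarrow>\<^sub>0 nat) set"
  assumes "finite A" "finite B" "A \<noteq> {}" "B \<noteq> {}"
  shows "\<exists>a\<in>A. \<exists>b\<in>B. \<forall>a'\<in>A. \<forall>b'\<in>B. a' + b' = a + b \<longrightarrow> a' = a"
proof -
  have "\<exists>a\<in>A. \<exists>b\<in>B. \<forall>a'\<in>A. \<forall>b'\<in>B. a' + b' = a + b \<longrightarrow> (\<forall>i\<in>J. lookup a' i = lookup a i)"
    if "finite J" for J
    using that assms
  proof (induction J arbitrary: A B rule: finite_induct)
    case (insert x J)
    define p where "p = Max ((\<lambda>a. lookup a x) ` A)"
    define q where "q = Max ((\<lambda>b. lookup b x) ` B)"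
    let ?A = "{a \<in> A. lookup a x = p}" and ?B = "{b \<in> B. lookup b x = q}"
    have "p \<in> (\<lambda>a. lookup a x) ` A" "q \<in> (\<lambda>b. lookup b x) ` B"
      using insert.prems by (auto simp: p_def q_def intro!: Max_in)
    then have ne: "?A \<noteq> {}" "?B \<noteq> {}" by auto
    have fin: "finite ?A" "finite ?B" using insert.prems by simp_all
    obtain a b where ab: "a \<in> ?A" "b \<in> ?B"
      "\<forall>a'\<in>?A. \<forall>b'\<in>?B. a' + b' = a + b \<longrightarrow> (\<forall>i\<in>J. lookup a' i = lookup a i)"
      using insert.IH [OF fin ne] by blast
    have max: "lookup a' x \<le> p" "lookup b' x \<le> q" if "a' \<in> A" "b' \<in> B" for a' b'
      using that insert.prems by (auto simp: p_def q_def)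
    have "\<forall>i\<in>insert x J. lookup a' i = lookup a i" if ab': "a' \<in> A" "b' \<in> B" "a' + b' = a + b" for a' b'
    proof -
      have "lookup a' x + lookup b' x = p + q"
        using arg_cong [OF ab'(3), of "\<lambda>t. lookup t x"] ab(1,2) by (simp add: lookup_add)
      then have x: "lookup a' x = p" "lookup b' x = q"
        using max [OF ab'(1,2)] by linarith+
      then have "\<forall>i\<in>J. lookup a' i = lookup a i"
        using ab(3) ab' by blast
      then show ?thesis using x ab(1) by simp
    qed
    then show ?case using ab(1,2) by blast
  qed auto
  from this [of UNIV] show ?thesis
    by (simp add: poly_mapping_eq_iff fun_eq_iff)
qed

lemma lookup_mult_keys:
  fixes a b :: "('n, 'k::field) mpoly"
  shows "lookup (a * b) t = (\<Sum>u\<in>keys a. if u \<preceq> t then lookup a u * lookup b (t - u) else 0)"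
proof -
  have "a * b = (\<Sum>u\<in>keys a. single u (lookup a u) * b)"
    by (subst poly_mapping_sum_single [of a]) (simp add: sum_distrib_right)
  then show ?thesis
    by (simp add: lookup_sum lookup_single_mult)
qed

text \<open>Q is closed under products and divisors, so a product in Q has both factors in Q, and
  the term of the pair from \<open>unique_sum\<close> cannot cancel. With Q all monomials this shows
  that S is a domain; with the monomials free of N, that (x_i : i \<in> N) is prime.\<close>

lemma product_key:
  fixes a b :: "('n::finite, 'k::field) mpoly"
  assumes Q: "\<And>u w. u + w \<in> Q \<Longrightarrow> u \<in> Q \<and> w \<in> Q" "\<And>u w. u \<in> Q \<Longrightarrow> w \<in> Q \<Longrightarrow> u + w \<in> Q"
    and "keys a \<inter> Q \<noteq> {}" "keys b \<inter> Q \<noteq> {}"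
  shows "keys (a * b) \<inter> Q \<noteq> {}"
proof -
  obtain u w where u: "u \<in> keys a \<inter> Q" and w: "w \<in> keys b \<inter> Q"
    and uniq: "\<forall>u'\<in>keys a \<inter> Q. \<forall>w'\<in>keys b \<inter> Q. u' + w' = u + w \<longrightarrow> u' = u"
    using unique_sum [of "keys a \<inter> Q" "keys b \<inter> Q"] assms(3,4) by auto
  have "(if u' \<preceq> u + w then lookup a u' * lookup b (u + w - u') else 0) = 0" if u': "u' \<in> keys a - {u}" for u'
  proof (rule ccontr)
    assume *: "\<not> ?thesis"
    then have eq: "u' + (u + w - u') = u + w"
      using divides_diff_add [of u' "u + w"] by (auto simp: add.commute split: if_splits)
    have "u + w \<in> Q" using Q(2) u w by blast
    then have "u' \<in> Q" "u + w - u' \<in> Q" using Q(1) eq by metis+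
    moreover have "u + w - u' \<in> keys b" using * by (auto simp: in_keys_iff split: if_splits)
    ultimately show False using uniq u' eq by blast
  qed
  then have "lookup (a * b) (u + w) = (\<Sum>u'\<in>{u}. if u' \<preceq> u + w then lookup a u' * lookup b (u + w - u') else 0)"
    unfolding lookup_mult_keys using u by (intro sum.mono_neutral_right) auto
  also have "\<dots> \<noteq> 0" using u w by (simp add: in_keys_iff)
  finally have "u + w \<in> keys (a * b)" by (simp add: in_keys_iff)
  then show ?thesis using Q(2) u w by blast
qed

lemma mpoly_mult_nonzero:
  fixes a b :: "('n::finite, 'k::field) mpoly"
  assumes "a \<noteq> 0" "b \<noteq> 0"
  shows "a * b \<noteq> 0"
  using product_key [of UNIV a b] assms by (metis Int_UNIV_right UNIV_I keys_eq_empty)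

section \<open>Primes generated by variables\<close>

lemma var_image: "var ` N = monomial ` (\<lambda>i. single i 1) ` N"
  by (simp add: var_def image_image)

lemma mem_span_vars:
  fixes f :: "('n, 'k::field) mpoly"
  shows "f \<in> ideal.span (var ` N) \<longleftrightarrow> (\<forall>u\<in>keys f. \<exists>i\<in>N. 0 < lookup u i)"
  unfolding var_image mem_span_monomials by (simp add: single_divides_iff)

lemma var_mem_span_vars: "(var x :: ('n, 'k::field) mpoly) \<in> ideal.span (var ` N) \<longleftrightarrow> x \<in> N"
proof -
  have "keys (var x :: ('n, 'k) mpoly) = {single x 1}" by (simp add: var_def)
  then show ?thesis
    unfolding mem_span_vars by (auto simp: lookup_single when_def split: if_splits)
qed

lemma prime_ideal_vars: "prime_ideal (ideal.span (var ` N) :: ('n::finite, 'k::field) mpoly set)"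
  unfolding prime_ideal_def
proof (intro conjI allI impI)
  let ?P = "ideal.span (var ` N) :: ('n, 'k) mpoly set"
  have "1 \<notin> ?P" by (simp add: mem_span_vars)
  then show "?P \<noteq> UNIV" by blast
  show "a \<in> ?P \<or> b \<in> ?P" if ab: "a * b \<in> ?P" for a b
  proof (rule ccontr)
    assume not: "\<not> (a \<in> ?P \<or> b \<in> ?P)"
    define Q where "Q = {u :: 'n \<Rightarrow>\<^sub>0 nat. \<forall>i\<in>N. lookup u i = 0}"
    have Q: "f \<in> ?P \<longleftrightarrow> keys f \<inter> Q = {}" for f
      by (auto simp: mem_span_vars Q_def)
    have "keys (a * b) \<inter> Q \<noteq> {}"
      using not by (intro product_key) (auto simp: Q Q_def lookup_add)
    then show False using ab Q by blast
  qed
qed simp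

lemma keys_diff_single:
  fixes f :: "('n, 'k::field) mpoly"
  shows "keys (f - single u (lookup f u)) = keys f - {u}"
  by (auto simp: in_keys_iff lookup_minus lookup_single when_def split: if_splits)

text \<open>Let P = (I : f) with as few terms in f as possible. If a monomial w carried one term of
  f into I without lying in P, then w times the rest of f would have the same annihilator, P being
  prime, and fewer terms. Hence P contains the monomials of its elements, and primality reduces
  these to variables.\<close>

lemma Ass_monomial_ideal:
  fixes I :: "('n::finite, 'k::field) mpoly set"
  assumes I: "monomial_ideal I" and P: "P \<in> Ass I"
  shows "P = ideal.span (var ` {i. var i \<in> P})"
proof -
  have prime: "prime_ideal P" using P by (simp add: Ass_def)
  then have sub: "ideal.subspace P" and "P \<noteq> UNIV"
    and prime_mult: "\<And>a b. a * b \<in> P \<Longrightarrow> a \<in> P \<or> b \<in> P"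
    by (auto simp: prime_ideal_def)
  note subI = monomial_ideal_subspace [OF I]
  have one: "1 \<notin> P"
    using \<open>P \<noteq> UNIV\<close> ideal.subspace_scale [OF sub, of 1] by auto
  obtain f\<^sub>0 where "P = {g. g * f\<^sub>0 \<in> I}"
    using P unfolding Ass_def by blast
  from ex_has_least_nat [of "\<lambda>f. P = {g. g * f \<in> I}", OF this, of "\<lambda>f. card (keys f)"]
  obtain f where f: "P = {g. g * f \<in> I}"
    and f_min: "\<And>f'. P = {g. g * f' \<in> I} \<Longrightarrow> card (keys f) \<le> card (keys f')"
    by blast
  have colon: "monomial w \<in> P" if u: "u \<in> keys f" and wu: "monomial (w + u) \<in> I" for u w
  proof (rule ccontr)
    assume w: "monomial w \<notin> P"
    let ?r = "f - single u (lookup f u)"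
    let ?f = "monomial w * ?r"
    have *: "monomial w * single u (lookup f u) = single 0 (lookup f u) * monomial (w + u)"
      by (simp add: monomial_def mult_single)
    have rest: "monomial w * single u (lookup f u) \<in> I"
      unfolding * by (rule ideal.subspace_scale [OF subI wu])
    have "g * ?f \<in> I \<longleftrightarrow> g \<in> P" for g
    proof -
      have "g * ?f = (g * monomial w) * f - g * (monomial w * single u (lookup f u))"
        by (simp only: right_diff_distrib mult.assoc)
      moreover have "g * (monomial w * single u (lookup f u)) \<in> I"
        using ideal.subspace_scale [OF subI rest] .
      ultimately have "g * ?f \<in> I \<longleftrightarrow> (g * monomial w) * f \<in> I"
        using ideal.subspace_diff [OF subI, of "(g * monomial w) * f" "g * (monomial w * single u (lookup f u))"]
          ideal.subspace_add [OF subI, of "g * ?f" "g * (monomial w * single u (lookup f u))"]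
        by (metis diff_add_cancel)
      also have "\<dots> \<longleftrightarrow> g * monomial w \<in> P" by (simp add: f)
      also have "\<dots> \<longleftrightarrow> g \<in> P"
      proof
        assume "g \<in> P"
        then have "monomial w * g \<in> P" by (rule ideal.subspace_scale [OF sub])
        then show "g * monomial w \<in> P" by (simp only: mult.commute)
      qed (use prime_mult w in blast)
      finally show ?thesis .
    qed
    then have "card (keys f) \<le> card (keys ?f)" by (intro f_min) blast
    also have "\<dots> \<le> card (keys ?r)"
    proof -
      have "keys ?f \<subseteq> (\<lambda>t. w + t) ` keys ?r" using keys_mult [of "monomial w" ?r] by auto
      then show ?thesis by (meson card_image_le card_mono finite_imageI finite_keys le_trans)
    qed
    also have "keys ?r = keys f - {u}"
      by (rule keys_diff_single)
    finally show False using card_Diff1_less [OF finite_keys u] by linarith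
  qed
  have "f \<noteq> 0" using f \<open>P \<noteq> UNIV\<close> ideal.subspace_0 [OF subI] by auto
  \<comment> \<open>S is a domain, so g f has a monomial w u with w in g and u in f. It lies in I,
    hence w \<in> P by \<open>colon\<close>, and the term of w can be split off from g.\<close>
  have graded: "\<forall>w\<in>keys g. monomial w \<in> P" if "g \<in> P" for g
    using that
  proof (induction "card (keys g)" arbitrary: g rule: less_induct)
    case less
    show ?case
    proof (cases "g = 0")
      case False
      then have "g * f \<noteq> 0" using \<open>f \<noteq> 0\<close> by (rule mpoly_mult_nonzero)
      then obtain t where t: "t \<in> keys (g * f)" by (metis keys_eq_empty ex_in_conv)
      then obtain w u where wu: "t = w + u" "w \<in> keys g" "u \<in> keys f" using keys_mult [of g f] by blast
      have "g * f \<in> I" using less.prems f by blast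
      then have "monomial (w + u) \<in> I" using t wu(1) monomial_ideal_mem_iff [OF I] by blast
      then have wP: "monomial w \<in> P" using colon wu by blast
      let ?g = "g - single w (lookup g w)"
      have "single w (lookup g w) = single 0 (lookup g w) * monomial w"
        by (simp add: monomial_def mult_single)
      then have "?g \<in> P"
        using ideal.subspace_diff [OF sub less.prems] ideal.subspace_scale [OF sub wP] by simp
      moreover have keys_g: "keys ?g = keys g - {w}"
        by (rule keys_diff_single)
      then have "card (keys ?g) < card (keys g)"
        using wu(2) by (metis card_Diff1_less finite_keys)
      ultimately have "\<forall>w\<in>keys ?g. monomial w \<in> P" using less.hyps by blast
      then show ?thesis using wP keys_g by blast
    qed simp
  qed
  have var_factor: "\<exists>i. 0 < lookup w i \<and> var i \<in> P" if "monomial w \<in> P" for w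
    using that
  proof (induction "mdeg w" arbitrary: w)
    case 0
    then have "w = 0" by (simp add: mdeg_eq_0_iff)
    then show ?case using 0(2) one by (simp add: monomial_zero)
  next
    case (Suc d)
    then obtain i where i: "0 < lookup w i" by (metis mdeg_pos_obtain zero_less_Suc)
    define w' where "w' = w - single i 1"
    have w: "w' + single i 1 = w" unfolding w'_def using i by (intro divides_diff_add single_divides)
    then have "monomial w' * var i \<in> P" using Suc.prems by (simp add: var_def monomial_mult)
    then consider "var i \<in> P" | "monomial w' \<in> P" using prime_mult by blast
    then show ?case
    proof cases
      case 2
      have "d = mdeg w'" using Suc.hyps(2) arg_cong [OF w, of mdeg] by (simp add: mdeg_add)
      then obtain i' where "0 < lookup w' i'" "var i' \<in> P" using Suc.hyps(1) 2 by blast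
      then show ?thesis using w by (metis add_pos_nonneg lookup_add zero_le)
    qed (use i in blast)
  qed
  show ?thesis
  proof (rule antisym)
    show "P \<subseteq> ideal.span (var ` {i. var i \<in> P})"
      using graded var_factor by (fastforce simp: mem_span_vars)
    show "ideal.span (var ` {i. var i \<in> P}) \<subseteq> P"
      by (rule ideal.span_minimal) (use sub in auto)
  qed
qed

text \<open>The variables are sorted by the number of members of the chain that miss them, so those
  lying in the small members come first.\<close>

lemma chain_numbering:
  fixes \<N> :: "'n::finite set set"
  assumes chain: "\<And>M N. M \<in> \<N> \<Longrightarrow> N \<in> \<N> \<Longrightarrow> M \<subseteq> N \<or> N \<subseteq> M"
  shows "\<exists>v. numbering v \<and> (\<forall>N\<in>\<N>. \<exists>k\<le>CARD('n). N = v ` {1..k})"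
proof -
  define r where "r x = card {N \<in> \<N>. x \<notin> N}" for x
  obtain xs :: "'n list" where xs: "set xs = UNIV" "distinct xs"
    using finite_distinct_list [of "UNIV :: 'n set"] by auto
  define ys where "ys = sort_key r xs"
  have ys: "set ys = UNIV" "distinct ys" "sorted (map r ys)"
    using xs by (simp_all add: ys_def)
  have len: "length ys = CARD('n)" using ys distinct_card by metis
  define v where "v i = ys ! (i - 1)" for i
  have bij: "bij_betw v {1..CARD('n)} UNIV"
  proof -
    have "bij_betw (\<lambda>i. i - 1) {1..CARD('n)} {..<length ys}"
      unfolding len by (rule bij_betw_byWitness [where f' = Suc]) auto
    then have "bij_betw ((!) ys \<circ> (\<lambda>i. i - 1)) {1..CARD('n)} (set ys)"
      using bij_betw_nth [OF ys(2) refl refl] by (rule bij_betw_trans)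
    then show ?thesis using ys(1) by (simp add: v_def [abs_def] o_def)
  qed
  have down: "ys ! i' \<in> N" if N: "N \<in> \<N>" and "ys ! i \<in> N" "i' \<le> i" "i < length ys" for N i i'
  proof (rule ccontr)
    assume "ys ! i' \<notin> N"
    \<comment> \<open>A member missing \<open>ys ! i\<close> cannot contain N, so it lies inside N
      and misses \<open>ys ! i'\<close> as well; N itself makes the inclusion strict.\<close>
    have "{M \<in> \<N>. ys ! i \<notin> M} \<subset> {M \<in> \<N>. ys ! i' \<notin> M}"
      using chain [OF _ N] \<open>ys ! i' \<notin> N\<close> \<open>ys ! i \<in> N\<close> N by blast
    then have "r (ys ! i) < r (ys ! i')"
      unfolding r_def by (intro psubset_card_mono) auto
    moreover have "r (ys ! i') \<le> r (ys ! i)"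
      using sorted_nth_mono [OF ys(3), of i' i] that by simp
    ultimately show False by simp
  qed
  have "\<exists>k\<le>CARD('n). N = v ` {1..k}" if N: "N \<in> \<N>" for N
  proof -
    define k where "k = (LEAST m. m = length ys \<or> ys ! m \<notin> N)"
    have k: "k = length ys \<or> ys ! k \<notin> N" unfolding k_def by (rule LeastI [of _ "length ys"]) simp
    have k_le: "k \<le> length ys" unfolding k_def by (rule Least_le) simp
    have below: "ys ! i \<in> N" if "i < k" for i
      using not_less_Least [of i "\<lambda>m. m = length ys \<or> ys ! m \<notin> N"] that by (simp add: k_def)
    have above: "i < k" if "i < length ys" "ys ! i \<in> N" for i
      using down [OF N that(2), of k] k that by (metis leI le_less_trans order_less_irrefl)
    have "N = (!) ys ` {..<k}"
    proof (intro equalityI subsetI)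
      fix x assume x: "x \<in> N"
      obtain i where "i < length ys" "x = ys ! i" using ys(1) by (metis UNIV_I in_set_conv_nth)
      then show "x \<in> (!) ys ` {..<k}" using above x by blast
    qed (use below in auto)
    also have "{..<k} = (\<lambda>i. i - 1) ` {1..k}"
    proof (intro equalityI subsetI)
      fix i assume "i \<in> {..<k}"
      then show "i \<in> (\<lambda>i. i - 1) ` {1..k}" by (intro image_eqI [of _ _ "Suc i"]) auto
    qed auto
    finally have "N = v ` {1..k}" by (simp add: image_image v_def)
    then show ?thesis using k_le len by auto
  qed
  then show ?thesis using bij unfolding numbering_def by blast
qed

lemma exists_adapted_numbering:
  fixes I :: "('n::finite, 'k::field) mpoly set"
  assumes I: "monomial_ideal I" and chain: "\<forall>P\<in>Ass I. \<forall>Q\<in>Ass I. P \<subseteq> Q \<or> Q \<subseteq> P"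
  shows "\<exists>v. adapted_numbering I v"
proof -
  have "\<exists>v. numbering v \<and> (\<forall>N\<in>(\<lambda>P. {i. var i \<in> P}) ` Ass I. \<exists>k\<le>CARD('n). N = v ` {1..k})"
  proof (rule chain_numbering)
    fix M N
    assume "M \<in> (\<lambda>P. {i. var i \<in> P}) ` Ass I" "N \<in> (\<lambda>P. {i. var i \<in> P}) ` Ass I"
    then obtain P Q where "P \<in> Ass I" "M = {i. var i \<in> P}" "Q \<in> Ass I" "N = {i. var i \<in> Q}"
      by (elim imageE)
    moreover from this have "P \<subseteq> Q \<or> Q \<subseteq> P" using chain by simp
    ultimately show "M \<subseteq> N \<or> N \<subseteq> M" by auto
  qed
  then obtain v where v: "numbering v"
    "\<forall>N\<in>(\<lambda>P. {i. var i \<in> P}) ` Ass I. \<exists>k\<le>CARD('n). N = v ` {1..k}"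
    by (elim exE conjE)
  have "\<exists>k\<le>CARD('n). P = ideal.span ((\<lambda>i. var (v i)) ` {1..k})" if P: "P \<in> Ass I" for P
  proof -
    obtain k where k: "k \<le> CARD('n)" "{i. var i \<in> P} = v ` {1..k}"
      using bspec [OF v(2) imageI [OF P]] by blast
    have "P = ideal.span ((\<lambda>i. var (v i)) ` {1..k})"
      using Ass_monomial_ideal [OF I P] unfolding k(2) image_image .
    then show ?thesis using k(1) by blast
  qed
  then show ?thesis using v(1) unfolding adapted_numbering_def by blast
qed

text \<open>A large exponent of \<open>x\<close> makes \<open>x\<close> a nonzerodivisor modulo \<open>I : u\<close>; enlarging \<open>u\<close> until as many
  variables as possible annihilate it then produces an associated prime without \<open>x\<close>.\<close>

lemma exists_Ass_avoiding:
  fixes I :: "('n::finite, 'k::field) mpoly set"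
  assumes I: "monomial_ideal I" and uI: "monomial u \<notin> I"
    and large: "\<And>m. m \<in> min_gens I \<Longrightarrow> lookup m x \<le> lookup u x"
    and y: "monomial (u + single y 1) \<in> I"
  shows "\<exists>P\<in>Ass I. var y \<in> P \<and> var x \<notin> P"
proof -
  define N where "N f = {z. monomial (f + single z 1) \<in> I}" for f
  let ?S = "\<lambda>f. u \<preceq> f \<and> monomial f \<notin> I"
  have "\<exists>f. ?S f \<and> (\<forall>f'. ?S f' \<longrightarrow> card (N f') \<le> card (N f))"
    using uI by (intro ex_has_greatest_nat [of _ u _ "Suc CARD('n)"])
      (auto simp: less_Suc_eq_le intro: card_mono)
  then obtain f where f: "u \<preceq> f" "monomial f \<notin> I"
    and f_max: "\<And>f'. u \<preceq> f' \<Longrightarrow> monomial f' \<notin> I \<Longrightarrow> card (N f') \<le> card (N f)"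
    by blast
  \<comment> \<open>Multiplying f by a monomial outside I : f cannot enlarge the set N, by
    maximality; so a variable outside \<open>N f\<close> never brings the product into I.\<close>
  have avoid: "monomial (f + w) \<notin> I" if "\<forall>z\<in>N f. lookup w z = 0" for w
    using that
  proof (induction "mdeg w" arbitrary: w)
    case 0
    then have "w = 0" by (simp add: mdeg_eq_0_iff)
    then show ?case using f by simp
  next
    case (Suc d)
    then obtain z where z: "0 < lookup w z" by (metis mdeg_pos_obtain zero_less_Suc)
    define w' where "w' = w - single z 1"
    have w: "w' + single z 1 = w" unfolding w'_def using z by (intro divides_diff_add single_divides)
    have "d = mdeg w'" using Suc.hyps(2) arg_cong [OF w, of mdeg] by (simp add: mdeg_add)
    moreover have "\<forall>z\<in>N f. lookup w' z = 0" using Suc.prems by (simp add: w'_def lookup_minus)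
    ultimately have w'I: "monomial (f + w') \<notin> I" using Suc.hyps(1) by blast
    have "N f \<subseteq> N (f + w')"
    proof
      fix z assume "z \<in> N f"
      moreover have "f + single z 1 \<preceq> f + w' + single z 1" by (simp add: divides_def lookup_add)
      ultimately show "z \<in> N (f + w')" using monomial_ideal_divides [OF I] unfolding N_def by blast
    qed
    moreover have "card (N (f + w')) \<le> card (N f)"
      using f_max w'I f(1) divides_trans divides_add(1) by blast
    ultimately have "N (f + w') = N f" by (metis card_seteq finite)
    moreover have "z \<notin> N f" using Suc.prems z by auto
    ultimately have "z \<notin> N (f + w')" by simp
    then show ?case using w by (simp add: N_def add.assoc)
  qed
  let ?P = "ideal.span (var ` N f) :: ('n, 'k) mpoly set"
  have "monomial (f + w) \<in> I \<longleftrightarrow> (\<exists>z\<in>N f. 0 < lookup w z)" for w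
  proof
    assume "\<exists>z\<in>N f. 0 < lookup w z"
    then obtain z where z: "z \<in> N f" "0 < lookup w z" by blast
    then have "f + single z 1 \<preceq> f + w"
      by (auto simp: divides_def lookup_add lookup_single when_def)
    then show "monomial (f + w) \<in> I" using z(1) monomial_ideal_divides [OF I] unfolding N_def by blast
  next
    assume "monomial (f + w) \<in> I"
    then show "\<exists>z\<in>N f. 0 < lookup w z" using avoid [of w] by (metis neq0_conv)
  qed
  moreover have "keys (g * monomial f) = (\<lambda>w. f + w) ` keys g" for g :: "('n, 'k) mpoly"
  proof (intro equalityI subsetI)
    fix t assume "t \<in> keys (g * monomial f)"
    then have "f \<preceq> t" "t - f \<in> keys g"
      by (auto simp: in_keys_iff mult.commute [of g] lookup_monomial_mult split: if_splits)
    then show "t \<in> (\<lambda>w. f + w) ` keys g"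
      using divides_diff_add [of f t] by (intro image_eqI [of _ _ "t - f"]) (auto simp: add.commute)
  qed (auto simp: in_keys_iff mult.commute [of g] lookup_monomial_mult)
  ultimately have P: "?P = {g. g * monomial f \<in> I}"
    by (intro set_eqI) (subst mem_Collect_eq, subst monomial_ideal_mem_iff [OF I], simp add: mem_span_vars)
  then have "?P \<in> Ass I"
    using prime_ideal_vars unfolding Ass_def by blast
  moreover have "y \<in> N f"
  proof -
    have "u + single y 1 \<preceq> f + single y 1" using f(1) by (simp add: divides_def lookup_add)
    then show ?thesis using monomial_ideal_divides [OF I y] unfolding N_def by blast
  qed
  then have "var y \<in> ?P" by (intro ideal.span_base imageI)
  \<comment> \<open>No generator has a larger exponent at x than u, hence than f, so a generator
    dividing x f already divides f.\<close>
  moreover have "x \<notin> N f"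
  proof
    assume "x \<in> N f"
    then obtain m where m: "m \<in> min_gens I" "m \<preceq> f + single x 1"
      using min_gens_divides unfolding N_def by blast
    have "lookup m i \<le> lookup f i" for i
    proof (cases "i = x")
      case True
      then show ?thesis using large [OF m(1)] f(1) unfolding divides_def by (metis le_trans)
    next
      case False
      then have "lookup (f + single x 1) i = lookup f i" by (simp add: lookup_add lookup_single when_def)
      then show ?thesis using m(2) unfolding divides_def by metis
    qed
    then have "m \<preceq> f" by (simp add: divides_def)
    moreover have "monomial m \<in> I" using m(1) by (simp add: min_gens_def)
    ultimately have "monomial f \<in> I" using monomial_ideal_divides [OF I] by blast
    then show False using f(2) by blast
  qed
  then have "var x \<notin> ?P"
    by (simp add: var_mem_span_vars)
  ultimately show ?thesis by blast
qed

lemma adapted_exists_sat: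
  fixes I :: "('n::finite, 'k::field) mpoly set"
  assumes I: "monomial_ideal I" and adapted: "adapted_numbering I v"
  shows "\<exists>e. koszul.sat v I e"
proof -
  interpret koszul v by unfold_locales (use adapted in \<open>simp add: adapted_numbering_def\<close>)
  \<comment> \<open>D exceeds every exponent of a generator; \<open>Suc\<close> also makes it
    positive, so a variable with exponent at least D does occur.\<close>
  define D where "D = Suc (Max (insert 0 (mdeg ` min_gens I)))"
  have D: "lookup m x < D" if "m \<in> min_gens I" for m x
  proof -
    have "lookup m x \<le> mdeg m" unfolding mdeg_def by (rule member_le_sum) auto
    also have "\<dots> \<le> Max (insert 0 (mdeg ` min_gens I))" using that finite_min_gens [of I] by (intro Max_ge) auto
    finally show ?thesis by (simp add: D_def)
  qed
  \<comment> \<open>By the pigeonhole principle a monomial of degree at least n D has an exponent at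
    least D.\<close>
  have "sat I (CARD('n) * D)"
    unfolding sat_def
  proof (intro ballI allI impI, rule ccontr)
    fix k u
    assume k: "k \<in> vars" and above: "\<forall>m\<in>vars. k < m \<longrightarrow> lookup u (v m) = 0"
      and deg: "CARD('n) * D \<le> mdeg u" and xu: "monomial (u + single (v k) 1) \<in> I" and uI: "monomial u \<notin> I"
    have "\<exists>x. D \<le> lookup u x"
    proof (rule ccontr)
      assume "\<not> ?thesis"
      then have "mdeg u < (\<Sum>x\<in>(UNIV :: 'n set). D)"
        unfolding mdeg_def by (intro sum_strict_mono) (auto simp: not_le)
      then show False using deg by simp
    qed
    then obtain j where j: "j \<in> vars" "D \<le> lookup u (v j)" using ex_var by metis
    then have "0 < lookup u (v j)" by (simp add: D_def)
    then have "j \<le> k" using above j(1) by (metis less_irrefl not_le)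
    obtain P where P: "P \<in> Ass I" "var (v k) \<in> P" "var (v j) \<notin> P"
      using exists_Ass_avoiding [OF I uI _ xu, of "v j"] D j(2) by (meson le_trans less_imp_le)
    obtain q where q: "q \<le> CARD('n)" "P = ideal.span ((\<lambda>i. var (v i)) ` {1..q})"
      using adapted P(1) unfolding adapted_numbering_def by blast
    have vars_P: "var (v l) \<in> P \<longleftrightarrow> v l \<in> v ` {1..q}" for l
      unfolding q(2) image_image [of var v, symmetric] by (rule var_mem_span_vars)
    then obtain i where i: "i \<in> {1..q}" "v i = v k"
      using P(2) by (metis imageE)
    \<comment> \<open>P = (x_1, ..., x_q) contains x_k, hence also x_j, as j \<le> k.\<close>
    then have "i = k" using v_eq_iff [of i k] k q(1) by (auto simp: indices_def)
    then have "j \<in> {1..q}" using i(1) \<open>j \<le> k\<close> j(1) by (auto simp: indices_def)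
    then have "var (v j) \<in> P" unfolding vars_P by (rule imageI)
    then show False using P(3) by blast
  qed
  then show ?thesis ..
qed

theorem corollary1p8:
  fixes I :: "('n::finite, 'k::field) mpoly set"
  assumes "infinite (UNIV :: 'k set)"
    and "CARD('n) \<ge> 2"
    and "monomial_ideal I"
    and "I \<noteq> {0}"
    and "\<forall>P\<in>Ass I. \<forall>Q\<in>Ass I. P \<subseteq> Q \<or> Q \<subseteq> P"
  shows "(\<exists>v. adapted_numbering I v) \<and>
    (\<forall>v. adapted_numbering I v \<longrightarrow>
      is_minimum (regularity I)
        {e. (\<forall>u\<in>min_gens I. int (mdeg u) \<le> e) \<and> stable_ideal v (truncation I e)})"
proof (intro conjI allI impI)
  show "\<exists>v. adapted_numbering I v"
    using exists_adapted_numbering assms by blast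
next
  fix v assume adapted: "adapted_numbering I v"
  then interpret koszul v by unfold_locales (simp add: adapted_numbering_def)
  \<comment> \<open>\<open>sat\<close> is indexed by naturals, so a least exponent exists once some
    exponent works; negative integers are excluded from the set by
    \<open>stable_truncation_iff_sat\<close>.\<close>
  define e where "e = (LEAST e. sat I e)"
  have e: "sat I e"
    unfolding e_def using adapted_exists_sat [OF assms(3) adapted] by (rule LeastI_ex)
  have least: "e \<le> e'" if "sat I e'" for e'
    unfolding e_def using that by (rule Least_le)
  have "regularity I = int e"
    using regularity_eq [OF numbering assms(3,4) e least] .
  then show "is_minimum (regularity I)
      {e. (\<forall>u\<in>min_gens I. int (mdeg u) \<le> e) \<and> stable_ideal v (truncation I e)}"
    unfolding stable_truncation_iff_sat [OF assms(3,4)] is_minimum_def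
    using e least by (auto simp flip: le_nat_iff)
qed

end
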